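(* Let $V$ be an $n$-dimensional vector space over the finite field $\mathbb F_q$ together with a non-degenerate symplectic, hermitian or symmetric form of Witt index $d\ge 2$, and let $m\in\{1,\dots,d\}$. Let $\mathcal N_m$ be the set of all $m$-dimensional totally isotropic subspaces of $V$. For $0\le i\le j\le m$ let $n_{i,j}$ be the valency of the relation $$\{(S,U)\in\mathcal N_m\times\mathcal N_m:\ \dim_l(S^\perp\cap U)=m-i,\ \dim_l(S\cap U)=m-j\}.$$ Then all valencies $n_{i,j}$ ($0\le i\le j\le m$) are pairwise distinct; that is, $n_{i,j}\neq n_{i',j'}$ whenever $(i,j)\neq(i',j')$.
   Context: $\dim_l$ is the linear dimension of a vector subspace. $S^\perp$ is the orthogonal complement of $S$ with respect to the given form. A subspace is totally isotropic if the form vanishes on it (totally singular, in the case of a quadratic form); the Witt index is the maximal dimension of such a subspace. The valency of the relation is the number of $U\in\mathcal N_m$ in relation with a given $S\in\mathcal N_m$ (this number does not depend on $S$).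
   Formalization: Pairs whose relations are both empty (both valencies 0) are excluded, as are quadratic forms with q=2, n=2d, m=d-1, where n_{0,1}=n_{1,1}. In characteristic 2, "symmetric form" is read as quadratic form, since non-alternating symmetric bilinear forms need not have constant valency. *)

theory Defs
  imports Complex_Main "HOL-Library.Cardinality"
begin

text \<open>
  A form is either a map of two arguments (symplectic, hermitian, symmetric) or a quadratic form.
  Symmetric bilinear forms are used in characteristic other than 2; the orthogonal geometries in
  characteristic 2 are given by quadratic forms. (A symmetric, non-alternating bilinear form in
  characteristic 2 does not define a polar space in general, and the relations below then need
  not have a constant valency.) In odd characteristic the constructor for quadratic forms is
  redundant.
\<close>

datatype ('f, 'v) form =
    is_sesqui: Sesqui "'v \<Rightarrow> 'v \<Rightarrow> 'f"
  | is_quad: Quad "'v \<Rightarrow> 'f"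

definition polarization :: "('v::ab_group_add \<Rightarrow> 'f::ab_group_add) \<Rightarrow> 'v \<Rightarrow> 'v \<Rightarrow> 'f" where
  "polarization Q x y = Q (x + y) - Q x - Q y"

primrec pairing :: "('f::ab_group_add, 'v::ab_group_add) form \<Rightarrow> 'v \<Rightarrow> 'v \<Rightarrow> 'f" where
  "pairing (Sesqui \<beta>) = \<beta>"
| "pairing (Quad Q) = polarization Q"

primrec vanishes_on :: "('f::zero, 'v) form \<Rightarrow> 'v set \<Rightarrow> bool" where
  "vanishes_on (Sesqui \<beta>) S \<longleftrightarrow> (\<forall>x\<in>S. \<forall>y\<in>S. \<beta> x y = 0)"
| "vanishes_on (Quad Q) S \<longleftrightarrow> (\<forall>x\<in>S. Q x = 0)"

definition orth :: "('f::ab_group_add, 'v::ab_group_add) form \<Rightarrow> 'v set \<Rightarrow> 'v set" where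
  "orth F S = {x. \<forall>s\<in>S. pairing F s x = 0}"

definition field_involution :: "('f::field \<Rightarrow> 'f) \<Rightarrow> bool" where
  "field_involution \<sigma> \<longleftrightarrow>
     (\<forall>a b. \<sigma> (a + b) = \<sigma> a + \<sigma> b) \<and> (\<forall>a b. \<sigma> (a * b) = \<sigma> a * \<sigma> b) \<and>
     (\<forall>a. \<sigma> (\<sigma> a) = a) \<and> \<sigma> \<noteq> id"

definition bilinear_form ::
    "('f::field \<Rightarrow> 'v::ab_group_add \<Rightarrow> 'v) \<Rightarrow> ('v \<Rightarrow> 'v \<Rightarrow> 'f) \<Rightarrow> bool" where
  "bilinear_form scale \<beta> \<longleftrightarrow>
     (\<forall>y. Vector_Spaces.linear scale (*) (\<lambda>x. \<beta> x y)) \<and>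
     (\<forall>x. Vector_Spaces.linear scale (*) (\<lambda>y. \<beta> x y))"

definition symplectic_form ::
    "('f::field \<Rightarrow> 'v::ab_group_add \<Rightarrow> 'v) \<Rightarrow> ('v \<Rightarrow> 'v \<Rightarrow> 'f) \<Rightarrow> bool" where
  "symplectic_form scale \<beta> \<longleftrightarrow> bilinear_form scale \<beta> \<and> (\<forall>x. \<beta> x x = 0)"

text \<open>Semilinearity in the second argument follows from the other two conditions.\<close>

definition hermitian_form ::
    "('f::field \<Rightarrow> 'v::ab_group_add \<Rightarrow> 'v) \<Rightarrow> ('v \<Rightarrow> 'v \<Rightarrow> 'f) \<Rightarrow> bool" where
  "hermitian_form scale \<beta> \<longleftrightarrow>
     (\<exists>\<sigma>. field_involution \<sigma> \<and>
          (\<forall>y. Vector_Spaces.linear scale (*) (\<lambda>x. \<beta> x y)) \<and>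
          (\<forall>x y. \<beta> y x = \<sigma> (\<beta> x y)))"

definition symmetric_form ::
    "('f::field \<Rightarrow> 'v::ab_group_add \<Rightarrow> 'v) \<Rightarrow> ('v \<Rightarrow> 'v \<Rightarrow> 'f) \<Rightarrow> bool" where
  "symmetric_form scale \<beta> \<longleftrightarrow> bilinear_form scale \<beta> \<and> (\<forall>x y. \<beta> x y = \<beta> y x)"

definition quadratic_form ::
    "('f::field \<Rightarrow> 'v::ab_group_add \<Rightarrow> 'v) \<Rightarrow> ('v \<Rightarrow> 'f) \<Rightarrow> bool" where
  "quadratic_form scale Q \<longleftrightarrow>
     (\<forall>c x. Q (scale c x) = c\<^sup>2 * Q x) \<and> bilinear_form scale (polarization Q)"

text \<open>
  A quadratic form is non-degenerate if no nonzero singular vector lies in the radical of its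
  polarization; in characteristic 2 and odd dimension that radical itself is nonzero.
\<close>

definition nondegenerate_form ::
    "('f::field \<Rightarrow> 'v::ab_group_add \<Rightarrow> 'v) \<Rightarrow> ('f, 'v) form \<Rightarrow> bool" where
  "nondegenerate_form scale F \<longleftrightarrow>
     (case F of
        Sesqui \<beta> \<Rightarrow>
          (symplectic_form scale \<beta> \<or> hermitian_form scale \<beta> \<or>
           symmetric_form scale \<beta> \<and> (2::'f) \<noteq> 0) \<and>
          (\<forall>x. (\<forall>y. \<beta> x y = 0) \<longrightarrow> x = 0)
      | Quad Q \<Rightarrow>
          quadratic_form scale Q \<and>
          (\<forall>x. Q x = 0 \<and> (\<forall>y. polarization Q x y = 0) \<longrightarrow> x = 0))"

definition witt_index ::
    "('f::field \<Rightarrow> 'v::ab_group_add \<Rightarrow> 'v) \<Rightarrow> ('f, 'v) form \<Rightarrow> nat" where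
  "witt_index scale F =
     Max {vector_space.dim scale S | S. module.subspace scale S \<and> vanishes_on F S}"

definition isotropic_subspaces ::
    "('f::field \<Rightarrow> 'v::ab_group_add \<Rightarrow> 'v) \<Rightarrow> ('f, 'v) form \<Rightarrow> nat \<Rightarrow> 'v set set" where
  "isotropic_subspaces scale F m =
     {S. module.subspace scale S \<and> vanishes_on F S \<and> vector_space.dim scale S = m}"

definition isotropic_relation ::
    "('f::field \<Rightarrow> 'v::ab_group_add \<Rightarrow> 'v) \<Rightarrow>
     ('f, 'v) form \<Rightarrow> nat \<Rightarrow> nat \<Rightarrow> nat \<Rightarrow> ('v set \<times> 'v set) set" where
  "isotropic_relation scale F m i j =
     {(S, U) \<in> isotropic_subspaces scale F m \<times> isotropic_subspaces scale F m.
        vector_space.dim scale (orth F S \<inter> U) = m - i \<and>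
        vector_space.dim scale (S \<inter> U) = m - j}"

text \<open>The description below only determines a number if the count does not depend on \<open>S\<close>.\<close>

definition valency :: "'x set \<Rightarrow> ('x \<times> 'x) set \<Rightarrow> nat" where
  "valency N R = (THE k. \<forall>S\<in>N. card (R `` {S}) = k)"

end

theory Submission
  imports Defs "HOL-Number_Theory.Number_Theory"
begin

text \<open>
  Let \<open>q = p^f\<close> be the number of scalars, and put \<open>k = j - i\<close>, \<open>l = m - j\<close>, \<open>D = d - m\<close>.

  Counting. A subspace \<open>U\<close> related to \<open>S\<close> carries the flag \<open>U \<inter> S \<subseteq> U \<inter> S\<^sup>\<bottom> \<subseteq> U\<close> with dimensions
  \<open>l\<close>, \<open>l + k\<close>, \<open>m\<close>. The ordered bases of \<open>U\<close> adapted to this flag are built one vector at a time,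
  and the number of candidates for the next vector depends on dimensions only. This rests on
  \<open>card_sing_orthc\<close>: the number of singular vectors orthogonal to a totally isotropic subspace is
  determined by its dimension. Besides \<open>q\<close>, \<open>dim V\<close> and \<open>d\<close> only one number depends on the type of
  form, the number \<open>t\<close> of singular vectors on a line \<open>y + \<langle>x\<rangle>\<close> with \<open>x\<close> singular and not
  orthogonal to \<open>y\<close>; it is a power of \<open>p\<close>. Counting all adapted lists in two ways (\<open>card_related\<close>)
  gives the valency \<open>N\<close> in the closed form (\<open>card_related_closed_form\<close>)

  \<open>N G(l) G(k)^2 G(i) G(D - k) = G(m) G(D) (\<Prod>D-k \<le> c < D. s q^c + 1) s^i q^(k^2 + 2 D i + i(i-1)/2)\<close>

  with \<open>G(n) = (\<Prod>1 \<le> c \<le> n. q^c - 1)\<close> and \<open>s = t q^(dim V - 2 d)\<close>, again a power of \<open>p\<close>.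

  Distinctness. Let \<open>(i, k)\<close> and \<open>(i', k')\<close> give the same number, with \<open>i \<le> i'\<close>. The factors
  \<open>q^c - 1\<close> are prime to \<open>p\<close>, and so are the factors \<open>s q^c + 1\<close>, apart from a single 2 that
  occurs for \<open>p = 2\<close>, \<open>s = 1\<close>, \<open>k = D\<close>. Comparing the exponents of \<open>p\<close>, and the numbers themselves
  in a few small cases, leaves only \<open>k' < k\<close> and \<open>i < i'\<close>, and, unless \<open>i' - i < k - k'\<close>, only the
  situation of a hyperbolic quadric over two scalars with \<open>d = m + 1\<close>. After cancelling common
  factors there remains an identity between products of terms \<open>q^c - 1\<close> and \<open>s q^c + 1\<close> over short
  intervals of \<open>c\<close>, with a square on one side. Such an identity is impossible
  (\<open>no_balanced_identity\<close>): by Zsigmondy's theorem (\<open>primitive_prime_exists\<close>) the largest exponent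
  of \<open>p\<close> has a prime divisor of its own, so that this exponent occurs equally often on both sides;
  a second primitive prime, for the next smaller exponent, settles the cases that this leaves
  open. It follows that the intervals that start beyond \<open>i\<close> and \<open>l\<close> lie at least as high as that
  of the square. The smallest exponent of \<open>p\<close> then belongs to the terms next to \<open>c = D - k\<close>, and
  modulo the following power of \<open>p\<close> the two sides differ. Zsigmondy's exception \<open>2^6 - 1\<close> leaves a
  finite list of parameters, for which the identity is refuted by evaluation.
\<close>

section \<open>Singular vectors in polar geometries\<close>

text \<open>
  The properties of a form that the count uses, so that all types of forms are treated at once.
  \<open>perp_hyperplane\<close> says that the vectors orthogonal to \<open>x\<close> have codimension at most 1, and \<open>t\<close>
  counts the singular vectors on an affine line in the direction of a singular vector \<open>x\<close> that is
  not orthogonal to the line.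
\<close>

locale polar_geometry = finite_dimensional_vector_space scale Basis
  for scale :: "'f::{field,finite} \<Rightarrow> 'v::ab_group_add \<Rightarrow> 'v" and Basis :: "'v set" +
  fixes perp :: "'v \<Rightarrow> 'v \<Rightarrow> bool" and sing :: "'v \<Rightarrow> bool" and t q :: nat
  assumes q_def: "q = CARD('f)"
    and perp_sym: "perp x y \<Longrightarrow> perp y x"
    and perp_subspace: "subspace {y. perp x y}"
    and perp_hyperplane: "\<not> perp x y \<Longrightarrow> \<exists>c. perp x (z - scale c y)"
    and sing_zero: "sing 0"
    and sing_scale: "sing x \<Longrightarrow> sing (scale c x)"
    and sing_add: "sing x \<Longrightarrow> sing y \<Longrightarrow> perp x y \<Longrightarrow> sing (x + y)"
    and sing_perp: "sing x \<Longrightarrow> perp x x"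
    and nondegenerate: "sing x \<Longrightarrow> (\<And>y. perp x y) \<Longrightarrow> x = 0"
    and card_sing_line: "sing x \<Longrightarrow> \<not> perp x y \<Longrightarrow> card {c. sing (y + scale c x)} = t"
begin

lemma q_ge_2: "q \<ge> 2"
proof -
  have "card {0, 1::'f} \<le> q" unfolding q_def by (intro card_mono) auto
  thus ?thesis by simp
qed

lemma card_span_insert:
  assumes "subspace P" "finite P" "x \<notin> P"
  shows "finite (span (insert x P))" "card (span (insert x P)) = q * card P"
proof -
  have eq: "span (insert x P) = (\<lambda>(c, p). scale c x + p) ` (UNIV \<times> P)"
  proof (intro Set.set_eqI iffI)
    fix y assume "y \<in> span (insert x P)"
    then obtain c where "y - scale c x \<in> span P"
      by (auto simp: span_breakdown_eq)
    moreover have "span P = P" using assms span_eq_iff by blast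
    ultimately have "y - scale c x \<in> P" by simp
    thus "y \<in> (\<lambda>(c, p). scale c x + p) ` (UNIV \<times> P)"
      by (intro image_eqI[of _ _ "(c, y - scale c x)"]) auto
  next
    fix y assume "y \<in> (\<lambda>(c, p). scale c x + p) ` (UNIV \<times> P)"
    then obtain c p where "y = scale c x + p" "p \<in> P" by auto
    hence "y - scale c x \<in> span P" by (simp add: span_base)
    thus "y \<in> span (insert x P)" by (auto simp: span_breakdown_eq)
  qed
  have "inj_on (\<lambda>(c, p). scale c x + p) (UNIV \<times> P)"
  proof (rule inj_onI, clarify)
    fix c p c' p' assume *: "p \<in> P" "p' \<in> P" "scale c x + p = scale c' x + p'"
    hence "scale (c - c') x = p' - p" by (simp add: scale_left_diff_distrib algebra_simps)
    hence mem: "scale (c - c') x \<in> P" using * assms subspace_diff by metis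
    have "c = c'"
    proof (rule ccontr)
      assume "c \<noteq> c'"
      hence "scale (inverse (c - c')) (scale (c - c') x) = x" by simp
      thus False using mem assms subspace_scale by metis
    qed
    thus "c = c' \<and> p = p'" using * by simp
  qed
  thus "card (span (insert x P)) = q * card P"
    unfolding eq q_def by (simp add: card_image card_cartesian_product)
  show "finite (span (insert x P))" unfolding eq using assms by simp
qed

lemma card_span_independent:
  assumes "finite B" "independent B"
  shows "finite (span B) \<and> card (span B) = q ^ card B"
  using assms
proof (induction B rule: finite_induct)
  case (insert b B)
  hence "independent B" "b \<notin> span B" by (auto simp: independent_insert)
  moreover have "span (insert b B) = span (insert b (span B))"
    by (metis span_breakdown_eq span_span subsetI subset_antisym)
  ultimately show ?case
    using insert card_span_insert[of "span B" b] by simp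
qed (simp add: span_empty)

lemma finite_UNIV_vectors: "finite (UNIV :: 'v set)"
  using card_span_independent[OF finite_Basis independent_Basis] span_Basis by simp

lemma finite_vectors [simp]: "finite (A :: 'v set)"
  by (rule finite_subset[OF subset_UNIV finite_UNIV_vectors])

lemma card_subspace:
  assumes "subspace S" shows "card S = q ^ dim S"
proof -
  obtain B where "B \<subseteq> S" "independent B" "S \<subseteq> span B" "card B = dim S"
    using basis_exists[of S] by blast
  moreover from this have "span B = S" using assms span_subspace by blast
  ultimately show ?thesis using card_span_independent[of B] by simp
qed

lemma card_subspace_eq_iff:
  assumes "subspace S" shows "card S = q ^ r \<longleftrightarrow> dim S = r"
  using card_subspace[OF assms] q_ge_2 by simp

lemma card_sum_subspaces:
  assumes "subspace A" "subspace B"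
  shows "card (span (A \<union> B)) * card (A \<inter> B) = card A * card B"
proof -
  have "span (A \<union> B) = {x + y |x y. x \<in> A \<and> y \<in> B}"
  proof -
    have "span A = A" "span B = B" using assms span_eq_iff by blast+
    thus ?thesis unfolding span_Un by (simp only:)
  qed
  hence "dim (span (A \<union> B)) + dim (A \<inter> B) = dim A + dim B"
    using dim_sums_Int[OF assms] by simp
  thus ?thesis using assms
    by (simp add: card_subspace subspace_inter flip: power_add)
qed

definition orthc :: "'v set \<Rightarrow> 'v set" where
  "orthc A = {y. \<forall>a\<in>A. perp a y}"

lemma orthc_eq_Inter: "orthc A = (\<Inter>a\<in>A. {y. perp a y})"
  by (auto simp: orthc_def)

lemma subspace_orthc [simp]: "subspace (orthc A)"
  unfolding orthc_eq_Inter by (intro subspace_Inter) (auto simp: perp_subspace)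

lemma subset_orthc_sym: "A \<subseteq> orthc B \<Longrightarrow> B \<subseteq> orthc A"
  unfolding orthc_def using perp_sym by blast

lemma orthc_span: "orthc (span A) = orthc A"
proof
  show "orthc (span A) \<subseteq> orthc A" unfolding orthc_def using span_base by blast
  have "A \<subseteq> orthc (orthc A)" by (rule subset_orthc_sym) simp
  hence "span A \<subseteq> orthc (orthc A)" by (intro span_minimal) auto
  thus "orthc A \<subseteq> orthc (span A)" by (rule subset_orthc_sym)
qed

lemma orthc_Un: "orthc (A \<union> B) = orthc A \<inter> orthc B"
  by (auto simp: orthc_def)

lemma card_hyperplane_section:
  assumes "subspace B" "b \<in> B" "\<not> perp a b"
  shows "card B = q * card (B \<inter> {y. perp a y})"
proof -
  let ?H = "B \<inter> {y. perp a y}"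
  have sub: "subspace ?H" using assms perp_subspace subspace_inter by blast
  have "span (insert b ?H) = B"
  proof
    show "span (insert b ?H) \<subseteq> B" using assms by (intro span_minimal) auto
    show "B \<subseteq> span (insert b ?H)"
    proof
      fix z assume "z \<in> B"
      obtain c where "perp a (z - scale c b)" using perp_hyperplane assms by blast
      hence "z - scale c b \<in> ?H"
        using \<open>z \<in> B\<close> assms subspace_diff subspace_scale by blast
      thus "z \<in> span (insert b ?H)" by (auto simp: span_breakdown_eq intro: span_base)
    qed
  qed
  thus ?thesis using card_span_insert(2)[OF sub, of b] assms by simp
qed

text \<open>
  For each \<open>a \<in> A\<close> the vectors of \<open>B\<close> orthogonal to \<open>a\<close> are either all of \<open>B\<close> or a hyperplane of
  \<open>B\<close>.
\<close>

lemma card_perp_pairs: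
  assumes "subspace A" "subspace B"
  shows "q * card {(a, b) \<in> A \<times> B. perp a b} =
    card A * card B + (q - 1) * (card (A \<inter> orthc B) * card B)"
proof -
  have "{(a, b) \<in> A \<times> B. perp a b} = (SIGMA a:A. B \<inter> {y. perp a y})" by auto
  hence "q * card {(a, b) \<in> A \<times> B. perp a b} = (\<Sum>a\<in>A. q * card (B \<inter> {y. perp a y}))"
    by (simp add: sum_distrib_left)
  also have "\<dots> = (\<Sum>a\<in>A. card B + (if a \<in> orthc B then (q - 1) * card B else 0))"
  proof (intro sum.cong refl)
    fix a assume "a \<in> A"
    show "q * card (B \<inter> {y. perp a y}) = card B + (if a \<in> orthc B then (q - 1) * card B else 0)"
    proof (cases "a \<in> orthc B")
      case True
      hence "B \<inter> {y. perp a y} = B" using perp_sym by (auto simp: orthc_def)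
      moreover have "q = 1 + (q - 1)" using q_ge_2 by simp
      hence "q * card B = card B + (q - 1) * card B" by (metis add_mult_distrib mult_1)
      ultimately show ?thesis using True by simp
    next
      case False
      then obtain b where "b \<in> B" "\<not> perp a b" using perp_sym by (auto simp: orthc_def)
      thus ?thesis using card_hyperplane_section[OF assms(2)] False by simp
    qed
  qed
  also have "\<dots> = card A * card B + (\<Sum>a\<in>A. if a \<in> orthc B then (q - 1) * card B else 0)"
    by (simp add: sum.distrib)
  also have "(\<Sum>a\<in>A. if a \<in> orthc B then (q - 1) * card B else 0) =
      (\<Sum>a\<in>A \<inter> orthc B. (q - 1) * card B)"
    by (simp only: sum.inter_restrict[OF finite_vectors])
  finally show ?thesis by (simp add: mult_ac)
qed

text \<open>
  The number of orthogonal pairs is symmetric in \<open>A\<close> and \<open>B\<close>. It serves as dimension formula for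
  orthogonal complements and holds even where the polarization of a quadratic form is degenerate.
\<close>

lemma card_pairing:
  assumes "subspace A" "subspace B"
  shows "card A * card (B \<inter> orthc A) = card B * card (A \<inter> orthc B)"
proof -
  have "card {(a, b) \<in> A \<times> B. perp a b} = card {(b, a) \<in> B \<times> A. perp b a}"
    by (rule bij_betw_same_card[of "\<lambda>(a, b). (b, a)"])
      (auto simp: bij_betw_def inj_on_def image_iff intro: perp_sym)
  hence "(q - 1) * (card (A \<inter> orthc B) * card B) = (q - 1) * (card (B \<inter> orthc A) * card A)"
    using card_perp_pairs[OF assms] card_perp_pairs[OF assms(2,1)] by (simp add: mult.commute)
  thus ?thesis using q_ge_2 by (simp add: mult.commute)
qed

text \<open>
  Totally isotropic, or totally singular in the case of a quadratic form.
\<close>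

definition ti :: "'v set \<Rightarrow> bool" where
  "ti S \<longleftrightarrow> subspace S \<and> (\<forall>x\<in>S. sing x) \<and> S \<subseteq> orthc S"

lemma tiD: "ti S \<Longrightarrow> subspace S" "ti S \<Longrightarrow> x \<in> S \<Longrightarrow> sing x" "ti S \<Longrightarrow> S \<subseteq> orthc S"
  by (auto simp: ti_def)

lemma ti_zero: "ti {0}"
  unfolding ti_def using subspace_0[OF subspace_orthc, of "{0}"] by (simp add: sing_zero)

lemma ti_subset: "ti A \<Longrightarrow> subspace B \<Longrightarrow> B \<subseteq> A \<Longrightarrow> ti B"
  unfolding ti_def orthc_def by blast

lemma ti_sum:
  assumes "ti A" "ti B" "B \<subseteq> orthc A"
  shows "ti (span (A \<union> B))"
  unfolding ti_def
proof (intro conjI ballI)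
  show "subspace (span (A \<union> B))" by simp
  fix x assume "x \<in> span (A \<union> B)"
  then obtain a b where "a \<in> A" "b \<in> B" "x = a + b"
    using assms tiD(1) by (auto simp: span_Un span_eq_iff[THEN iffD2])
  thus "sing x" using assms sing_add tiD(2) by (auto simp: orthc_def)
next
  have "A \<union> B \<subseteq> orthc (A \<union> B)"
    using assms tiD(3)[of A] tiD(3)[of B] subset_orthc_sym[OF assms(3)] by (simp add: orthc_Un)
  hence "A \<union> B \<subseteq> orthc (span (A \<union> B))" by (simp add: orthc_span)
  thus "span (A \<union> B) \<subseteq> orthc (span (A \<union> B))" by (intro span_minimal) auto
qed

lemma ti_line: "sing x \<Longrightarrow> ti (span {x})"
  unfolding ti_def
proof (intro conjI ballI)
  assume x: "sing x"
  show "subspace (span {x})" by simp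
  show "sing y" if "y \<in> span {x}" for y
    using that x sing_scale by (auto simp: span_singleton)
  have "{x} \<subseteq> orthc (span {x})" using x sing_perp by (simp add: orthc_span) (simp add: orthc_def)
  thus "span {x} \<subseteq> orthc (span {x})" by (intro span_minimal) auto
qed

lemma span_insert_eq: "span (insert x A) = span (A \<union> span {x})"
proof
  show "span (insert x A) \<subseteq> span (A \<union> span {x})"
    by (intro span_mono) (auto intro: span_base)
  have "span {x} \<subseteq> span (insert x A)" by (intro span_mono) auto
  moreover have "A \<subseteq> span (insert x A)" by (auto intro: span_base)
  ultimately show "span (A \<union> span {x}) \<subseteq> span (insert x A)" by (intro span_minimal) auto
qed

lemma ti_insert:
  assumes "ti A" "sing x" "x \<in> orthc A"
  shows "ti (span (insert x A))"
proof -
  have "span {x} \<subseteq> orthc A" using assms by (intro span_minimal) auto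
  thus ?thesis unfolding span_insert_eq[of x A] using assms ti_line by (intro ti_sum) auto
qed

lemma card_orthc_ti:
  assumes "ti A" shows "card A * card (orthc A) = q ^ dim UNIV"
proof -
  have "A \<inter> orthc UNIV = {0}"
  proof
    show "A \<inter> orthc UNIV \<subseteq> {0}"
      using assms nondegenerate tiD(2) perp_sym by (fastforce simp: orthc_def)
    show "{0} \<subseteq> A \<inter> orthc UNIV"
      using assms subspace_0 tiD(1) subspace_orthc by blast
  qed
  thus ?thesis
    using card_pairing[OF tiD(1)[OF assms] subspace_UNIV] card_subspace[OF subspace_UNIV] by simp
qed

text \<open>
  The vectors of \<open>W\<close> that are not orthogonal to \<open>x\<close> form lines in the direction of \<open>x\<close>, each with
  \<open>q\<close> vectors, \<open>t\<close> of them singular.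
\<close>

lemma card_sing_not_perp:
  assumes "subspace W" "x \<in> W" "sing x"
  shows "q * card {z \<in> W. sing z \<and> \<not> perp x z} = t * card {z \<in> W. \<not> perp x z}"
proof -
  let ?W = "{z \<in> W. \<not> perp x z}"
  have shift: "perp x (z + scale c x) \<longleftrightarrow> perp x z" for z c
  proof -
    have x: "scale c x \<in> {y. perp x y}"
      using assms sing_perp perp_subspace[of x] subspace_scale by blast
    hence "z + scale c x \<in> {y. perp x y} \<longleftrightarrow> z \<in> {y. perp x y}"
      using perp_subspace[of x] by (metis add_diff_cancel_right' subspace_add subspace_diff)
    thus ?thesis by simp
  qed
  have "(\<Sum>z\<in>?W. \<Sum>c\<in>UNIV. of_bool (sing (z + scale c x))) =
      (\<Sum>c\<in>UNIV. \<Sum>z\<in>?W. of_bool (sing (z + scale c x)) :: nat)"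
    by (rule sum.swap)
  moreover have "(\<Sum>c\<in>UNIV. of_bool (sing (z + scale c x)) :: nat) = t" if "z \<in> ?W" for z
    using that card_sing_line[of x z] assms by (simp add: sum_of_bool_eq)
  moreover have "(\<Sum>z\<in>?W. of_bool (sing (z + scale c x)) :: nat) =
      card {z \<in> W. sing z \<and> \<not> perp x z}" for c
  proof -
    have "(\<Sum>z\<in>?W. of_bool (sing (z + scale c x)) :: nat) = (\<Sum>z\<in>?W. of_bool (sing z))"
    proof (rule sum.reindex_bij_witness[where i = "\<lambda>z. z - scale c x" and j = "\<lambda>z. z + scale c x"])
      fix z assume z: "z \<in> ?W"
      have c: "scale c x \<in> W" using assms subspace_scale by blast
      show "z + scale c x \<in> ?W" using z c shift[of z c] subspace_add[OF assms(1)] by simp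
      show "z - scale c x \<in> ?W"
        using z c shift[of "z - scale c x" c] subspace_diff[OF assms(1)] by simp
    qed auto
    also have "\<dots> = card (?W \<inter> {z. sing z})" by (simp add: sum_of_bool_eq)
    also have "?W \<inter> {z. sing z} = {z \<in> W. sing z \<and> \<not> perp x z}" by auto
    finally show ?thesis .
  qed
  ultimately show ?thesis by (simp add: q_def mult.commute del: sum_of_bool_eq)
qed

definition sing_orthc :: "'v set \<Rightarrow> 'v set" where
  "sing_orthc A = {z \<in> orthc A. sing z}"

text \<open>
  A singular vector orthogonal to \<open>A\<close> either is orthogonal to \<open>x\<close> as well, or is counted by
  \<open>card_sing_not_perp\<close> with \<open>W = orthc A\<close>.
\<close>

lemma sing_orthc_step:
  assumes "ti A" "x \<in> sing_orthc A"
  shows "q * card (sing_orthc A) + t * card (orthc (span (insert x A))) =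
         q * card (sing_orthc (span (insert x A))) + t * card (orthc A)"
proof -
  have o: "orthc (span (insert x A)) = orthc A \<inter> {y. perp x y}"
    unfolding orthc_span by (auto simp: orthc_def)
  have x: "x \<in> orthc A" "sing x" using assms by (auto simp: sing_orthc_def)
  have ZU: "sing_orthc A = sing_orthc (span (insert x A)) \<union> {z \<in> orthc A. sing z \<and> \<not> perp x z}"
    unfolding sing_orthc_def o by auto
  have "sing_orthc (span (insert x A)) \<inter> {z \<in> orthc A. sing z \<and> \<not> perp x z} = {}"
    unfolding sing_orthc_def o by auto
  hence Z: "card (sing_orthc A) = card (sing_orthc (span (insert x A))) + card {z \<in> orthc A. sing z \<and> \<not> perp x z}"
    by (subst ZU, intro card_Un_disjoint) auto
  have OU: "orthc A = (orthc A \<inter> {y. perp x y}) \<union> {z \<in> orthc A. \<not> perp x z}" by auto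
  have O: "card (orthc A) = card (orthc (span (insert x A))) + card {z \<in> orthc A. \<not> perp x z}"
    unfolding o by (subst OU, intro card_Un_disjoint) auto
  have "q * card {z \<in> orthc A. sing z \<and> \<not> perp x z} = t * card {z \<in> orthc A. \<not> perp x z}"
    using x by (intro card_sing_not_perp) auto
  thus ?thesis using Z O by (simp add: algebra_simps)
qed

text \<open>
  By \<open>sing_orthc_step\<close>, extending \<open>B\<close> by one vector does not change the left-hand side.
\<close>

lemma sing_orthc_invariant:
  assumes "finite B" "independent B" "ti (span B)"
  shows "int q * card (sing_orthc (span B)) - int t * card (orthc (span B)) =
         int q * card (sing_orthc {0}) - int t * card (orthc {0})"
  using assms
proof (induction B rule: finite_induct)
  case (insert b B)
  have eq: "span (insert b B) = span (insert b (span B))"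
    by (metis span_breakdown_eq span_span subsetI subset_antisym)
  have B: "independent B" "ti (span B)"
    using insert ti_subset[OF insert.prems(2), of "span B"] span_mono[of B "insert b B"]
    by (auto simp: independent_insert split: if_splits)
  have "b \<in> span (insert b B)" by (simp add: span_base)
  moreover from this have "b \<in> orthc (span (insert b B))" using insert.prems(2) tiD(3) by blast
  ultimately have "b \<in> sing_orthc (span B)"
    using insert.prems(2) tiD(2) unfolding sing_orthc_def orthc_span by (auto simp: orthc_def)
  from sing_orthc_step[OF B(2) this] show ?case
    using insert.IH[OF B] unfolding eq
    by (simp add: algebra_simps flip: of_nat_mult of_nat_add)
qed (simp add: span_empty)

context
  fixes d :: nat
  assumes max_dim: "\<And>A. ti A \<Longrightarrow> dim A \<le> d"
    and max_ex: "\<exists>A. ti A \<and> dim A = d"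
begin

text \<open>
  The invariant is evaluated at a totally isotropic subspace \<open>M\<close> of dimension \<open>d\<close>; maximality of
  \<open>M\<close> means that every singular vector orthogonal to \<open>M\<close> lies in \<open>M\<close>.
\<close>

lemma card_sing_orthc:
  assumes "ti A"
  shows "real q * card (sing_orthc A) = q * q ^ d + t * (q ^ dim UNIV / q ^ dim A) - t * (q ^ dim UNIV / q ^ d)"
proof -
  have inv: "int q * card (sing_orthc A) - int t * card (orthc A) =
      int q * card (sing_orthc {0}) - int t * card (orthc {0})" if "ti A" for A
  proof -
    obtain B where "B \<subseteq> A" "independent B" "A \<subseteq> span B" "card B = dim A"
      using basis_exists[of A] by blast
    moreover from this have "span B = A" using tiD(1)[OF that] span_subspace by blast
    ultimately show ?thesis using sing_orthc_invariant[of B] that by simp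
  qed
  obtain M where M: "ti M" "dim M = d" using max_ex by blast
  have "sing_orthc M = M"
  proof
    show "M \<subseteq> sing_orthc M" using M tiD(2,3) unfolding sing_orthc_def by blast
    show "sing_orthc M \<subseteq> M"
    proof
      fix x assume x: "x \<in> sing_orthc M"
      show "x \<in> M"
      proof (rule ccontr)
        assume "x \<notin> M"
        have ti: "ti (span (insert x M))" using M x by (intro ti_insert) (auto simp: sing_orthc_def)
        have "card (span (insert x M)) = q * q ^ d"
          using card_span_insert(2)[of M x] \<open>x \<notin> M\<close> tiD(1)[OF M(1)] card_subspace[of M] M(2) by simp
        hence "dim (span (insert x M)) = Suc d"
          using card_subspace_eq_iff[of "span (insert x M)" "Suc d"] by simp
        thus False using max_dim[OF ti] by simp
      qed
    qed
  qed
  have orth: "real (card (orthc A)) = q ^ dim UNIV / q ^ dim A" if "ti A" for A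
  proof -
    have "real (card A * card (orthc A)) = real (q ^ dim UNIV)"
      by (simp only: card_orthc_ti[OF that])
    thus ?thesis using card_subspace[OF tiD(1)[OF that]] q_ge_2 by (simp add: field_simps)
  qed
  have "int q * card (sing_orthc A) - int t * card (orthc A) = int q * card (sing_orthc M) - int t * card (orthc M)"
    using inv[OF assms] inv[OF M(1)] by simp
  hence "real_of_int (int q * card (sing_orthc A) - int t * card (orthc A)) =
      real_of_int (int q * card (sing_orthc M) - int t * card (orthc M))" by (simp only:)
  thus ?thesis
    using orth[OF assms] orth[OF M(1)] card_subspace[OF tiD(1)[OF M(1)]]
    by (simp add: \<open>sing_orthc M = M\<close> M(2) algebra_simps)
qed

end

section \<open>Counting subspaces by adapted bases\<close>

text \<open>
  A list grows at its head; \<open>R\<close> sees the number and the span of the vectors already chosen.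
\<close>

fun chain :: "(nat \<Rightarrow> 'v set \<Rightarrow> 'v \<Rightarrow> bool) \<Rightarrow> 'v list \<Rightarrow> bool" where
  "chain R [] = True"
| "chain R (u # us) = (chain R us \<and> R (length us) (span (set us)) u)"

lemma finite_lists_of_length: "finite {us :: 'v list. P us \<and> length us = N}"
  by (rule finite_subset[OF _ finite_lists_length_eq[OF finite_UNIV_vectors, of N]]) auto

lemma card_chains:
  assumes "\<And>us. chain R us \<Longrightarrow> length us < N \<Longrightarrow>
      real (card {u. R (length us) (span (set us)) u}) = w (length us)"
  shows "real (card {us. chain R us \<and> length us = N}) = (\<Prod>r<N. w r)"
  using assms
proof (induction N)
  case 0
  have "{us. chain R us \<and> length us = 0} = {[]}" by auto
  thus ?case by simp
next
  case (Suc N)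
  let ?L = "{us. chain R us \<and> length us = N}"
  have "{us. chain R us \<and> length us = Suc N} =
      (\<lambda>(us, u). u # us) ` (SIGMA us:?L. {u. R (length us) (span (set us)) u})"
    by (force simp: length_Suc_conv image_iff)
  hence "card {us. chain R us \<and> length us = Suc N} =
      card (SIGMA us:?L. {u. R (length us) (span (set us)) u})"
    by (simp only:) (rule card_image, auto simp: inj_on_def)
  also have "\<dots> = (\<Sum>us\<in>?L. card {u. R (length us) (span (set us)) u})"
    using finite_lists_of_length by (intro card_SigmaI) auto
  also have "real \<dots> = (\<Sum>us\<in>?L. w N)"
    unfolding of_nat_sum by (intro sum.cong refl) (use Suc.prems in auto)
  also have "\<dots> = real (card ?L) * w N" by simp
  also have "real (card ?L) = (\<Prod>r<N. w r)" using Suc by simp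
  finally show ?case by simp
qed

lemma span_subspace_eq: "subspace P \<Longrightarrow> span P = P"
  by (simp add: span_eq_iff)

lemma zero_in_orthc: "0 \<in> orthc A"
  by (rule subspace_0) simp

lemma sing_orthc_span_Un: "u \<in> sing_orthc (span (A \<union> B)) \<longleftrightarrow> sing u \<and> u \<in> orthc A \<and> u \<in> orthc B"
  unfolding sing_orthc_def orthc_span orthc_Un by blast

text \<open>
  The choice of the next vector of an adapted basis when the subspace \<open>U\<close> to be built is not yet
  known: first \<open>l\<close> vectors from \<open>S\<close>, then \<open>k\<close> singular vectors orthogonal to \<open>S\<close> that enlarge
  \<open>S + P\<close>, and finally vectors that fail to be orthogonal to some vector of \<open>S \<inter> P\<^sup>\<bottom>\<close>.
\<close>

definition adapted_to :: "'v set \<Rightarrow> nat \<Rightarrow> nat \<Rightarrow> nat \<Rightarrow> 'v set \<Rightarrow> 'v \<Rightarrow> bool" where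
  "adapted_to S l k r P u \<longleftrightarrow>
     (if r < l then u \<in> S - P
      else if r < l + k then u \<in> sing_orthc (span (S \<union> P)) - span (S \<union> P)
      else u \<in> sing_orthc P - sing_orthc (span (P \<union> (S \<inter> orthc P))))"

text \<open>
  The same choice when \<open>U\<close> is given, along the flag \<open>U \<inter> S \<subseteq> U \<inter> S\<^sup>\<bottom> \<subseteq> U\<close>.
\<close>

definition adapted_in :: "'v set \<Rightarrow> 'v set \<Rightarrow> nat \<Rightarrow> nat \<Rightarrow> nat \<Rightarrow> 'v set \<Rightarrow> 'v \<Rightarrow> bool" where
  "adapted_in S U l k r P u \<longleftrightarrow>
     u \<in> (if r < l then U \<inter> S else if r < l + k then U \<inter> orthc S else U) - P"

text \<open>
  The neighbours of \<open>S\<close> in the relation with \<open>l = m - j\<close> and \<open>k = j - i\<close>.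
\<close>

definition related :: "'v set \<Rightarrow> nat \<Rightarrow> nat \<Rightarrow> nat \<Rightarrow> 'v set set" where
  "related S l k m = {U. ti U \<and> dim U = m \<and> dim (U \<inter> S) = l \<and> dim (U \<inter> orthc S) = l + k}"

lemma span_set_Cons: "span (set (u # us)) = span (insert u (span (set us)))"
proof
  show "span (set (u # us)) \<subseteq> span (insert u (span (set us)))"
    by (intro span_mono) (auto intro: span_base)
  have "span (set us) \<subseteq> span (set (u # us))" by (intro span_mono) auto
  moreover have "u \<in> span (set (u # us))" by (auto intro: span_base)
  ultimately show "span (insert u (span (set us))) \<subseteq> span (set (u # us))"
    by (intro span_minimal) auto
qed

text \<open>
  The dimension of \<open>S \<inter> P\<^sup>\<bottom>\<close>, from that of \<open>P \<inter> S\<^sup>\<bottom>\<close> by \<open>card_pairing\<close>.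
\<close>

lemma card_orthc_section:
  assumes "subspace P" "subspace S" "card P = q ^ r" "card S = q ^ m" "card (P \<inter> orthc S) = q ^ e"
    and "e \<le> r" "r \<le> m + e"
  shows "card (S \<inter> orthc P) = q ^ (m + e - r)"
proof -
  have "q ^ r * card (S \<inter> orthc P) = q ^ m * q ^ e"
    using card_pairing[OF assms(1,2)] assms by simp
  also have "\<dots> = q ^ r * q ^ (m + e - r)"
    using assms by (simp flip: power_add)
  finally show ?thesis using q_ge_2 by simp
qed

context
  fixes S :: "'v set" and l k m :: nat
  assumes S: "ti S" and dimS: "dim S = m" and lkm: "l + k \<le> m"
begin

lemma subS: "subspace S" and cardS: "card S = q ^ m" and S_orthc: "S \<subseteq> orthc S"
  using S dimS tiD card_subspace by auto

text \<open>
  The position of the span \<open>P\<close> of the first \<open>r\<close> vectors relative to \<open>S\<close>. For \<open>r = m\<close> it says that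
  \<open>P\<close> is related to \<open>S\<close>.
\<close>

definition flag_invariant :: "nat \<Rightarrow> 'v set \<Rightarrow> bool" where
  "flag_invariant r P \<longleftrightarrow> ti P \<and> card P = q ^ r \<and>
     (r \<le> l \<longrightarrow> P \<subseteq> S) \<and> (l \<le> r \<longrightarrow> card (P \<inter> S) = q ^ l) \<and>
     (l \<le> r \<and> r \<le> l + k \<longrightarrow> P \<subseteq> orthc S) \<and> (l + k \<le> r \<longrightarrow> card (P \<inter> orthc S) = q ^ (l + k))"

text \<open>
  In the second phase \<open>u\<close> is independent of \<open>S + P\<close>, so adding it does not enlarge \<open>P \<inter> S\<close>. In the
  last phase some \<open>x \<in> S \<inter> P\<^sup>\<bottom>\<close> is not orthogonal to \<open>u\<close>; a vector of \<open>P + \<langle>u\<rangle>\<close> orthogonal to \<open>S\<close>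
  then has no component along \<open>u\<close>, so \<open>P \<inter> S\<^sup>\<bottom>\<close> does not grow.
\<close>

lemma flag_invariant_Suc:
  assumes inv: "flag_invariant r P" and r: "r < m" and u: "adapted_to S l k r P u"
  shows "flag_invariant (Suc r) (span (insert u P))" "u \<notin> P"
    "r < l \<Longrightarrow> u \<in> S" "r < l + k \<Longrightarrow> u \<in> orthc S"
proof -
  have tiP: "ti P" and cP: "card P = q ^ r" using inv by (auto simp: flag_invariant_def)
  note subP = tiD(1)[OF tiP]
  let ?P = "span (insert u P)"
  have P_le: "P \<subseteq> ?P" and u_in: "u \<in> ?P" by (auto intro: span_base)
  have elim: "\<exists>c. x - scale c u \<in> P" if "x \<in> ?P" for x
    using that unfolding span_breakdown_eq span_subspace_eq[OF subP] .
  have S_P: "P \<subseteq> span (S \<union> P)" "S \<subseteq> span (S \<union> P)" by (auto intro: span_base)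
  have "u \<notin> P \<and> sing u \<and> u \<in> orthc P \<and> (r < l \<longrightarrow> u \<in> S) \<and> (r < l + k \<longrightarrow> u \<in> orthc S) \<and>
     (r < l \<longrightarrow> ?P \<subseteq> S) \<and>
     (l \<le> r \<longrightarrow> ?P \<inter> S = P \<inter> S) \<and> (l + k \<le> r \<longrightarrow> ?P \<inter> orthc S = P \<inter> orthc S)"
  proof (cases "r < l")
    case True
    hence "P \<subseteq> S" "u \<in> S" "u \<notin> P" using inv u by (auto simp: flag_invariant_def adapted_to_def)
    moreover from this have "?P \<subseteq> S" using subS by (intro span_minimal) auto
    moreover have "sing u" "u \<in> orthc S" using \<open>u \<in> S\<close> S tiD(2) S_orthc by auto
    moreover have "u \<in> orthc P" using \<open>u \<in> orthc S\<close> \<open>P \<subseteq> S\<close> by (auto simp: orthc_def)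
    ultimately show ?thesis using True by auto
  next
    case False
    show ?thesis
    proof (cases "r < l + k")
      case True
      have u': "u \<in> orthc (S \<union> P)" "sing u" "u \<notin> span (S \<union> P)"
        using u True False by (auto simp: adapted_to_def sing_orthc_def orthc_span)
      have "?P \<inter> S \<subseteq> P"
      proof
        fix x assume x: "x \<in> ?P \<inter> S"
        then obtain c where c: "x - scale c u \<in> P" using elim by auto
        have "scale c u \<in> span (S \<union> P)"
          using span_diff[of x "S \<union> P" "x - scale c u"] x c S_P by auto
        hence "c = 0" using u'(3) span_scale[of "scale c u" "S \<union> P" "inverse c"] by (cases "c = 0") auto
        thus "x \<in> P" using c by simp
      qed
      hence "?P \<inter> S = P \<inter> S" using P_le by auto
      thus ?thesis using u' True False S_P by (auto simp: orthc_Un)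
    next
      case False
      have uP: "u \<in> orthc P" "sing u"
        using u False \<open>\<not> r < l\<close> by (auto simp: adapted_to_def sing_orthc_def)
      moreover have "u \<notin> orthc (P \<union> (S \<inter> orthc P))"
        using u False \<open>\<not> r < l\<close> uP by (auto simp: adapted_to_def sing_orthc_def orthc_span)
      ultimately obtain x where x: "x \<in> S" "x \<in> orthc P" "\<not> perp x u"
        by (auto simp: orthc_Un) (auto simp: orthc_def)
      have xP: "perp x y" if "y \<in> P" for y using x(2) that perp_sym by (auto simp: orthc_def)
      have sub: "?P \<inter> orthc S \<subseteq> P"
      proof
        fix y assume y: "y \<in> ?P \<inter> orthc S"
        then obtain c where c: "y - scale c u \<in> P" using elim by auto
        have "y \<in> {y. perp x y}" "y - scale c u \<in> {y. perp x y}"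
          using y x xP[OF c] by (auto simp: orthc_def)
        hence "y - (y - scale c u) \<in> {y. perp x y}" using perp_subspace subspace_diff by blast
        hence "scale c u \<in> {y. perp x y}" by simp
        hence "c = 0" using x(3) subspace_scale[OF perp_subspace, of "scale c u" x "inverse c"]
          by (cases "c = 0") auto
        thus "y \<in> P" using c by simp
      qed
      have "u \<notin> P" using x(3) xP by auto
      moreover have "?P \<inter> orthc S = P \<inter> orthc S" using sub P_le by auto
      moreover from this have "?P \<inter> S = P \<inter> S" using S_orthc by auto
      ultimately show ?thesis using uP False \<open>\<not> r < l\<close> by auto
    qed
  qed
  hence *: "u \<notin> P" "sing u" "u \<in> orthc P" "r < l \<Longrightarrow> u \<in> S" "r < l + k \<Longrightarrow> u \<in> orthc S"
     "r < l \<Longrightarrow> ?P \<subseteq> S"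
     "l \<le> r \<Longrightarrow> ?P \<inter> S = P \<inter> S" "l + k \<le> r \<Longrightarrow> ?P \<inter> orthc S = P \<inter> orthc S"
    by blast+
  show "u \<notin> P" "r < l \<Longrightarrow> u \<in> S" "r < l + k \<Longrightarrow> u \<in> orthc S" by fact+
  have c: "card ?P = q ^ Suc r" using card_span_insert(2)[OF subP _ *(1)] cP by simp
  have sub_orthc: "?P \<subseteq> orthc S" if "r < l + k" "P \<subseteq> orthc S"
    using *(5)[OF that(1)] that(2) by (intro span_minimal) auto
  have PS: "P \<subseteq> orthc S" if "r < l + k"
    using inv that S_orthc by (cases "r \<le> l") (auto simp: flag_invariant_def)
  show "flag_invariant (Suc r) ?P"
    unfolding flag_invariant_def
  proof (intro conjI impI)
    show "ti ?P" using *(2,3) tiP by (intro ti_insert)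
    show "card ?P = q ^ Suc r" by fact
    show "?P \<subseteq> S" if "Suc r \<le> l" using *(6) that by simp
    show "card (?P \<inter> S) = q ^ l" if "l \<le> Suc r"
    proof (cases "l \<le> r")
      case True thus ?thesis using *(7) inv by (simp add: flag_invariant_def)
    next
      case False
      hence "l = Suc r" using that by simp
      thus ?thesis using *(6) c by (simp add: Int_absorb2)
    qed
    show "?P \<subseteq> orthc S" if "l \<le> Suc r \<and> Suc r \<le> l + k"
      using sub_orthc PS that by simp
    show "card (?P \<inter> orthc S) = q ^ (l + k)" if "l + k \<le> Suc r"
    proof (cases "l + k \<le> r")
      case True thus ?thesis using *(8) inv by (simp add: flag_invariant_def)
    next
      case False
      hence "l + k = Suc r" using that by simp
      thus ?thesis using sub_orthc PS c by (simp add: Int_absorb2)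
    qed
  qed
qed

lemma chain_adapted_invariant:
  assumes "chain (adapted_to S l k) us" "length us \<le> m"
  shows "flag_invariant (length us) (span (set us))"
  using assms
proof (induction us)
  case Nil
  have "P \<inter> {0} = {0}" if "subspace P" for P using that subspace_0 by auto
  thus ?case using ti_zero subspace_0[OF subS] subspace_orthc[of S] zero_in_orthc[of S]
    by (auto simp: flag_invariant_def span_empty Int_commute)
next
  case (Cons u us)
  have "flag_invariant (Suc (length us)) (span (insert u (span (set us))))"
    using Cons by (intro flag_invariant_Suc(1)) auto
  thus ?case using span_set_Cons[of u us] by simp
qed

lemma chain_adapted_to_imp_in:
  assumes "chain (adapted_to S l k) us" "length us \<le> m" "set us \<subseteq> U"
  shows "chain (adapted_in S U l k) us"
  using assms
proof (induction us)
  case (Cons u us)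
  have "flag_invariant (length us) (span (set us))"
    using Cons.prems by (intro chain_adapted_invariant) auto
  from flag_invariant_Suc(2-4)[OF this, of u] show ?case
    using Cons by (auto simp: adapted_in_def)
qed simp

text \<open>
  After \<open>l\<close> steps the chosen vectors span a subspace of \<open>U \<inter> S\<close> with as many elements, hence all
  of it; likewise for \<open>U \<inter> S\<^sup>\<bottom>\<close> after \<open>l + k\<close> steps.
\<close>

lemma chain_adapted_in_invariant:
  assumes U: "U \<in> related S l k m" and "chain (adapted_in S U l k) us" "length us \<le> m"
  shows "span (set us) \<subseteq> U \<and> card (span (set us)) = q ^ length us \<and>
    (length us \<le> l \<longrightarrow> span (set us) \<subseteq> S) \<and> (l \<le> length us \<longrightarrow> U \<inter> S \<subseteq> span (set us)) \<and>
    (length us \<le> l + k \<longrightarrow> span (set us) \<subseteq> orthc S) \<and>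
    (l + k \<le> length us \<longrightarrow> U \<inter> orthc S \<subseteq> span (set us))"
proof -
  have subU: "subspace U" using U tiD by (auto simp: related_def)
  have subs: "subspace (U \<inter> S)" "subspace (U \<inter> orthc S)"
    using subU subS subspace_inter by auto
  have cards: "card (U \<inter> S) = q ^ l" "card (U \<inter> orthc S) = q ^ (l + k)"
    using U subs card_subspace by (auto simp: related_def)
  have eq: "A \<subseteq> B" if "B \<subseteq> A" "card B = card A" for A B :: "'v set"
    using card_subset_eq[OF finite_vectors that] by simp
  have fill: "(length us \<le> l \<longrightarrow> span (set us) \<subseteq> S) \<Longrightarrow>
      (length us \<le> l + k \<longrightarrow> span (set us) \<subseteq> orthc S) \<Longrightarrow> span (set us) \<subseteq> U \<Longrightarrow>
      card (span (set us)) = q ^ length us \<Longrightarrow>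
      (length us = l \<longrightarrow> U \<inter> S \<subseteq> span (set us)) \<and>
      (length us = l + k \<longrightarrow> U \<inter> orthc S \<subseteq> span (set us))" for us
    using eq[of "span (set us)" "U \<inter> S"] eq[of "span (set us)" "U \<inter> orthc S"] cards by auto
  show ?thesis using assms(2,3)
  proof (induction us)
    case Nil
    show ?case using fill[of "[]"] subspace_0[OF subU] subspace_0[OF subS]
        subspace_0[OF subspace_orthc, of S] by (simp add: span_empty)
  next
    case (Cons u us)
    let ?P = "span (set us)" and ?r = "length us"
    note IH = Cons.IH
    have u: "u \<in> (if ?r < l then U \<inter> S else if ?r < l + k then U \<inter> orthc S else U) - ?P"
      and ch: "chain (adapted_in S U l k) us" "?r \<le> m"
      using Cons.prems unfolding chain.simps adapted_in_def[of S U l k ?r] by simp_all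
    have uU: "u \<in> U" "u \<notin> ?P" "?r < l \<Longrightarrow> u \<in> S" "?r < l + k \<Longrightarrow> u \<in> orthc S"
      using u S_orthc by (auto split: if_splits)
    have sp: "span (set (u # us)) = span (insert u ?P)" by (rule span_set_Cons)
    have P_le: "?P \<subseteq> span (set (u # us))" unfolding sp by (auto intro: span_base)
    have c: "card (span (set (u # us))) = q ^ length (u # us)"
      unfolding sp using card_span_insert(2)[of ?P u] uU(2) IH[OF ch] by simp
    have 1: "span (set (u # us)) \<subseteq> U"
      unfolding sp using uU(1) IH[OF ch] subU by (intro span_minimal) auto
    have 2: "length (u # us) \<le> l \<longrightarrow> span (set (u # us)) \<subseteq> S"
      unfolding sp using uU(3) IH[OF ch] subS by (intro impI span_minimal) auto
    have 3: "length (u # us) \<le> l + k \<longrightarrow> span (set (u # us)) \<subseteq> orthc S"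
      unfolding sp using uU(4) IH[OF ch] by (intro impI span_minimal) auto
    from fill[OF 2 3 1 c] IH[OF ch] P_le
    have 4: "l \<le> length (u # us) \<longrightarrow> U \<inter> S \<subseteq> span (set (u # us))"
      and 5: "l + k \<le> length (u # us) \<longrightarrow> U \<inter> orthc S \<subseteq> span (set (u # us))"
      by (auto simp: le_Suc_eq simp del: set_simps)
    show ?case using 1 2 3 4 5 c by blast
  qed
qed

text \<open>
  The point is the last phase. If \<open>u\<close> were orthogonal to \<open>S \<inter> P\<^sup>\<bottom>\<close>, then replacing \<open>P\<close> by
  \<open>P + \<langle>u\<rangle>\<close> would change neither \<open>S \<inter> P\<^sup>\<bottom>\<close> nor \<open>P \<inter> S\<^sup>\<bottom>\<close>, while \<open>card_pairing\<close> expresses the size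
  of \<open>P\<close> through theirs.
\<close>

lemma chain_adapted_in_imp_to:
  assumes U: "U \<in> related S l k m" and "chain (adapted_in S U l k) us" "length us \<le> m"
  shows "chain (adapted_to S l k) us"
  using assms(2,3)
proof (induction us)
  case (Cons u us)
  let ?P = "span (set us)" and ?r = "length us"
  have ch: "chain (adapted_in S U l k) us" "?r < m" using Cons.prems by auto
  have IH: "chain (adapted_to S l k) us" using Cons by simp
  have u: "u \<in> (if ?r < l then U \<inter> S else if ?r < l + k then U \<inter> orthc S else U) - ?P"
    using Cons.prems unfolding chain.simps adapted_in_def[of S U l k ?r] by simp
  have tiU: "ti U" using U by (auto simp: related_def)
  note inv = chain_adapted_in_invariant[OF U ch(1)]
  have inv': "flag_invariant ?r ?P" using chain_adapted_invariant IH ch by simp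
  have uU: "u \<in> U" "u \<notin> ?P" using u by (auto split: if_splits)
  have P_U: "?P \<subseteq> U" using inv ch by simp
  have "u \<in> orthc U" using tiD(3)[OF tiU] uU(1) by blast
  hence uP: "sing u" "u \<in> orthc ?P" using tiD(2)[OF tiU uU(1)] P_U by (auto simp: orthc_def)
  have "adapted_to S l k ?r ?P u"
  proof (cases "?r < l")
    case True thus ?thesis using u by (simp add: adapted_to_def)
  next
    case F1: False
    show ?thesis
    proof (cases "?r < l + k")
      case True
      have "u \<in> orthc S" using u True F1 by simp
      moreover have "u \<notin> span (S \<union> ?P)"
      proof
        assume "u \<in> span (S \<union> ?P)"
        then obtain s p where sp: "s \<in> S" "p \<in> ?P" "u = s + p"
          unfolding span_Un span_subspace_eq[OF subS] span_span by blast
        hence "s = u - p" by simp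
        hence "s \<in> U" using uU(1) sp(2) P_U tiD(1)[OF tiU] subspace_diff by blast
        hence "s \<in> ?P" using inv ch sp(1) F1 by auto
        thus False using sp uU(2) span_add by blast
      qed
      ultimately show ?thesis using True F1 uP unfolding adapted_to_def Diff_iff sing_orthc_span_Un by simp
    next
      case False
      have "u \<notin> orthc (S \<inter> orthc ?P)"
      proof
        assume "u \<in> orthc (S \<inter> orthc ?P)"
        let ?P' = "span (insert u ?P)"
        have "S \<inter> orthc ?P' = S \<inter> orthc ?P"
        proof -
          have "S \<inter> orthc ?P \<subseteq> orthc {u}"
            using \<open>u \<in> orthc (S \<inter> orthc ?P)\<close> by (rule subset_orthc_sym[of "{u}", simplified])
          moreover have "orthc ?P' = orthc ?P \<inter> orthc {u}"
            unfolding orthc_span[of "insert u ?P"] by (auto simp: orthc_def)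
          ultimately show ?thesis by blast
        qed
        moreover have "?P' \<inter> orthc S = ?P \<inter> orthc S"
        proof -
          have "?P' \<subseteq> U" using uU(1) P_U tiD(1)[OF tiU] by (intro span_minimal) auto
          moreover have "U \<inter> orthc S \<subseteq> ?P" using inv ch False by simp
          moreover have "?P \<subseteq> ?P'" by (auto intro: span_base)
          ultimately show ?thesis by auto
        qed
        ultimately have "card ?P' * card (S \<inter> orthc ?P) = card ?P * card (S \<inter> orthc ?P)"
          using card_pairing[of ?P' S] card_pairing[of ?P S] subS by simp
        moreover have "card (S \<inter> orthc ?P) > 0"
          using subspace_0[OF subspace_inter[OF subS subspace_orthc]] by (auto simp: card_gt_0_iff)
        ultimately have "card ?P' = card ?P" by (metis mult_cancel2 less_irrefl)
        hence "q * card ?P = card ?P" using card_span_insert(2)[of ?P u] uU(2) by simp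
        moreover have "card ?P > 0" using inv ch q_ge_2 by simp
        ultimately show False using q_ge_2 by simp
      qed
      thus ?thesis using F1 False uP unfolding adapted_to_def Diff_iff sing_orthc_span_Un unfolding sing_orthc_def by simp
    qed
  qed
  thus ?case using IH by simp
qed simp

text \<open>
  The span of an adapted list is related to \<open>S\<close>, and the list is an adapted basis of that span.
\<close>

lemma adapted_chains_eq:
  "{us. chain (adapted_to S l k) us \<and> length us = m} =
   (\<Union>U\<in>related S l k m. {us. chain (adapted_in S U l k) us \<and> length us = m})"
proof (intro Set.set_eqI iffI)
  fix us assume us: "us \<in> {us. chain (adapted_to S l k) us \<and> length us = m}"
  let ?U = "span (set us)"
  have inv: "flag_invariant m ?U" using us chain_adapted_invariant[of us] by simp
  hence "?U \<in> related S l k m"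
    using lkm tiD(1)[of ?U] subS card_subspace_eq_iff
    by (auto simp: flag_invariant_def related_def subspace_inter)
  moreover have "chain (adapted_in S ?U l k) us"
    using us by (intro chain_adapted_to_imp_in) (auto intro: span_base)
  ultimately show "us \<in> (\<Union>U\<in>related S l k m. {us. chain (adapted_in S U l k) us \<and> length us = m})"
    using us by blast
qed (use chain_adapted_in_imp_to in auto)

lemma adapted_chain_span:
  assumes "U \<in> related S l k m" "chain (adapted_in S U l k) us" "length us = m"
  shows "span (set us) = U"
proof -
  have "span (set us) \<subseteq> U" "card (span (set us)) = q ^ m"
    using chain_adapted_in_invariant[of U us] assms by auto
  moreover have "card U = q ^ m" using assms tiD card_subspace by (auto simp: related_def)
  ultimately show ?thesis using card_subset_eq[OF finite_vectors] by simp
qed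

lemma card_adapted_chains_in:
  assumes U: "U \<in> related S l k m"
  shows "real (card {us. chain (adapted_in S U l k) us \<and> length us = m}) =
    (\<Prod>r<m. real q ^ (if r < l then l else if r < l + k then l + k else m) - real q ^ r)"
proof (rule card_chains)
  fix us assume us: "chain (adapted_in S U l k) us" "length us < m"
  let ?r = "length us" and ?P = "span (set us)"
  let ?W = "if ?r < l then U \<inter> S else if ?r < l + k then U \<inter> orthc S else U"
  have tiU: "ti U" using U by (simp add: related_def)
  have subs: "subspace (U \<inter> S)" "subspace (U \<inter> orthc S)" "subspace U"
    using tiD(1)[OF tiU] subS subspace_inter by auto
  have cards: "card ?W = q ^ (if ?r < l then l else if ?r < l + k then l + k else m)"
    using U subs card_subspace by (auto simp: related_def)
  note inv = chain_adapted_in_invariant[OF U us(1) less_imp_le[OF us(2)]]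
  have sub: "?P \<subseteq> ?W" using inv by auto
  have "{u. adapted_in S U l k ?r ?P u} = ?W - ?P"
    unfolding adapted_in_def by blast
  hence "card {u. adapted_in S U l k ?r ?P u} = card ?W - card ?P"
    using card_Diff_subset[OF finite_vectors sub] by simp
  moreover have "card ?P \<le> card ?W" using sub by (intro card_mono) auto
  ultimately have "real (card {u. adapted_in S U l k ?r ?P u}) = real (card ?W) - real (card ?P)"
    by (simp add: of_nat_diff)
  also have "card ?P = q ^ ?r" using inv by blast
  finally show "real (card {u. adapted_in S U l k ?r ?P u}) =
      real q ^ (if ?r < l then l else if ?r < l + k then l + k else m) - real q ^ ?r"
    unfolding cards by simp
qed

text \<open>
  The excluded vectors form \<open>P\<close> of dimension \<open>r\<close>, then \<open>S + P\<close> of dimension \<open>m + r - l\<close>, and in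
  the last phase the singular vectors orthogonal to \<open>P + (S \<inter> P\<^sup>\<bottom>)\<close>, which is totally isotropic of
  dimension \<open>m + k\<close>.
\<close>

lemma card_adapted_chains_to:
  assumes "\<And>A. ti A \<Longrightarrow> dim A \<le> d" "\<exists>A. ti A \<and> dim A = d"
  shows "real (card {us. chain (adapted_to S l k) us \<and> length us = m}) =
    (\<Prod>r<m. if r < l then real q ^ m - real q ^ r
      else if r < l + k then real q ^ d + (t * q ^ dim UNIV / q ^ (m + r - l) - t * q ^ dim UNIV / q ^ d) / q
             - real q ^ (m + r - l)
      else (t * q ^ dim UNIV / q ^ r - t * q ^ dim UNIV / q ^ (m + k)) / q)"
proof (rule card_chains)
  fix us assume us: "chain (adapted_to S l k) us" "length us < m"
  let ?r = "length us" and ?P = "span (set us)"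
  have inv: "flag_invariant ?r ?P" using chain_adapted_invariant us by simp
  have tiP: "ti ?P" and cP: "card ?P = q ^ ?r" using inv by (auto simp: flag_invariant_def)
  have q0: "real q > 0" using q_ge_2 by simp
  have sing_orthc: "real (card (sing_orthc A)) = real q ^ d + (t * q ^ dim UNIV / q ^ e - t * q ^ dim UNIV / q ^ d) / q"
    if "ti A" "card A = q ^ e" for A e
  proof -
    have "dim A = e" using card_subspace_eq_iff that tiD by blast
    from card_sing_orthc[OF assms that(1)] this q0 show ?thesis by (simp add: field_simps)
  qed
  consider "?r < l" | "l \<le> ?r" "?r < l + k" | "l + k \<le> ?r" by linarith
  thus "real (card {u. adapted_to S l k ?r ?P u}) =
     (if ?r < l then real q ^ m - real q ^ ?r
      else if ?r < l + k then real q ^ d + (t * q ^ dim UNIV / q ^ (m + ?r - l) - t * q ^ dim UNIV / q ^ d) / q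
             - real q ^ (m + ?r - l)
      else (t * q ^ dim UNIV / q ^ ?r - t * q ^ dim UNIV / q ^ (m + k)) / q)"
  proof cases
    case 1
    hence sub: "?P \<subseteq> S" using inv by (simp add: flag_invariant_def)
    have "{u. adapted_to S l k ?r ?P u} = S - ?P" using 1 by (auto simp: adapted_to_def)
    hence "real (card {u. adapted_to S l k ?r ?P u}) = real (card S - card ?P)"
      using card_Diff_subset[OF finite_vectors sub] by simp
    also have "\<dots> = real q ^ m - real q ^ ?r"
      using cardS cP card_mono[OF finite_vectors sub] by (simp add: of_nat_diff)
    finally show ?thesis using 1 by simp
  next
    case 2
    let ?Q = "span (S \<union> ?P)"
    have P: "?P \<subseteq> orthc S" "card (?P \<inter> S) = q ^ l" using inv 2 by (auto simp: flag_invariant_def)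
    have tiQ: "ti ?Q" using S tiP P by (intro ti_sum)
    have "card ?Q * q ^ l = q ^ m * q ^ ?r"
      using card_sum_subspaces[OF subS subspace_span[of "set us"]] P(2) cardS cP by (simp add: Int_commute)
    also have "\<dots> = q ^ (m + ?r - l) * q ^ l" using 2 by (simp flip: power_add)
    finally have cQ: "card ?Q = q ^ (m + ?r - l)" using q_ge_2 by simp
    have sub: "?Q \<subseteq> sing_orthc ?Q" using tiD[OF tiQ] by (auto simp: sing_orthc_def)
    have "{u. adapted_to S l k ?r ?P u} = sing_orthc ?Q - ?Q" using 2 by (auto simp: adapted_to_def)
    hence "real (card {u. adapted_to S l k ?r ?P u}) = real (card (sing_orthc ?Q) - card ?Q)"
      using card_Diff_subset[OF finite_vectors sub] by simp
    also have "\<dots> = real (card (sing_orthc ?Q)) - real (card ?Q)"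
      using card_mono[OF finite_vectors sub] by (simp add: of_nat_diff)
    finally show ?thesis using 2 sing_orthc[OF tiQ cQ] cQ by simp
  next
    case 3
    let ?K = "S \<inter> orthc ?P" and ?Q = "span (?P \<union> (S \<inter> orthc ?P))"
    have subK: "subspace ?K" using subS subspace_inter by auto
    have PS: "card (?P \<inter> orthc S) = q ^ (l + k)" "card (?P \<inter> S) = q ^ l"
      using inv 3 by (auto simp: flag_invariant_def)
    have cK: "card ?K = q ^ (m + (l + k) - ?r)"
      using cP cardS PS(1) 3 us(2) by (intro card_orthc_section[OF _ subS]) auto
    have "?P \<inter> ?K = ?P \<inter> S" using tiD(3)[OF tiP] by blast
    hence "card ?Q * q ^ l = q ^ ?r * q ^ (m + (l + k) - ?r)"
      using card_sum_subspaces[OF subspace_span[of "set us"] subK] PS(2) cP cK by simp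
    also have "\<dots> = q ^ (m + k) * q ^ l" using 3 us(2) by (simp add: ac_simps flip: power_add)
    finally have cQ: "card ?Q = q ^ (m + k)" using q_ge_2 by simp
    have "ti ?K" using ti_subset[OF S subK] by simp
    hence tiQ: "ti ?Q" using tiP by (intro ti_sum) auto
    have sub: "sing_orthc ?Q \<subseteq> sing_orthc ?P" unfolding sing_orthc_span_Un subset_iff by (simp add: sing_orthc_def)
    have "{u. adapted_to S l k ?r ?P u} = sing_orthc ?P - sing_orthc ?Q" using 3 by (auto simp: adapted_to_def)
    hence "real (card {u. adapted_to S l k ?r ?P u}) = real (card (sing_orthc ?P) - card (sing_orthc ?Q))"
      using card_Diff_subset[OF finite_vectors sub] by simp
    also have "\<dots> = real (card (sing_orthc ?P)) - real (card (sing_orthc ?Q))"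
      using card_mono[OF finite_vectors sub] by (simp add: of_nat_diff)
    finally show ?thesis using 3 sing_orthc[OF tiQ cQ] sing_orthc[OF tiP cP] by (simp add: diff_divide_distrib)
  qed
qed

text \<open>
  Adapted lists are counted with and without reference to the subspace that they span; every
  related subspace has the same number of adapted bases.
\<close>

theorem card_related:
  assumes "\<And>A. ti A \<Longrightarrow> dim A \<le> d" "\<exists>A. ti A \<and> dim A = d"
  shows "real (card (related S l k m)) *
    (\<Prod>r<m. real q ^ (if r < l then l else if r < l + k then l + k else m) - real q ^ r) =
    (\<Prod>r<m. if r < l then real q ^ m - real q ^ r
      else if r < l + k then real q ^ d + (t * q ^ dim UNIV / q ^ (m + r - l) - t * q ^ dim UNIV / q ^ d) / q
             - real q ^ (m + r - l)
      else (t * q ^ dim UNIV / q ^ r - t * q ^ dim UNIV / q ^ (m + k)) / q)"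
proof -
  let ?C = "\<lambda>U. {us. chain (adapted_in S U l k) us \<and> length us = m}"
  have "card (\<Union>U\<in>related S l k m. ?C U) = (\<Sum>U\<in>related S l k m. card (?C U))"
  proof (rule card_UN_disjoint)
    show "finite (related S l k m)"
      by (rule finite_subset[of _ "Pow UNIV"]) (blast, simp only: finite_Pow_iff finite_vectors)
    show "\<forall>U\<in>related S l k m. finite (?C U)" using finite_lists_of_length by blast
    show "\<forall>U\<in>related S l k m. \<forall>V\<in>related S l k m. U \<noteq> V \<longrightarrow> ?C U \<inter> ?C V = {}"
      using adapted_chain_span by blast
  qed
  hence "real (card {us. chain (adapted_to S l k) us \<and> length us = m}) =
      (\<Sum>U\<in>related S l k m. real (card (?C U)))"
    by (simp add: adapted_chains_eq)
  also have "\<dots> = (\<Sum>U\<in>related S l k m.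
      (\<Prod>r<m. real q ^ (if r < l then l else if r < l + k then l + k else m) - real q ^ r))"
    using card_adapted_chains_in by (intro sum.cong refl)
  finally show ?thesis using card_adapted_chains_to[OF assms] by simp
qed

end

end

section \<open>Polar geometries of forms\<close>

text \<open>
  A subgroup \<open>B \<subseteq> A\<close> of maximal order among those whose order is a power of the characteristic \<open>p\<close>
  is all of \<open>A\<close>: adjoining \<open>x \<in> A - B\<close> gives \<open>p\<close> disjoint cosets of \<open>B\<close>.
\<close>

lemma card_additive_subgroup:
  fixes A :: "'f::{field,finite} set"
  assumes zero: "0 \<in> A" and add: "\<And>x y. x \<in> A \<Longrightarrow> y \<in> A \<Longrightarrow> x + y \<in> A"
  shows "\<exists>e. card A = CHAR('f) ^ e"
proof -
  let ?p = "CHAR('f)"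
  have p: "prime ?p"
    by (rule prime_CHAR_semidom) (rule finite_imp_CHAR_pos, simp)
  have mult: "of_nat j * x \<in> B" if "0 \<in> B" "\<And>x y. x \<in> B \<Longrightarrow> y \<in> B \<Longrightarrow> x + y \<in> B" "x \<in> B"
    for B and x :: 'f and j :: nat
    using that by (induction j) (auto simp: algebra_simps)
  define P where "P = (\<lambda>B. B \<subseteq> A \<and> 0 \<in> B \<and> (\<forall>x\<in>B. \<forall>y\<in>B. x + y \<in> B) \<and> (\<exists>e. card B = ?p ^ e))"
  have "P {0}" using zero by (auto simp: P_def intro: exI[of _ 0])
  moreover have "\<forall>B. P B \<longrightarrow> card B < Suc CARD('f)" by (auto intro: card_mono simp: less_Suc_eq_le)
  ultimately have "\<exists>B. P B \<and> (\<forall>C. P C \<longrightarrow> card C \<le> card B)"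
    by (rule ex_has_greatest_nat)
  then obtain B where B: "P B" and max: "\<And>C. P C \<Longrightarrow> card C \<le> card B" by blast
  have B': "B \<subseteq> A" "0 \<in> B" "\<And>x y. x \<in> B \<Longrightarrow> y \<in> B \<Longrightarrow> x + y \<in> B" using B by (auto simp: P_def)
  obtain e where e: "card B = ?p ^ e" using B by (auto simp: P_def)
  have minus: "x - y \<in> B" if "x \<in> B" "y \<in> B" for x y
  proof -
    have "of_nat (?p - 1) * y + y = of_nat (?p - 1 + 1) * y" by (simp add: algebra_simps)
    also have "?p - 1 + 1 = ?p" using prime_gt_0_nat[OF p] by simp
    finally have "of_nat (?p - 1) * y = - y" by (simp add: eq_neg_iff_add_eq_0)
    moreover have "x + of_nat (?p - 1) * y \<in> B" using B'(3) that mult[OF B'(2,3)] by blast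
    ultimately show ?thesis by simp
  qed
  have "A \<subseteq> B"
  proof (rule ccontr)
    assume "\<not> A \<subseteq> B"
    then obtain x where x: "x \<in> A" "x \<notin> B" by blast
    define h where "h = (\<lambda>(b, j). b + of_nat j * x)"
    define C where "C = h ` (B \<times> {..<?p})"
    have C: "b + of_nat j * x \<in> C" if "b \<in> B" for b and j :: nat
    proof -
      have "of_nat j = (of_nat (j mod ?p) :: 'f)"
        by (simp add: of_nat_eq_iff_cong_CHAR cong_def)
      moreover have "j mod ?p < ?p" using prime_gt_0_nat[OF p] by simp
      ultimately show ?thesis unfolding C_def h_def using that
        by (intro image_eqI[of _ _ "(b, j mod ?p)"]) auto
    qed
    have CA: "C \<subseteq> A" using B' add mult[OF zero add x(1)] by (auto simp: C_def h_def)
    have Cadd: "u + v \<in> C" if uv: "u \<in> C" "v \<in> C" for u v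
    proof -
      obtain b j b' j' where "u = b + of_nat j * x" "v = b' + of_nat j' * x" "b \<in> B" "b' \<in> B"
        using uv by (auto simp: C_def h_def)
      moreover from this have "u + v = (b + b') + of_nat (j + j') * x" by (simp add: algebra_simps)
      moreover have "(b + b') + of_nat (j + j') * x \<in> C"
        by (intro C B'(3)) fact+
      ultimately show ?thesis by (simp only:)
    qed
    have wlog: "j' \<le> j" if eq: "b + of_nat j * x = b' + of_nat j' * x"
      and "b \<in> B" "b' \<in> B" "j < ?p" "j' < ?p" for b b' j j'
    proof (rule ccontr)
      assume "\<not> j' \<le> j"
      define k where "k = j' - j"
      have "b - b' = of_nat k * x"
        using eq \<open>\<not> j' \<le> j\<close> by (simp add: k_def of_nat_diff algebra_simps)
      hence kx: "of_nat k * x \<in> B" using minus[OF that(2,3)] by simp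
      have "0 < k" "k < ?p" using \<open>\<not> j' \<le> j\<close> that by (auto simp: k_def)
      hence "coprime k ?p" using p by (metis coprime_commute nat_dvd_not_less prime_imp_coprime)
      then obtain u where "[k * u = Suc 0] (mod ?p)" using cong_solve_coprime_nat by blast
      hence "of_nat (k * u) = (of_nat 1 :: 'f)" unfolding of_nat_eq_iff_cong_CHAR by simp
      hence "of_nat u * (of_nat k * x) = x" by (simp add: mult_ac)
      moreover have "of_nat u * (of_nat k * x) \<in> B" using B'(2,3) kx by (rule mult)
      ultimately show False using x by (simp only:)
    qed
    have "inj_on h (B \<times> {..<?p})"
    proof (rule inj_onI)
      fix v v' assume *: "v \<in> B \<times> {..<?p}" "v' \<in> B \<times> {..<?p}" "h v = h v'"
      obtain b j b' j' where v: "v = (b, j)" "v' = (b', j')" by (cases v, cases v')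
      have eq: "b + of_nat j * x = b' + of_nat j' * x" using *(3) by (simp add: h_def v)
      have "j = j'" using wlog[OF eq] wlog[OF eq[symmetric]] * by (simp add: v)
      thus "v = v'" using eq by (simp add: v)
    qed
    hence "card C = card B * ?p" by (simp add: C_def card_image card_cartesian_product)
    hence "card C = ?p ^ Suc e" "card B < card C" using e prime_gt_1_nat[OF p] by auto
    moreover have "0 \<in> C" using C[OF B'(2), of 0] by simp
    ultimately have "P C" unfolding P_def using CA Cadd by blast
    thus False using max \<open>card B < card C\<close> by fastforce
  qed
  thus ?thesis using B' e by (metis subset_antisym)
qed

lemma bilinear_formD:
  assumes "bilinear_form scale \<beta>"
  shows "\<beta> (x + y) z = \<beta> x z + \<beta> y z" "\<beta> z (x + y) = \<beta> z x + \<beta> z y"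
    "\<beta> (scale c x) y = c * \<beta> x y" "\<beta> x (scale c y) = c * \<beta> x y"
proof -
  have "module_hom scale (*) (\<lambda>x. \<beta> x y)" "module_hom scale (*) (\<lambda>y. \<beta> x y)" for x y
    using assms by (auto simp: bilinear_form_def Vector_Spaces.linear_def)
  thus "\<beta> (x + y) z = \<beta> x z + \<beta> y z" "\<beta> z (x + y) = \<beta> z x + \<beta> z y"
    "\<beta> (scale c x) y = c * \<beta> x y" "\<beta> x (scale c y) = c * \<beta> x y"
    by (metis module_hom.add, metis module_hom.add, metis module_hom.scale, metis module_hom.scale)
qed

text \<open>
  The reflexive form \<open>B\<close> is additive and semilinear in its second argument; \<open>\<tau>\<close> is the identity
  unless the form is hermitian.
\<close>

lemma polar_geometry_reflexive:
  fixes scale :: "'f::{field,finite} \<Rightarrow> 'v::ab_group_add \<Rightarrow> 'v" and B :: "'v \<Rightarrow> 'v \<Rightarrow> 'f"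
  assumes fd: "finite_dimensional_vector_space scale Basis"
    and addR: "\<And>x y z. B z (x + y) = B z x + B z y"
    and scaleR: "\<And>c x y. B x (scale c y) = \<tau> c * B x y"
    and surj: "surj \<tau>"
    and refl: "\<And>x y. B x y = 0 \<Longrightarrow> B y x = 0"
    and sing: "sing 0" "\<And>x c. sing x \<Longrightarrow> sing (scale c x)"
      "\<And>x y. sing x \<Longrightarrow> sing y \<Longrightarrow> B x y = 0 \<Longrightarrow> sing (x + y)" "\<And>x. sing x \<Longrightarrow> B x x = 0"
    and nondeg: "\<And>x. sing x \<Longrightarrow> (\<And>y. B x y = 0) \<Longrightarrow> x = 0"
    and line: "\<And>x y. sing x \<Longrightarrow> B x y \<noteq> 0 \<Longrightarrow> card {c. sing (y + scale c x)} = t"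
  shows "polar_geometry scale Basis (\<lambda>x y. B x y = 0) sing t CARD('f)"
proof -
  interpret finite_dimensional_vector_space scale Basis by (rule fd)
  have minusR: "B z (x - y) = B z x - B z y" for x y z
    using addR[of z "x - y" y] by (simp add: algebra_simps)
  have zeroR: "B z 0 = 0" for z using minusR[of z 0 0] by simp
  show ?thesis
  proof unfold_locales
    show "subspace {y. B x y = 0}" for x
      by (rule subspaceI) (simp_all add: zeroR addR scaleR)
    show "\<exists>c. B x (z - scale c y) = 0" if "B x y \<noteq> 0" for x y z
    proof -
      obtain c where "\<tau> c = B x z / B x y" using surj by (metis surjD)
      hence "B x (z - scale c y) = 0" using that by (simp add: minusR scaleR)
      thus ?thesis ..
    qed
  qed (use refl sing nondeg line in auto)
qed

lemma singular_points_on_line_unique: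
  fixes a b :: "'f::field"
  assumes "b \<noteq> 0"
  shows "card {c. a + c * b = 0} = 1"
proof -
  have "{c. a + c * b = 0} = {- a / b}"
    using assms by (auto simp: field_simps eq_neg_iff_add_eq_0 add.commute)
  thus ?thesis by simp
qed

text \<open>
  Singularity of \<open>y + c x\<close> is an equation for the scalar \<open>c\<close>. It is linear for quadratic and
  symmetric forms (one solution) and void for symplectic forms (\<open>q\<close> solutions); for hermitian
  forms it prescribes \<open>w + \<sigma> w\<close> for a nonzero multiple \<open>w\<close> of \<open>c\<close>, and the solutions are a coset
  of an additive subgroup. The second part of the conclusion distinguishes, over the field with
  two elements, quadratic forms from the others: there \<open>2 = 0\<close> and no field involution exists, so
  that only symplectic forms with \<open>t = 2\<close> remain.
\<close>

lemma nondegenerate_form_polar_geometry: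
  fixes scale :: "'f::{field,finite} \<Rightarrow> 'v::ab_group_add \<Rightarrow> 'v" and F :: "('f, 'v) form"
  assumes fd: "finite_dimensional_vector_space scale Basis" and nd: "nondegenerate_form scale F"
  shows "\<exists>e. polar_geometry scale Basis (\<lambda>x y. pairing F x y = 0) (\<lambda>x. vanishes_on F {x})
      (CHAR('f) ^ e) CARD('f) \<and> (is_sesqui F \<longrightarrow> CARD('f) = 2 \<longrightarrow> e \<noteq> 0)"
proof (cases F)
  case (Quad Q)
  have qf: "quadratic_form scale Q" and nd': "\<And>x. Q x = 0 \<Longrightarrow> (\<And>y. polarization Q x y = 0) \<Longrightarrow> x = 0"
    using nd by (auto simp: Quad nondegenerate_form_def)
  have Qs: "Q (scale c x) = c\<^sup>2 * Q x" for c x using qf by (simp add: quadratic_form_def)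
  note bil = bilinear_formD[OF conjunct2[OF qf[unfolded quadratic_form_def]]]
  interpret finite_dimensional_vector_space scale Basis by (rule fd)
  have Qadd: "Q (x + y) = Q x + Q y + polarization Q x y" for x y by (simp add: polarization_def)
  have sym: "polarization Q x y = polarization Q y x" for x y
    by (simp add: polarization_def algebra_simps)
  have diag: "polarization Q x x = 0" if "Q x = 0" for x
  proof -
    have "x + x = scale (1 + 1) x" by (simp only: scale_left_distrib scale_one)
    hence "Q (x + x) = 0" using that by (simp add: Qs)
    thus ?thesis using that by (simp add: polarization_def)
  qed
  have "polar_geometry scale Basis (\<lambda>x y. polarization Q x y = 0) (\<lambda>x. Q x = 0) 1 CARD('f)"
  proof (rule polar_geometry_reflexive[where \<tau> = id, OF fd])
    show "Q 0 = 0" using Qs[of 0 0] by simp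
    show "card {c. Q (y + scale c x) = 0} = 1" if "Q x = 0" "polarization Q x y \<noteq> 0" for x y
    proof -
      have "Q (y + scale c x) = Q y + c * polarization Q x y" for c
        using that by (simp add: Qadd Qs bil sym)
      thus ?thesis using singular_points_on_line_unique[OF that(2), of "Q y"] by simp
    qed
  qed (simp_all add: bil sym Qs Qadd diag nd')
  thus ?thesis unfolding Quad by (intro exI[of _ 0]) simp
next
  case (Sesqui \<beta>)
  have nd': "\<And>x. (\<And>y. \<beta> x y = 0) \<Longrightarrow> x = 0" using nd by (auto simp: Sesqui nondegenerate_form_def)
  consider "symplectic_form scale \<beta>" | "hermitian_form scale \<beta>" | "symmetric_form scale \<beta>" "(2::'f) \<noteq> 0"
    using nd by (auto simp: Sesqui nondegenerate_form_def)
  thus ?thesis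
  proof cases
    case 1
    note bil = bilinear_formD[OF conjunct1[OF 1[unfolded symplectic_form_def]]]
    have alt: "\<beta> x x = 0" for x using 1 by (simp add: symplectic_form_def)
    have anti: "\<beta> y x = - \<beta> x y" for x y
    proof -
      have "\<beta> y x + \<beta> x y = \<beta> (x + y) (x + y)"
        by (simp only: bil alt[of x] alt[of y] add_0_left add_0_right add.commute)
      also have "\<dots> = 0" by (rule alt)
      finally show ?thesis by (simp only: eq_neg_iff_add_eq_0)
    qed
    have pg: "polar_geometry scale Basis (\<lambda>x y. \<beta> x y = 0) (\<lambda>x. \<beta> x x = 0) CARD('f) CARD('f)"
    proof (rule polar_geometry_reflexive[where \<tau> = id, OF fd])
      show "\<beta> y x = 0" if "\<beta> x y = 0" for x y using anti[of x y] that by simp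
    qed (simp_all add: bil alt nd')
    obtain e where e: "CARD('f) = CHAR('f) ^ e"
      using card_additive_subgroup[of "UNIV :: 'f set"] by auto
    have "e \<noteq> 0" if "CARD('f) = 2" using that e by (intro notI) simp
    thus ?thesis using pg unfolding Sesqui e by (intro exI[of _ e]) simp
  next
    case 3
    note bil = bilinear_formD[OF conjunct1[OF 3(1)[unfolded symmetric_form_def]]]
    have sym: "\<beta> x y = \<beta> y x" for x y using 3 by (simp add: symmetric_form_def)
    have pg: "polar_geometry scale Basis (\<lambda>x y. \<beta> x y = 0) (\<lambda>x. \<beta> x x = 0) 1 CARD('f)"
    proof (rule polar_geometry_reflexive[where \<tau> = id, OF fd])
      show "\<beta> 0 0 = 0" using bil(1)[of 0 0 0] by (metis add.right_neutral add_left_imp_eq)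
      show "\<beta> y x = 0" if "\<beta> x y = 0" for x y using sym[of x y] that by simp
      show "\<beta> (x + y) (x + y) = 0" if "\<beta> x x = 0" "\<beta> y y = 0" "\<beta> x y = 0" for x y
        using that sym[of x y] by (simp add: bil)
      show "card {c. \<beta> (y + scale c x) (y + scale c x) = 0} = 1" if "\<beta> x x = 0" "\<beta> x y \<noteq> 0" for x y
      proof -
        have "\<beta> (y + scale c x) (y + scale c x) = \<beta> y y + c * (2 * \<beta> x y)" for c
          using that(1) sym[of y x] by (simp add: bil algebra_simps)
        moreover have "2 * \<beta> x y \<noteq> 0" using that 3(2) by simp
        ultimately show ?thesis using singular_points_on_line_unique[of "2 * \<beta> x y" "\<beta> y y"]
          by presburger
      qed
    qed (simp_all add: bil nd')
    have "CARD('f) \<noteq> 2"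
    proof
      assume "CARD('f) = 2"
      hence "{0, 1} = (UNIV :: 'f set)" by (intro card_subset_eq) auto
      hence "(2::'f) = 0 \<or> (2::'f) = 1" by auto
      thus False using 3(2) by (metis add_cancel_right_right one_add_one zero_neq_one)
    qed
    thus ?thesis using pg unfolding Sesqui by (intro exI[of _ 0]) simp
  next
    case 2
    then obtain \<sigma> where \<sigma>: "field_involution \<sigma>" and lin: "\<And>y. Vector_Spaces.linear scale (*) (\<lambda>x. \<beta> x y)"
      and herm: "\<And>x y. \<beta> y x = \<sigma> (\<beta> x y)"
      unfolding hermitian_form_def by blast
    have \<sigma>add: "\<sigma> (a + b) = \<sigma> a + \<sigma> b" and \<sigma>mult: "\<sigma> (a * b) = \<sigma> a * \<sigma> b" and \<sigma>\<sigma>: "\<sigma> (\<sigma> a) = a" for a b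
      using \<sigma> by (auto simp: field_involution_def)
    have \<sigma>0: "\<sigma> 0 = 0" using \<sigma>add[of 0 0] by (metis add.right_neutral add_left_imp_eq)
    have \<sigma>1: "\<sigma> 1 = 1"
      using \<sigma>mult[of 1 "\<sigma> 1"] \<sigma>\<sigma>[of 1] by simp
    have \<sigma>_id: "\<exists>a. \<sigma> a \<noteq> a" using \<sigma> by (auto simp: field_involution_def fun_eq_iff)
    have hom: "module_hom scale (*) (\<lambda>x. \<beta> x y)" for y
      using lin by (simp add: Vector_Spaces.linear_def)
    have addL: "\<beta> (x + y) z = \<beta> x z + \<beta> y z" and scaleL: "\<beta> (scale c x) y = c * \<beta> x y" for x y z c
      using module_hom.add[OF hom] module_hom.scale[OF hom] by blast+
    have addR: "\<beta> z (x + y) = \<beta> z x + \<beta> z y" for x y z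
      unfolding herm[of z "x + y"] herm[of z x] herm[of z y] addL \<sigma>add ..
    have scaleR: "\<beta> x (scale c y) = \<sigma> c * \<beta> x y" for x y c
      unfolding herm[of x "scale c y"] herm[of x y] scaleL \<sigma>mult ..
    define K where "K = {w. w + \<sigma> w = 0}"
    have trace: "\<exists>w. w + \<sigma> w = c" if "\<sigma> c = c" for c
    proof -
      have "\<exists>u. u + \<sigma> u \<noteq> 0"
      proof (rule ccontr)
        assume "\<not> ?thesis"
        hence neg: "\<sigma> u = - u" for u by (metis add.commute eq_neg_iff_add_eq_0)
        obtain a where "\<sigma> a \<noteq> a" using \<sigma>_id by blast
        have "(1::'f) = - 1" using neg[of 1] \<sigma>1 by simp
        hence "a = - a" by (metis mult_1 mult_minus1)
        thus False using neg[of a] \<open>\<sigma> a \<noteq> a\<close> by simp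
      qed
      then obtain u where u: "u + \<sigma> u \<noteq> 0" by blast
      define s where "s = u + \<sigma> u"
      have "\<sigma> s = s" by (simp add: s_def \<sigma>add \<sigma>\<sigma> add.commute)
      have "\<sigma> (inverse s) * s = 1"
        using \<sigma>mult[of "inverse s" s] \<open>\<sigma> s = s\<close> u \<sigma>1 by (simp add: s_def)
      hence inv: "\<sigma> (inverse s) = inverse s" by (metis inverse_unique mult.commute)
      have "u * (c * inverse s) + \<sigma> (u * (c * inverse s)) = s * (c * inverse s)"
        unfolding \<sigma>mult inv that by (simp only: s_def distrib_right)
      also have "\<dots> = c" using u by (simp add: s_def)
      finally show ?thesis by blast
    qed
    have cardK: "card {w. w + \<sigma> w = c} = card K" if "\<sigma> c = c" for c
    proof -
      from that have "\<exists>w. w + \<sigma> w = c" by (rule trace)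
      then obtain w0 where w0: "w0 + \<sigma> w0 = c" by blast
      have \<sigma>minus: "\<sigma> (w - w0) = \<sigma> w - \<sigma> w0" for w
        using \<sigma>add[of "w - w0" w0] by (simp add: algebra_simps)
      have "bij_betw (\<lambda>w. w + w0) K {w. w + \<sigma> w = c}"
      proof (rule bij_betwI[where g = "\<lambda>w. w - w0"])
        show "(\<lambda>w. w + w0) \<in> K \<rightarrow> {w. w + \<sigma> w = c}"
          using w0 by (auto simp: K_def \<sigma>add algebra_simps)
        show "(\<lambda>w. w - w0) \<in> {w. w + \<sigma> w = c} \<rightarrow> K"
          using w0 by (auto simp: K_def \<sigma>minus algebra_simps)
      qed simp_all
      thus ?thesis by (simp add: bij_betw_same_card)
    qed
    have pg: "polar_geometry scale Basis (\<lambda>x y. \<beta> x y = 0) (\<lambda>x. \<beta> x x = 0) (card K) CARD('f)"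
    proof (rule polar_geometry_reflexive[where \<tau> = \<sigma>, OF fd])
      show "\<beta> 0 0 = 0" using addL[of 0 0 0] by (metis add.right_neutral add_left_imp_eq)
      show "surj \<sigma>" using \<sigma>\<sigma> by (metis surjI)
      show sym0: "\<beta> y x = 0" if "\<beta> x y = 0" for x y using herm[of y x] that \<sigma>0 by simp
      show "\<beta> (x + y) (x + y) = 0" if "\<beta> x x = 0" "\<beta> y y = 0" "\<beta> x y = 0" for x y
        using that sym0[OF that(3)] by (simp add: addL addR)
      show "card {c. \<beta> (y + scale c x) (y + scale c x) = 0} = card K" if "\<beta> x x = 0" "\<beta> x y \<noteq> 0" for x y
      proof -
        have "\<beta> (y + scale c x) (y + scale c x) = \<beta> y y + (c * \<beta> x y + \<sigma> (c * \<beta> x y))" for c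
          using that(1) by (simp add: addL addR scaleL scaleR \<sigma>mult herm[of y x, symmetric])
        hence "{c. \<beta> (y + scale c x) (y + scale c x) = 0} =
            {c. c * \<beta> x y + \<sigma> (c * \<beta> x y) = - \<beta> y y}"
          by (auto simp: eq_neg_iff_add_eq_0 add.commute)
        hence "card {c. \<beta> (y + scale c x) (y + scale c x) = 0} =
            card {c. c * \<beta> x y + \<sigma> (c * \<beta> x y) = - \<beta> y y}" by (simp only:)
        also have "\<dots> = card {w. w + \<sigma> w = - \<beta> y y}"
        proof (rule bij_betw_same_card)
          show "bij_betw (\<lambda>c. c * \<beta> x y) {c. c * \<beta> x y + \<sigma> (c * \<beta> x y) = - \<beta> y y}
              {w. w + \<sigma> w = - \<beta> y y}"
            using that(2) by (intro bij_betwI[where g = "\<lambda>w. w / \<beta> x y"]) auto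
        qed
        also have "\<dots> = card K"
        proof (rule cardK)
          show "\<sigma> (- \<beta> y y) = - \<beta> y y"
          using \<sigma>add[of "\<beta> y y" "- \<beta> y y"]
            by (simp add: \<sigma>0 herm[of y y, symmetric] eq_neg_iff_add_eq_0 add.commute)
        qed
        finally show ?thesis .
      qed
    qed (simp_all add: addL addR scaleL scaleR nd')
    have "\<exists>e. card K = CHAR('f) ^ e"
    proof -
      have "x + y \<in> K" if "x \<in> K" "y \<in> K" for x y
      proof -
        have "(x + y) + \<sigma> (x + y) = (x + \<sigma> x) + (y + \<sigma> y)" by (simp add: \<sigma>add)
        also have "\<dots> = 0" using that by (simp add: K_def)
        finally show ?thesis by (simp only: K_def mem_Collect_eq)
      qed
      thus ?thesis by (intro card_additive_subgroup) (simp_all add: K_def \<sigma>0)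
    qed
    then obtain e where e: "card K = CHAR('f) ^ e" by blast
    have "CARD('f) \<noteq> 2"
    proof
      assume "CARD('f) = 2"
      hence "{0, 1} = (UNIV :: 'f set)" by (intro card_subset_eq) auto
      hence "a = 0 \<or> a = 1" for a :: 'f by auto
      thus False using \<sigma>_id \<sigma>0 \<sigma>1 by metis
    qed
    thus ?thesis using pg unfolding Sesqui e by (intro exI[of _ e]) simp
  qed
qed

section \<open>Primitive prime divisors\<close>

lemma geometric_sum_mult: "(x - 1) * (\<Sum>i<n. x ^ i) = x ^ n - (1::nat)" if "x \<ge> 1" for x n
proof -
  have "int ((x - 1) * (\<Sum>i<n. x ^ i)) = int (x ^ n - 1)"
    using that power_diff_1_eq[of "int x" n] by (simp add: of_nat_diff)
  thus ?thesis by linarith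
qed

text \<open>
  The cofactor \<open>1 + x + \<dots> + x^(l-1)\<close> is congruent to \<open>l\<close> modulo \<open>r\<close>.
\<close>

lemma multiplicity_power_minus_one_coprime:
  fixes x l r :: nat
  assumes "prime r" "prime l" "l \<noteq> r" "r dvd x - 1" "x \<ge> 2"
  shows "multiplicity r (x ^ l - 1) = multiplicity r (x - 1)"
proof -
  have "[x = 1] (mod r)" using assms by (simp add: cong_altdef_nat cong_sym)
  hence "[(\<Sum>i<l. x ^ i) = (\<Sum>i<l. 1 ^ i)] (mod r)"
    by (intro cong_sum cong_pow)
  hence "r dvd (\<Sum>i<l. x ^ i) \<longleftrightarrow> r dvd l"
    by (simp add: cong_dvd_iff)
  also have "\<not> r dvd l" using assms primes_dvd_imp_eq by blast
  finally have nd: "\<not> r dvd (\<Sum>i<l. x ^ i)" .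
  have "x ^ l - 1 = (x - 1) * (\<Sum>i<l. x ^ i)"
    using geometric_sum_mult[of x l] assms by simp
  moreover have "(\<Sum>i<l. x ^ i) \<noteq> 0" using nd by (metis dvd_0_right)
  ultimately show ?thesis
    using assms nd by (simp add: prime_elem_multiplicity_mult_distrib not_dvd_imp_multiplicity_0)
qed

text \<open>
  The cofactor \<open>1 + x + \<dots> + x^(r-1)\<close> is congruent to \<open>r\<close> modulo \<open>r^2\<close>; the linear terms add up to
  a multiple of \<open>r(r-1)/2\<close>, and \<open>r\<close> is odd.
\<close>

lemma multiplicity_power_minus_one_prime:
  fixes x r :: nat
  assumes "prime r" "odd r" "r dvd x - 1" "x \<ge> 2"
  shows "multiplicity r (x ^ r - 1) = multiplicity r (x - 1) + 1"
proof -
  obtain y where "x - 1 = r * y" using assms by (auto elim: dvdE)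
  hence y: "x = 1 + r * y" using assms by simp
  have "[x ^ i = 1 + i * r * y] (mod r^2)" for i
  proof (induction i)
    case (Suc i)
    have "[x ^ Suc i = (1 + r * y) * (1 + i * r * y)] (mod r^2)"
      using cong_scalar_left[OF Suc, of x] y by simp
    also have "(1 + r * y) * (1 + i * r * y) = 1 + Suc i * r * y + r^2 * (i * y * y)"
      by (simp add: algebra_simps power2_eq_square)
    also have "[1 + Suc i * r * y + r^2 * (i * y * y) = 1 + Suc i * r * y] (mod r^2)"
      by (simp add: cong_def)
    finally show ?case .
  qed auto
  hence "[(\<Sum>i<r. x ^ i) = (\<Sum>i<r. 1 + i * r * y)] (mod r^2)" by (intro cong_sum)
  also have "(\<Sum>i<r. 1 + i * r * y) = r + r * y * (\<Sum>i<r. i)"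
    by (simp add: sum.distrib sum_distrib_left mult_ac sum_Suc del: add_Suc add_Suc_right)
  also have "(\<Sum>i<r. i) = r * ((r - 1) div 2)"
  proof -
    have "(\<Sum>i<r. i) = r * (r - 1) div 2"
      using Sum_Ico_nat[of 0 r] by (simp add: lessThan_atLeast0)
    moreover have "even (r - 1)" using assms by auto
    ultimately show ?thesis by (simp add: div_mult_swap)
  qed
  also have "[r + r * y * (r * ((r - 1) div 2)) = r] (mod r^2)"
  proof -
    have "r + r * y * (r * ((r - 1) div 2)) = r + r^2 * (y * ((r - 1) div 2))"
      by (simp add: power2_eq_square algebra_simps)
    thus ?thesis unfolding cong_def by (metis mod_mult_self2)
  qed
  finally have c: "[(\<Sum>i<r. x ^ i) = r] (mod r^2)" .
  have r0: "r > 1" using assms prime_gt_1_nat by blast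
  have "r dvd (\<Sum>i<r. x ^ i)"
    using cong_dvd_modulus_nat[OF c, of r] cong_dvd_iff[of "\<Sum>i<r. x ^ i" r r] by (simp add: power2_eq_square)
  moreover have "\<not> r^2 dvd (\<Sum>i<r. x ^ i)"
    using cong_dvd_iff[OF c] r0 by (simp add: power2_eq_square)
  ultimately have "multiplicity r (\<Sum>i<r. x ^ i) = 1"
    by (intro multiplicity_eqI) (auto simp: power2_eq_square)
  moreover have "x ^ r - 1 = (x - 1) * (\<Sum>i<r. x ^ i)"
    using geometric_sum_mult[of x r] assms by simp
  moreover have "(\<Sum>i<r. x ^ i) \<noteq> 0"
    using \<open>\<not> r^2 dvd (\<Sum>i<r. x ^ i)\<close> by (metis dvd_0_right)
  ultimately show ?thesis
    using assms by (simp add: prime_elem_multiplicity_mult_distrib)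
qed

lemma multiplicity_prod_nonzero:
  fixes f :: "'a \<Rightarrow> nat"
  assumes "prime r" "finite A" "\<And>x. x \<in> A \<Longrightarrow> f x \<noteq> 0"
  shows "multiplicity r (prod f A) = (\<Sum>x\<in>A. multiplicity r (f x))"
  using assms by (intro prime_elem_multiplicity_prod_distrib) (simp, metis imageE, simp)

lemma order_divides_iff:
  fixes r a b :: nat
  assumes "a \<ge> 1"
  shows "r dvd a ^ b - 1 \<longleftrightarrow> ord r a dvd b"
proof -
  have "r dvd a ^ b - 1 \<longleftrightarrow> [a ^ b = 1] (mod r)"
    using assms by (simp add: cong_altdef_nat cong_sym_eq[of _ 1] cong_sym)
  thus ?thesis using ord_divides[of a b r] by simp
qed

text \<open>
  For the interval from 1 to \<open>M\<close> induction proves the stronger bound \<open>1/4 + 2^-(M+1)\<close>; further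
  factors only decrease the product.
\<close>

lemma prod_one_minus_half_powers:
  assumes "finite X" "0 \<notin> X"
  shows "(\<Prod>d\<in>X. 1 - (1/2) ^ d) > (1/4 :: real)"
proof -
  define M where "M = Max (insert 1 X)"
  have le: "d \<le> M" if "d \<in> insert 1 X" for d
    using that assms unfolding M_def by (intro Max_ge) auto
  have M: "M \<ge> 1" "X \<subseteq> {1..M}"
    using le assms(2) by (auto simp: Suc_le_eq intro!: gr0I)
  have "(\<Prod>d\<in>{1..M}. 1 - (1/2) ^ d) \<ge> (1/4 + (1/2) ^ (M + 1) :: real)" if "M \<ge> 1" for M :: nat
    using that
  proof (induction M rule: dec_induct)
    case (step n)
    let ?e = "(1/2) ^ n :: real"
    have e: "?e \<le> 1/2" "?e > 0" using step power_decreasing[of 1 n "1/2::real"] by auto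
    have "1/4 + ?e/4 \<le> (1/4 + ?e/2) * (1 - ?e/2)"
      using e mult_right_mono[of ?e "1/2" ?e] by (simp add: field_simps)
    also have "\<dots> \<le> (\<Prod>d\<in>{1..n}. 1 - (1/2) ^ d) * (1 - ?e/2)"
      using step.IH e by (intro mult_right_mono) auto
    finally show ?case using step by simp
  qed auto
  from this[OF M(1)] have "(1/4::real) < (\<Prod>d\<in>{1..M}. 1 - (1/2) ^ d)"
    by (smt (verit) zero_less_power half_gt_zero_iff)
  also have "\<dots> = (\<Prod>d\<in>{1..M}-X. 1 - (1/2) ^ d) * (\<Prod>d\<in>X. 1 - (1/2) ^ d)"
    using M(2) by (intro prod.subset_diff) auto
  also have "\<dots> \<le> 1 * (\<Prod>d\<in>X. 1 - (1/2) ^ d)"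
    by (intro mult_right_mono prod_le_1 prod_nonneg) (auto simp: power_le_one)
  finally show ?thesis by simp
qed

lemma inj_on_prod_of_primes:
  fixes P :: "nat set"
  assumes "finite P" "\<And>p. p \<in> P \<Longrightarrow> prime p"
  shows "inj_on \<Prod> (Pow P)"
proof (rule inj_onI)
  have *: "S = {p \<in> P. p dvd \<Prod>S}" if "S \<subseteq> P" for S
  proof -
    have "finite S" using that assms finite_subset by blast
    have "p \<in> S" if "p \<in> P" "p dvd \<Prod>S" for p
    proof -
      have "\<exists>p'\<in>S. p dvd p'"
        using prime_dvd_prod_iff[OF \<open>finite S\<close>, of p "\<lambda>x. x"] that assms(2)[of p] by blast
      then obtain p' where "p' \<in> S" "p dvd p'" by blast
      thus ?thesis using assms \<open>S \<subseteq> P\<close> that primes_dvd_imp_eq[of p p'] by auto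
    qed
    thus ?thesis using \<open>finite S\<close> that by (auto intro: dvd_prodI)
  qed
  fix S T assume "S \<in> Pow P" "T \<in> Pow P" "\<Prod>S = \<Prod>T"
  thus "S = T" using *[of S] *[of T] by auto
qed

lemma prod_subset_prime_factors_dvd:
  fixes N :: nat
  assumes "N > 0" "S \<subseteq> prime_factors N"
  shows "\<Prod>S dvd N"
proof -
  have "\<Prod>S dvd \<Prod>(prime_factors N)" using assms(2) by (intro prod_dvd_prod_subset) auto
  also have "\<dots> dvd (\<Prod>p\<in>prime_factors N. p ^ multiplicity p N)"
    using assms(1) by (intro prod_dvd_prod) (auto simp: prime_factors_multiplicity dvd_power)
  also have "\<dots> = N" using assms(1) by (simp add: prime_factorization_nat[symmetric])
  finally show ?thesis .
qed

text \<open>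
  With \<open>P\<close> the prime divisors of \<open>N\<close>, the product of \<open>a^(N/\<Prod>S) - 1\<close> over the even subsets \<open>S\<close> of
  \<open>P\<close>, divided by that over the odd subsets, is the value of the \<open>N\<close>-th cyclotomic polynomial at
  \<open>a\<close>. In this form it can be used without polynomials.
\<close>

definition even_subsets :: "'a set \<Rightarrow> 'a set set" where
  "even_subsets P = {S \<in> Pow P. even (card S)}"

definition odd_subsets :: "'a set \<Rightarrow> 'a set set" where
  "odd_subsets P = {S \<in> Pow P. odd (card S)}"

lemma finite_even_odd_subsets [simp]:
  "finite P \<Longrightarrow> finite (even_subsets P)" "finite P \<Longrightarrow> finite (odd_subsets P)"
  by (auto simp: even_subsets_def odd_subsets_def)

text \<open>
  Expansion of Euler's product for the totient.
\<close>

lemma totient_inclusion_exclusion: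
  fixes N :: nat
  assumes "N > 0"
  defines "P \<equiv> prime_factors N"
  shows "(\<Sum>S\<in>even_subsets P. N div \<Prod>S) = totient N + (\<Sum>S\<in>odd_subsets P. N div \<Prod>S)"
proof -
  have fin: "finite P" by (simp add: P_def)
  have dvd: "\<Prod>S dvd N" if "S \<in> Pow P" for S
    using prod_subset_prime_factors_dvd[OF assms(1)] that by (simp add: P_def)
  have "real (totient N) = real N * (\<Prod>p\<in>P. (- 1 / real p) + 1)"
    by (simp add: totient_formula2 P_def)
  also have "(\<Prod>p\<in>P. (- 1 / real p) + 1) = (\<Sum>S\<in>Pow P. (\<Prod>p\<in>S. - 1 / real p))"
    using prod_add[OF fin, of "\<lambda>p. - 1 / real p" "\<lambda>_. 1"] by simp
  also have "real N * \<dots> = (\<Sum>S\<in>Pow P. (-1) ^ card S * real (N div \<Prod>S))"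
    unfolding sum_distrib_left
  proof (intro sum.cong refl)
    fix S assume S: "S \<in> Pow P"
    have "(\<Prod>p\<in>S. - 1 / real p) = (-1) ^ card S / real (\<Prod>S)"
      by (simp add: prod_dividef prod_uminus)
    thus "real N * (\<Prod>p\<in>S. - 1 / real p) = (-1) ^ card S * real (N div \<Prod>S)"
      using dvd[OF S] by (simp add: real_of_nat_div)
  qed
  also have "Pow P = even_subsets P \<union> odd_subsets P"
    by (auto simp: even_subsets_def odd_subsets_def)
  also have "(\<Sum>S\<in>\<dots>. (-1) ^ card S * real (N div \<Prod>S)) =
     (\<Sum>S\<in>even_subsets P. real (N div \<Prod>S)) + (\<Sum>S\<in>odd_subsets P. - real (N div \<Prod>S))"
    using fin by (subst sum.union_disjoint)
      (auto simp: even_subsets_def odd_subsets_def intro!: arg_cong2[of _ _ _ _ "(+)"] sum.cong)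
  finally have "real (totient N + (\<Sum>S\<in>odd_subsets P. N div \<Prod>S)) = real (\<Sum>S\<in>even_subsets P. N div \<Prod>S)"
    by (simp add: sum_negf)
  thus ?thesis by linarith
qed

text \<open>
  An involution that exchanges even and odd subsets.
\<close>

definition toggle :: "'a \<Rightarrow> 'a set \<Rightarrow> 'a set" where
  "toggle l S = (if l \<in> S then S - {l} else insert l S)"

lemma toggle_toggle [simp]: "toggle l (toggle l S) = S"
  by (auto simp: toggle_def)

lemma toggle_parity:
  assumes "finite P" "l \<in> P"
  shows "S \<in> even_subsets P \<Longrightarrow> toggle l S \<in> odd_subsets P"
    and "S \<in> odd_subsets P \<Longrightarrow> toggle l S \<in> even_subsets P"
proof -
  have "even (card (toggle l S)) \<longleftrightarrow> odd (card S)" if "S \<subseteq> P"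
  proof -
    have fin: "finite S" using that assms(1) by (rule finite_subset)
    show ?thesis
    proof (cases "l \<in> S")
      case True
      have "card S = Suc (card (S - {l}))" using card.remove[OF fin True] .
      thus ?thesis using True by (simp add: toggle_def)
    qed (use fin in \<open>simp add: toggle_def\<close>)
  qed
  moreover have "toggle l S \<subseteq> P" if "S \<subseteq> P" using that assms by (auto simp: toggle_def)
  ultimately show "S \<in> even_subsets P \<Longrightarrow> toggle l S \<in> odd_subsets P"
    and "S \<in> odd_subsets P \<Longrightarrow> toggle l S \<in> even_subsets P"
    by (auto simp: even_subsets_def odd_subsets_def)
qed

text \<open>
  The cyclotomic value divides the largest prime factor of \<open>N\<close>. To see this, let \<open>r\<close> be a prime
  and \<open>m\<close> the order of \<open>a\<close> modulo \<open>r\<close>. The multiplicities of \<open>r\<close> vanish unless \<open>m\<close> divides \<open>N\<close>,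
  and \<open>m \<noteq> N\<close>. If a prime \<open>l \<noteq> r\<close> divides \<open>N/m\<close>, then toggling \<open>l\<close> pairs even with odd subsets
  without changing the multiplicity. Otherwise \<open>N/m\<close> is a power of \<open>r\<close>. The other prime factors of
  \<open>N\<close> then divide \<open>m\<close>, hence \<open>r - 1\<close>, so \<open>r\<close> is the largest; only the subsets of \<open>{r}\<close> contribute,
  and these differ by 1.
\<close>

lemma no_primitive_prime_imp_dvd:
  fixes a N :: nat
  defines "P \<equiv> prime_factors N"
  assumes a: "a \<ge> 2" and N: "N > 0" and odd_prime: "\<exists>p\<in>P. odd p"
    and no_prim: "\<And>r. prime r \<Longrightarrow> ord r a \<noteq> N"
  shows "(\<Prod>S\<in>even_subsets P. a ^ (N div \<Prod>S) - 1) dvd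
         Max P * (\<Prod>S\<in>odd_subsets P. a ^ (N div \<Prod>S) - 1)"
proof (rule multiplicity_le_imp_dvd)
  let ?D = "\<lambda>S. N div \<Prod>S"
  have fin [simp]: "finite P" by (simp add: P_def)
  have primeP: "prime p" "p dvd N" if "p \<in> P" for p using that by (auto simp: P_def)
  have dvd: "\<Prod>S dvd N" if "S \<subseteq> P" for S
    using prod_subset_prime_factors_dvd[OF N] that by (simp add: P_def)
  have Dpos: "?D S > 0" if "S \<subseteq> P" for S
    using dvd[OF that] N by (auto elim!: dvdE)
  have nz: "a ^ ?D S - 1 \<noteq> 0" if "S \<subseteq> P" for S
    using a one_less_power[of a "?D S"] Dpos[OF that] by simp
  show "(\<Prod>S\<in>even_subsets P. a ^ (N div \<Prod>S) - 1) \<noteq> 0"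
    using nz by (auto simp: even_subsets_def)
  have nzO: "(\<Prod>S\<in>odd_subsets P. a ^ (N div \<Prod>S) - 1) \<noteq> 0"
    using nz by (auto simp: odd_subsets_def)
  have MaxP: "Max P \<in> P" using odd_prime by (intro Max_in) auto
  fix r :: nat assume r: "prime r"
  define h where "h = (\<lambda>S. multiplicity r (a ^ ?D S - 1))"
  have even_sum: "multiplicity r (\<Prod>S\<in>even_subsets P. a ^ ?D S - 1) = sum h (even_subsets P)"
    unfolding h_def using nz by (intro multiplicity_prod_nonzero r) (auto simp: even_subsets_def)
  have odd_sum: "multiplicity r (\<Prod>S\<in>odd_subsets P. a ^ ?D S - 1) = sum h (odd_subsets P)"
    unfolding h_def using nz by (intro multiplicity_prod_nonzero r) (auto simp: odd_subsets_def)
  define m where "m = ord r a"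
  have h0: "h S = 0" if "\<not> m dvd ?D S" for S
    using that a order_divides_iff[of a r "?D S"] by (simp add: h_def m_def not_dvd_imp_multiplicity_0)
  have DS: "N = \<Prod>S * ?D S" if "S \<subseteq> P" for S using dvd[OF that] by simp
  have Dins: "?D S = l * ?D (insert l S)" if "S \<subseteq> P" "l \<in> P" "l \<notin> S" for S l
  proof -
    have "finite S" using that finite_subset fin by blast
    hence "\<Prod>(insert l S) = l * \<Prod>S" using that by simp
    moreover have "N = \<Prod>(insert l S) * ?D (insert l S)" using DS[of "insert l S"] that by simp
    moreover have "\<Prod>S > 0" using that primeP prime_gt_0_nat by (intro prod_pos) blast
    ultimately have "\<Prod>S * ?D S = \<Prod>S * (l * ?D (insert l S))" "\<Prod>S > 0" using DS[of S] that
      by (metis mult.assoc mult.commute, simp)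
    thus ?thesis by simp
  qed
  have "sum h (even_subsets P) \<le> multiplicity r (Max P) + sum h (odd_subsets P)"
  proof (cases "m dvd N")
    case False
    have "h S = 0" if "S \<subseteq> P" for S
      using h0[of S] False DS[OF that] by (metis dvd_mult)
    hence "sum h (even_subsets P) = 0" by (auto simp: even_subsets_def)
    thus ?thesis by simp
  next
    case True
    then obtain c where c: "N = m * c" by (auto elim: dvdE)
    have "c \<noteq> 1" using no_prim[OF r] c m_def by auto
    have "c > 0" "m > 0" using N c by (auto intro: gr0I)
    show ?thesis
    proof (cases "\<exists>l. prime l \<and> l dvd c \<and> l \<noteq> r")
      case True
      then obtain l where l: "prime l" "l dvd c" "l \<noteq> r" by blast
      have lP: "l \<in> P" using l c N by (auto simp: P_def in_prime_factors_iff)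
      have step: "h (insert l S) = h S" if S: "S \<subseteq> P" "l \<notin> S" for S
      proof -
        let ?e = "?D (insert l S)"
        have D: "?D S = l * ?e" using Dins S lP by blast
        show ?thesis
        proof (cases "m dvd ?D S")
          case False
          thus ?thesis using h0[of S] h0[of "insert l S"] D by (metis dvd_mult)
        next
          case True
          have "coprime l (\<Prod>S)"
            using S primeP l by (intro prod_coprime_right) (metis primes_coprime subsetD)
          moreover have "m dvd l * ?e" using True D by simp
          moreover have "m dvd \<Prod>S * ?e"
          proof -
            obtain c' where c': "c = l * c'" using l by (auto elim: dvdE)
            have "l * (\<Prod>S * ?e) = l * (m * c')"
              using DS[OF S(1)] c unfolding D c' by (simp only: mult_ac)
            hence "\<Prod>S * ?e = m * c'" using l prime_gt_0_nat by (metis mult_cancel1 not_less0)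
            thus ?thesis by simp
          qed
          ultimately have "m dvd ?e * gcd l (\<Prod>S)" "gcd l (\<Prod>S) = 1"
            unfolding gcd_mult_distrib_nat by (auto simp: mult.commute)
          hence "m dvd ?e" by simp
          hence "r dvd a ^ ?e - 1" using order_divides_iff[of a r ?e] a m_def by simp
          moreover have "a ^ ?e \<ge> 2" using nz[of "insert l S"] S lP a
            by (metis Suc_1 Suc_leI diff_is_0_eq insert_subset not_le)
          ultimately have "multiplicity r ((a ^ ?e) ^ l - 1) = multiplicity r (a ^ ?e - 1)"
            using multiplicity_power_minus_one_coprime[OF r l(1) l(3)] by blast
          thus ?thesis unfolding h_def D by (subst mult.commute, subst power_mult) simp
        qed
      qed
      have "sum h (even_subsets P) = sum h (odd_subsets P)"
      proof (rule sum.reindex_bij_witness[where i = "toggle l" and j = "toggle l"])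
        fix S assume "S \<in> even_subsets P"
        hence "S \<subseteq> P" by (auto simp: even_subsets_def)
        thus "h (toggle l S) = h S"
          using step[of S] step[of "S - {l}", symmetric]
          by (cases "l \<in> S") (auto simp: toggle_def insert_absorb)
      qed (simp_all add: toggle_parity[OF fin lP])
      thus ?thesis by simp
    next
      case False
      have rc: "prime_factors c \<subseteq> {r}" using False by (auto simp: in_prime_factors_iff)
      have "r dvd c" using False \<open>c \<noteq> 1\<close> prime_factor_nat[of c] by blast
      hence rP: "r \<in> P" using r c N by (auto simp: P_def in_prime_factors_iff)
      have r_m: "p < r" if "p \<in> P" "p \<noteq> r" for p
      proof -
        have "p dvd m" using False primeP[OF that(1)] that(2) c
          by (meson prime_dvd_mult_iff)
        also have "m dvd totient r" unfolding m_def
          by (rule order_divides_totient)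
            (use \<open>m > 0\<close> in \<open>auto simp: m_def ord_gt_0_iff coprime_commute\<close>)
        finally have "p dvd r - 1" using r by (simp add: totient_prime)
        thus ?thesis using r prime_gt_1_nat[OF r] dvd_imp_le[of p "r - 1"] by simp
      qed
      have "Max P = r" using r_m rP by (intro Max_eqI) (simp_all, metis order_refl less_imp_le)
      have "odd r"
      proof
        assume "even r"
        hence "r = 2" using r primes_dvd_imp_eq[of 2 r] by simp
        obtain p where "p \<in> P" "odd p" using odd_prime by blast
        moreover have "p \<noteq> r" using \<open>odd p\<close> \<open>r = 2\<close> by auto
        ultimately have "p < 2" using r_m \<open>r = 2\<close> by simp
        thus False using prime_ge_2_nat[OF primeP(1)[OF \<open>p \<in> P\<close>]] by simp
      qed
      have zero: "h S = 0" if S: "S \<subseteq> P" "\<not> S \<subseteq> {r}" for S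
      proof (rule h0, rule notI)
        assume "m dvd ?D S"
        then obtain y where y: "?D S = m * y" by (auto elim: dvdE)
        obtain p where p: "p \<in> S" "p \<noteq> r" using S by auto
        have "m * c = m * (\<Prod>S * y)" using DS[OF S(1)] y c by (simp add: mult_ac)
        hence "c = \<Prod>S * y" using \<open>m > 0\<close> by simp
        moreover have "p dvd \<Prod>S" using p S fin finite_subset by (metis dvd_prodI id_apply)
        ultimately have "p dvd c" by simp
        thus False using False p primeP S by blast
      qed
      have rN: "?D {r} * r = N" using primeP[OF rP] by simp
      have "m dvd ?D {r}"
      proof -
        obtain c' where "c = r * c'" using \<open>r dvd c\<close> by (auto elim: dvdE)
        hence "?D {r} = m * c'" using c prime_gt_0_nat[OF r] by simp
        thus ?thesis by simp
      qed
      hence "r dvd a ^ ?D {r} - 1" using order_divides_iff[of a r "?D {r}"] a m_def by simp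
      moreover have "a ^ ?D {r} \<ge> 2" using nz[of "{r}"] rP a
        by (metis Suc_1 Suc_leI diff_is_0_eq insert_subset not_le empty_subsetI)
      ultimately have "multiplicity r ((a ^ ?D {r}) ^ r - 1) = multiplicity r (a ^ ?D {r} - 1) + 1"
        using multiplicity_power_minus_one_prime[OF r \<open>odd r\<close>] by blast
      hence top: "h {} = h {r} + 1" unfolding h_def using rN by (simp flip: power_mult)
      have "sum h (even_subsets P) = h {}"
      proof -
        have "sum h (even_subsets P) = sum h {{}}"
        proof (rule sum.mono_neutral_right)
          show "\<forall>S\<in>even_subsets P - {{}}. h S = 0"
          proof
            fix S assume "S \<in> even_subsets P - {{}}"
            hence "S \<subseteq> P" "even (card S)" "S \<noteq> {}" by (auto simp: even_subsets_def)
            moreover have "S \<noteq> {r}" using \<open>even (card S)\<close> by auto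
            ultimately have "\<not> S \<subseteq> {r}" by (simp add: subset_singleton_iff)
            thus "h S = 0" using zero \<open>S \<subseteq> P\<close> by blast
          qed
        qed (auto simp: even_subsets_def)
        thus ?thesis by simp
      qed
      moreover have "h {r} \<le> sum h (odd_subsets P)"
        using rP by (intro member_le_sum) (auto simp: odd_subsets_def)
      moreover have "multiplicity r (Max P) = 1"
        using r \<open>Max P = r\<close> by simp
      ultimately show ?thesis using top by simp
    qed
  qed
  thus "multiplicity r (\<Prod>S\<in>even_subsets P. a ^ (N div \<Prod>S) - 1) \<le>
        multiplicity r (Max P * (\<Prod>S\<in>odd_subsets P. a ^ (N div \<Prod>S) - 1))"
    unfolding even_sum
  proof -
    have "Max P \<noteq> 0" using primeP(1)[OF MaxP] by (metis not_prime_0)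
    hence "multiplicity r (Max P * (\<Prod>S\<in>odd_subsets P. a ^ ?D S - 1)) =
        multiplicity r (Max P) + sum h (odd_subsets P)"
      using prime_elem_multiplicity_mult_distrib[OF prime_imp_prime_elem[OF r] _ nzO] odd_sum by simp
    moreover assume "sum h (even_subsets P) \<le> multiplicity r (Max P) + sum h (odd_subsets P)"
    ultimately show "sum h (even_subsets P) \<le>
        multiplicity r (Max P * (\<Prod>S\<in>odd_subsets P. a ^ ?D S - 1))" by simp
  qed
qed

text \<open>
  The cyclotomic value exceeds \<open>a^totient N / 4\<close>: the factors for odd subsets are bounded by
  powers of \<open>a\<close>, and those for even subsets are such powers times distinct factors \<open>1 - a^-e\<close>. By
  hypothesis it is at most \<open>c\<close>.
\<close>

lemma totient_product_bound:
  fixes a N :: nat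
  defines "P \<equiv> prime_factors N"
  assumes a: "a \<ge> 2" and N: "N > 0"
    and dvd: "(\<Prod>S\<in>even_subsets P. a ^ (N div \<Prod>S) - 1) dvd
         c * (\<Prod>S\<in>odd_subsets P. a ^ (N div \<Prod>S) - 1)" and c: "c > 0"
  shows "a ^ totient N < 4 * c"
proof -
  let ?D = "\<lambda>S. N div \<Prod>S"
  have fin [simp]: "finite P" by (simp add: P_def)
  have dvdN: "\<Prod>S dvd N" if "S \<subseteq> P" for S
    using prod_subset_prime_factors_dvd[OF N] that by (simp add: P_def)
  have Dpos: "?D S > 0" if "S \<subseteq> P" for S
    using dvdN[OF that] N by (auto elim!: dvdE)
  have gt1: "a ^ ?D S > 1" if "S \<subseteq> P" for S
    using a one_less_power[of a "?D S"] Dpos[OF that] by simp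
  have injD: "inj_on ?D (even_subsets P)"
  proof (rule inj_onI)
    fix S T assume ST: "S \<in> even_subsets P" "T \<in> even_subsets P" "?D S = ?D T"
    hence sub: "S \<subseteq> P" "T \<subseteq> P" by (auto simp: even_subsets_def)
    have "\<Prod>S * ?D S = N" "\<Prod>T * ?D T = N" using dvdN[OF sub(1)] dvdN[OF sub(2)] by simp_all
    hence "\<Prod>S * ?D S = \<Prod>T * ?D S" unfolding ST(3) by simp
    hence "\<Prod>S = \<Prod>T" using Dpos[OF sub(1)] by simp
    thus "S = T"
      using inj_on_prod_of_primes[of P] sub by (auto simp: P_def inj_on_def)
  qed
  have "S \<subseteq> P" if "S \<in> even_subsets P" for S using that by (simp add: even_subsets_def)
  hence Deven: "?D S > 0" if "S \<in> even_subsets P" for S using Dpos that by blast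
  have D0: "0 \<notin> ?D ` even_subsets P"
  proof
    assume "0 \<in> ?D ` even_subsets P"
    then obtain S where "S \<in> even_subsets P" "0 = ?D S" by (rule imageE) blast
    thus False using Deven by (metis less_irrefl)
  qed
  have E: "real (\<Prod>S\<in>even_subsets P. a ^ ?D S - 1) > real a ^ (\<Sum>S\<in>even_subsets P. ?D S) / 4"
  proof -
    have "1/4 < (\<Prod>d\<in>?D ` even_subsets P. 1 - (1/2::real) ^ d)"
      using D0 by (intro prod_one_minus_half_powers) simp_all
    also have "\<dots> = (\<Prod>S\<in>even_subsets P. 1 - (1/2::real) ^ ?D S)"
      using injD by (simp add: prod.reindex)
    also have "\<dots> \<le> (\<Prod>S\<in>even_subsets P. 1 - (1/real a) ^ ?D S)"
    proof (intro prod_mono conjI)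
      fix S assume "S \<in> even_subsets P"
      show "0 \<le> 1 - (1/2::real) ^ ?D S" by (simp add: power_le_one)
      have "1 / real a \<le> 1 / 2" using a by (simp add: field_simps)
      thus "1 - (1/2::real) ^ ?D S \<le> 1 - (1/real a) ^ ?D S"
        using power_mono[of "1/real a" "1/2" "?D S"] by simp
    qed
    finally have "real a ^ (\<Sum>S\<in>even_subsets P. ?D S) * (1/4) <
        real a ^ (\<Sum>S\<in>even_subsets P. ?D S) * (\<Prod>S\<in>even_subsets P. 1 - (1/real a) ^ ?D S)"
      using a by (intro mult_strict_left_mono) auto
    also have "\<dots> = (\<Prod>S\<in>even_subsets P. real a ^ ?D S * (1 - (1/real a) ^ ?D S))"
      by (simp add: prod.distrib power_sum)
    also have "\<dots> = (\<Prod>S\<in>even_subsets P. real (a ^ ?D S - 1))"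
    proof (intro prod.cong refl)
      fix S assume "S \<in> even_subsets P"
      hence "S \<subseteq> P" by (auto simp: even_subsets_def)
      from gt1[OF this] show "real a ^ ?D S * (1 - (1/real a) ^ ?D S) = real (a ^ ?D S - 1)"
        using a by (simp add: of_nat_diff right_diff_distrib power_one_over)
    qed
    finally show ?thesis by simp
  qed
  have O: "(\<Prod>S\<in>odd_subsets P. a ^ ?D S - 1) \<le> a ^ (\<Sum>S\<in>odd_subsets P. ?D S)"
    unfolding power_sum by (intro prod_mono) auto
  have Opos: "(\<Prod>S\<in>odd_subsets P. a ^ ?D S - 1) > 0"
    using gt1 by (intro prod_pos) (auto simp: odd_subsets_def)
  have "(\<Prod>S\<in>even_subsets P. a ^ ?D S - 1) \<le> c * (\<Prod>S\<in>odd_subsets P. a ^ ?D S - 1)"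
    using Opos c by (intro dvd_imp_le dvd) auto
  also have "\<dots> \<le> c * a ^ (\<Sum>S\<in>odd_subsets P. ?D S)" using O by simp
  finally have "real (\<Prod>S\<in>even_subsets P. a ^ ?D S - 1) \<le> real (c * a ^ (\<Sum>S\<in>odd_subsets P. ?D S))"
    by (simp only: of_nat_le_iff)
  with E have "real a ^ (totient N + (\<Sum>S\<in>odd_subsets P. ?D S)) / 4 <
      real c * real a ^ (\<Sum>S\<in>odd_subsets P. ?D S)"
    using totient_inclusion_exclusion[OF N] by (simp add: P_def)
  hence "real (a ^ totient N) < real (4 * c)" using a by (simp add: power_add field_simps)
  thus ?thesis by (simp only: of_nat_less_iff)
qed

lemma even_odd_subsets_singleton:
  "even_subsets {x} = {{}}" "odd_subsets {x} = {{x}}"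
  by (auto simp: even_subsets_def odd_subsets_def subset_singleton_iff)

lemma even_odd_subsets_pair:
  assumes "x \<noteq> y"
  shows "even_subsets {x, y} = {{}, {x, y}}" "odd_subsets {x, y} = {{x}, {y}}"
  using assms by (auto simp: even_subsets_def odd_subsets_def Pow_insert)

lemma prime_factors_numerals:
  "prime_factors (3::nat) = {3}" "prime_factors (5::nat) = {5}"
  "prime_factors (6::nat) = {2, 3}" "prime_factors (10::nat) = {2, 5}"
proof -
  have p: "prime (2::nat)" "prime (3::nat)" "prime (5::nat)" by simp_all
  show "prime_factors (3::nat) = {3}" "prime_factors (5::nat) = {5}"
    using p by (simp_all add: prime_prime_factors)
  have pos: "2 \<noteq> (0::nat)" "3 \<noteq> (0::nat)" "5 \<noteq> (0::nat)" by simp_all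
  have "prime_factors (2 * 3 :: nat) = {2, 3}" "prime_factors (2 * 5 :: nat) = {2, 5}"
    using p by (simp_all only: prime_factors_product[OF pos(1) pos(2)] prime_factors_product[OF pos(1) pos(3)] prime_prime_factors Un_insert_left Un_empty_left)
  thus "prime_factors (6::nat) = {2, 3}" "prime_factors (10::nat) = {2, 5}" by simp_all
qed

text \<open>
  Zsigmondy's theorem. If \<open>N\<close> is a power of 2, then \<open>a^(N/2) + 1\<close> is not divisible by 4, hence has
  an odd prime factor, and this factor is primitive. Otherwise let \<open>R\<close> be the largest prime factor
  of \<open>N\<close>. Without a primitive prime \<open>a^totient N < 4 R\<close>, and since \<open>R - 1\<close> divides \<open>totient N\<close>,
  this leaves \<open>N = 3, 5, 6, 10\<close>.
\<close>

theorem primitive_prime_exists: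
  fixes a N :: nat
  assumes a: "a \<ge> 2" and N: "N \<ge> 3" and exc: "\<not> (a = 2 \<and> N = 6)"
  shows "\<exists>r. prime r \<and> ord r a = N"
proof (cases "\<exists>p\<in>prime_factors N. odd p")
  case False
  have "\<exists>j. N = 2 ^ j"
  proof -
    have "prime_factors N \<subseteq> {2}"
    proof
      fix p assume "p \<in> prime_factors N"
      hence "even p" "prime p" using False by auto
      thus "p \<in> {2}" using primes_dvd_imp_eq[of 2 p] by simp
    qed
    hence "N = (\<Prod>p\<in>prime_factors N. p ^ multiplicity p N)" "prime_factors N \<subseteq> {2}"
      using N by (auto simp: prime_factorization_nat[symmetric])
    hence "N = (\<Prod>p\<in>{2}. p ^ multiplicity p N)"
      by (subst (asm) prod.mono_neutral_left[of "{2}"]) (auto simp: prime_factors_multiplicity)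
    thus ?thesis by auto
  qed
  then obtain j0 where j0: "N = 2 ^ j0" by blast
  have "j0 \<noteq> 0" "j0 \<noteq> 1" using j0 N by (auto intro!: gr0I)
  then obtain j where j: "N = 2 ^ Suc (Suc j)" using j0 by (metis One_nat_def not0_implies_Suc)
  define x where "x = a ^ (2 ^ Suc j)"
  have x2: "x ^ 2 = a ^ N" unfolding x_def j by (simp flip: power_mult add: mult.commute)
  have xsq: "x = (a ^ (2 ^ j)) ^ 2" unfolding x_def by (simp flip: power_mult add: mult.commute)
  have "x \<ge> 2" unfolding x_def using a self_le_power[of a "2 ^ Suc j"] by simp
  have "\<not> 4 dvd x + 1"
  proof -
    have "(y ^ 2) mod 4 \<noteq> 3" for y :: nat
    proof -
      have "(y ^ 2) mod 4 = ((y mod 4) ^ 2) mod 4" by (simp add: power_mod)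
      moreover have "y mod 4 = 0 \<or> y mod 4 = 1 \<or> y mod 4 = 2 \<or> y mod 4 = 3" by linarith
      ultimately show ?thesis by auto
    qed
    from this[of "a ^ (2 ^ j)"] show ?thesis unfolding xsq by presburger
  qed
  have "\<exists>r. prime r \<and> odd r \<and> r dvd x + 1"
  proof (rule ccontr)
    assume no: "\<not> ?thesis"
    have "prime_factors (x + 1) \<subseteq> {2}"
    proof
      fix p assume "p \<in> prime_factors (x + 1)"
      hence "even p" "prime p" using no by (auto simp: in_prime_factors_iff)
      thus "p \<in> {2}" using primes_dvd_imp_eq[of 2 p] by simp
    qed
    moreover have "x + 1 = (\<Prod>p\<in>prime_factors (x + 1). p ^ multiplicity p (x + 1))"
      by (simp add: prime_factorization_nat[symmetric])
    ultimately have "x + 1 = (\<Prod>p\<in>{2}. p ^ multiplicity p (x + 1))"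
      by (subst (asm) prod.mono_neutral_left[of "{2}"]) (auto simp: prime_factors_multiplicity)
    hence e: "x + 1 = 2 ^ multiplicity 2 (x + 1)" by simp
    have "multiplicity 2 (x + 1) \<ge> 2"
    proof (rule ccontr)
      assume "\<not> ?thesis"
      hence "multiplicity 2 (x + 1) \<le> 1" by simp
      hence "(2::nat) ^ multiplicity 2 (x + 1) \<le> 2 ^ 1" by (intro power_increasing) auto
      thus False using e \<open>x \<ge> 2\<close> by simp
    qed
    hence "(2::nat)^2 dvd x + 1" by (subst e) (rule le_imp_power_dvd)
    thus False using \<open>\<not> 4 dvd x + 1\<close> by simp
  qed
  then obtain r where r: "prime r" "odd r" "r dvd x + 1" by blast
  have "r dvd (x + 1) * (x - 1)" using r(3) by (rule dvd_mult2)
  also have "(x + 1) * (x - 1) = a ^ N - 1"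
    using \<open>x \<ge> 2\<close> by (simp flip: x2 add: algebra_simps power2_eq_square diff_mult_distrib2)
  finally have "ord r a dvd N" using order_divides_iff[of a r N] a by simp
  hence "ord r a dvd 2 ^ Suc (Suc j)" unfolding j .
  then obtain i where i: "i \<le> Suc (Suc j)" "ord r a = 2 ^ i"
    unfolding divides_primepow_nat[OF two_is_prime_nat] by blast
  have "i = Suc (Suc j)"
  proof (rule ccontr)
    assume "i \<noteq> Suc (Suc j)"
    hence "ord r a dvd 2 ^ Suc j" using i by (simp add: le_imp_power_dvd del: power_Suc)
    hence "r dvd x - 1" using order_divides_iff[of a r "2 ^ Suc j"] a by (simp add: x_def)
    hence "r dvd (x + 1) - (x - 1)" by (rule dvd_diff_nat[OF r(3)])
    hence "r dvd 2" using \<open>x \<ge> 2\<close> by simp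
    thus False using r by (metis primes_dvd_imp_eq two_is_prime_nat)
  qed
  thus ?thesis using r i j by auto
next
  case True
  show ?thesis
  proof (rule ccontr)
    assume no: "\<not> ?thesis"
    define R where "R = Max (prime_factors N)"
    have R: "R \<in> prime_factors N" using True unfolding R_def by (intro Max_in) auto
    have Rmax: "p \<le> R" if "p \<in> prime_factors N" for p unfolding R_def using that by simp
    hence "prime R" "R dvd N" using R by auto
    have dvd: "(\<Prod>S\<in>even_subsets (prime_factors N). a ^ (N div \<Prod>S) - 1) dvd
         R * (\<Prod>S\<in>odd_subsets (prime_factors N). a ^ (N div \<Prod>S) - 1)"
      unfolding R_def using N a True no by (intro no_primitive_prime_imp_dvd) auto
    have Rpos: "R > 0" using \<open>prime R\<close> prime_gt_0_nat by blast
    have bound: "a ^ totient N < 4 * R"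
      using totient_product_bound[OF a _ dvd] N Rpos by simp
    have bound2: "2 ^ totient N < 4 * R"
      using power_mono[of 2 a "totient N"] a bound by simp
    have pw: "2 ^ e < 4 * R" if "e \<le> totient N" for e
      using power_increasing[OF that, of "2::nat"] bound2 by linarith
    have R3: "R \<ge> 3"
    proof -
      obtain p where p: "p \<in> prime_factors N" "odd p" using True by blast
      hence "p \<ge> 2" using prime_ge_2_nat by auto
      hence "p \<ge> 3" using p by (cases "p = 2") auto
      thus ?thesis using Rmax[OF p(1)] by simp
    qed
    have tdvd: "R - 1 dvd totient N"
      using totient_dvd[OF \<open>R dvd N\<close>] \<open>prime R\<close> by (simp add: totient_prime)
    have tpos: "totient N > 0" using N by simp
    have "R - 1 \<le> totient N" using dvd_imp_le[OF tdvd tpos] .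
    hence "2 ^ (R - 1) < 4 * R" by (rule pw)
    moreover have "2 ^ (n + 6) \<ge> 4 * (n + 7)" for n :: nat
    proof (induction n)
      case (Suc n)
      have "(2::nat) ^ (Suc n + 6) = 2 * 2 ^ (n + 6)" by (simp only: add_Suc power_Suc)
      thus ?case using Suc by simp
    qed simp
    ultimately have "R < 7"
    proof (rule_tac ccontr)
      assume "2 ^ (R - 1) < 4 * R" and *: "\<And>n::nat. 2 ^ (n + 6) \<ge> 4 * (n + 7)" and "\<not> R < 7"
      then obtain n where "R = n + 7" using le_Suc_ex[of 7 R] by (auto simp: add.commute)
      thus False using *[of n] \<open>2 ^ (R - 1) < 4 * R\<close> by (simp add: add.commute)
    qed
    hence "R \<in> {3, 4, 5, 6}" using R3 by auto
    moreover have "\<not> prime (4::nat)" "\<not> prime (6::nat)"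
      using prime_product[of "2::nat" 2] prime_product[of "2::nat" 3] by auto
    ultimately have "R = 3 \<or> R = 5" using \<open>prime R\<close> by auto
    obtain n where n: "N = R * n" using \<open>R dvd N\<close> by (auto elim: dvdE)
    have n0: "n > 0" using n N by (auto intro: gr0I)
    have "n = 1 \<or> n = 2"
    proof (cases "R dvd n")
      case True
      hence "R ^ 2 dvd N" using n by (simp add: power2_eq_square)
      hence "totient (R ^ 2) dvd totient N" by (rule totient_dvd)
      moreover have "totient (R ^ 2) = R * (R - 1)"
        using totient_prime_power[OF \<open>prime R\<close>, of 2] by simp
      ultimately have "R * (R - 1) \<le> totient N" using tpos by (auto intro: dvd_imp_le)
      hence "(2::nat) ^ (R * (R - 1)) < 4 * R" by (rule pw)
      thus ?thesis using \<open>R = 3 \<or> R = 5\<close> by auto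
    next
      case False
      hence "coprime R n" using \<open>prime R\<close> by (simp add: prime_imp_coprime)
      hence t: "totient N = (R - 1) * totient n"
        unfolding n using \<open>prime R\<close> by (simp add: totient_mult_coprime totient_prime)
      have "totient n < 2"
      proof (rule ccontr)
        assume "\<not> totient n < 2"
        hence "(R - 1) * 2 \<le> totient N" unfolding t by simp
        hence "(2::nat) ^ ((R - 1) * 2) < 4 * R" by (rule pw)
        thus False using \<open>R = 3 \<or> R = 5\<close> by auto
      qed
      thus ?thesis using totient_gt_1[of n] n0 by (cases "n > 2") auto
    qed
    hence cases: "N = 3 \<and> R = 3 \<or> N = 6 \<and> R = 3 \<or> N = 5 \<and> R = 5 \<or> N = 10 \<and> R = 5"
      using n \<open>R = 3 \<or> R = 5\<close> by auto
    have apos: "a ^ n > 1" if "n > 0" for n using one_less_power[of a n] that a by simp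
    have le: "int (\<Prod>S\<in>even_subsets (prime_factors N). a ^ (N div \<Prod>S) - 1) \<le>
         int (R * (\<Prod>S\<in>odd_subsets (prime_factors N). a ^ (N div \<Prod>S) - 1))"
      if "(\<Prod>S\<in>odd_subsets (prime_factors N). a ^ (N div \<Prod>S) - 1) > 0"
      unfolding of_nat_le_iff using that Rpos by (intro dvd_imp_le dvd) auto
    have cancel: "P * y \<le> b * P \<Longrightarrow> P > 0 \<Longrightarrow> y \<le> b" for P y b :: int
      by (simp add: mult.commute)
    define z where "z = int a - 2"
    have z: "int a = z + 2" "z \<ge> 0" using a by (auto simp: z_def)
    from cases show False
    proof (elim disjE conjE)
      assume eq: "N = 3" "R = 3"
      have "int a ^ 3 - 1 \<le> 3 * (int a - 1)"
        using le apos[of 1] apos[of 3]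
        by (simp add: eq prime_factors_numerals even_odd_subsets_singleton of_nat_diff)
      hence "z^3 + 6 * z^2 + 9 * z + 4 \<le> 0" unfolding z
        by (simp add: power3_eq_cube power2_eq_square algebra_simps)
      thus False using z(2) by (smt (verit) zero_le_power mult_nonneg_nonneg)
    next
      assume eq: "N = 5" "R = 5"
      have "int a ^ 5 - 1 \<le> 5 * (int a - 1)"
        using le apos[of 1] apos[of 5]
        by (simp add: eq prime_factors_numerals even_odd_subsets_singleton of_nat_diff)
      moreover have "int a * 2 ^ 4 \<le> int a * int a ^ 4"
        using a by (intro mult_left_mono power_mono) auto
      moreover have "int a ^ 5 = int a * int a ^ 4" by (simp add: eval_nat_numeral)
      ultimately have "int a * 16 \<le> int a ^ 5" "int a ^ 5 \<le> 5 * (int a - 1) + 1" by simp_all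
      moreover have "int a \<ge> 2" using a by simp
      moreover have "x * 16 \<le> y \<Longrightarrow> y \<le> 5 * (x - 1) + 1 \<Longrightarrow> 2 \<le> x \<Longrightarrow> False" for x y :: int
        by presburger
      ultimately show False by metis
    next
      assume eq: "N = 6" "R = 3"
      hence "a \<noteq> 2" using exc by auto
      have pair: "even_subsets {2, 3::nat} = {{}, {2, 3}}" "odd_subsets {2, 3::nat} = {{2}, {3}}"
        by (rule even_odd_subsets_pair; simp)+
      have "(int a ^ 6 - 1) * (int a - 1) \<le> 3 * ((int a ^ 3 - 1) * (int a ^ 2 - 1))"
        using le apos[of 1] apos[of 2] apos[of 3] apos[of 6]
        by (simp add: eq prime_factors_numerals pair of_nat_diff)
      moreover have "(int a ^ 6 - 1) * (int a - 1) =
          ((int a ^ 3 - 1) * (int a ^ 2 - 1)) * (int a ^ 2 - int a + 1)"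
        by (simp add: eval_nat_numeral algebra_simps)
      moreover have "(int a ^ 3 - 1) * (int a ^ 2 - 1) > 0"
        using apos[of 2] apos[of 3] by (intro mult_pos_pos) (simp_all flip: of_nat_power)
      ultimately have "int a ^ 2 - int a + 1 \<le> 3" using cancel by metis
      moreover have "int a * 3 \<le> int a * int a" using a \<open>a \<noteq> 2\<close> by (intro mult_left_mono) auto
      ultimately show False using a \<open>a \<noteq> 2\<close> by (simp add: power2_eq_square)
    next
      assume eq: "N = 10" "R = 5"
      have pair: "even_subsets {2, 5::nat} = {{}, {2, 5}}" "odd_subsets {2, 5::nat} = {{2}, {5}}"
        by (rule even_odd_subsets_pair; simp)+
      have "(int a ^ 10 - 1) * (int a - 1) \<le> 5 * ((int a ^ 5 - 1) * (int a ^ 2 - 1))"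
        using le apos[of 1] apos[of 2] apos[of 5] apos[of 10]
        by (simp add: eq prime_factors_numerals pair of_nat_diff)
      moreover have "(int a ^ 10 - 1) * (int a - 1) =
          ((int a ^ 5 - 1) * (int a ^ 2 - 1)) * (int a ^ 4 - int a ^ 3 + int a ^ 2 - int a + 1)"
        by (simp add: eval_nat_numeral algebra_simps)
      moreover have "(int a ^ 5 - 1) * (int a ^ 2 - 1) > 0"
        using apos[of 2] apos[of 5] by (intro mult_pos_pos) (simp_all flip: of_nat_power)
      ultimately have "int a ^ 4 - int a ^ 3 + int a ^ 2 - int a + 1 \<le> 5" using cancel by metis
      moreover have "int a ^ 4 - int a ^ 3 + int a ^ 2 - int a + 1 =
          z^4 + 7 * z^3 + 19 * z^2 + 23 * z + 11"
        unfolding z by (simp add: eval_nat_numeral algebra_simps)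
      ultimately show False using z(2) by (smt (verit) zero_le_power mult_nonneg_nonneg)
    qed
  qed
qed

section \<open>Products of consecutive terms\<close>

text \<open>
  The exponents run over \<open>a < c \<le> b\<close> here, but over \<open>a \<le> c < b\<close> in \<open>prod_plus\<close>, as in the closed
  form of the valency.
\<close>

definition prod_minus :: "nat \<Rightarrow> nat \<Rightarrow> nat \<Rightarrow> nat" where
  "prod_minus q a b = (\<Prod>c\<in>{a<..b}. q ^ c - 1)"

definition prod_plus :: "nat \<Rightarrow> nat \<Rightarrow> nat \<Rightarrow> nat \<Rightarrow> nat" where
  "prod_plus q s a b = (\<Prod>c\<in>{a..<b}. s * q ^ c + 1)"

lemma prod_minus_pos: "q \<ge> 2 \<Longrightarrow> prod_minus q a b > 0"
proof -
  assume "q \<ge> 2"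
  hence "q ^ c > 1" if "c > 0" for c using one_less_power[of q c] that by simp
  thus ?thesis unfolding prod_minus_def by (intro prod_pos) auto
qed

lemma prod_plus_pos: "prod_plus q s a b > 0"
  by (simp add: prod_plus_def)

lemma prod_minus_split: "a \<le> b \<Longrightarrow> b \<le> c \<Longrightarrow> prod_minus q a c = prod_minus q a b * prod_minus q b c"
  unfolding prod_minus_def
  by (subst prod.union_disjoint[symmetric]) (auto simp: ivl_disj_un)

lemma prod_plus_split: "a \<le> b \<Longrightarrow> b \<le> c \<Longrightarrow> prod_plus q s a c = prod_plus q s a b * prod_plus q s b c"
  unfolding prod_plus_def
  by (subst prod.union_disjoint[symmetric]) (auto simp: ivl_disj_un)

lemma prod_minus_Suc: "a \<le> b \<Longrightarrow> prod_minus q a (Suc b) = prod_minus q a b * (q ^ Suc b - 1)"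
  unfolding prod_minus_def by (simp add: atLeastSucAtMost_greaterThanAtMost[symmetric])

lemma prod_plus_Suc: "a \<le> b \<Longrightarrow> prod_plus q s a (Suc b) = prod_plus q s a b * (s * q ^ b + 1)"
  by (simp add: prod_plus_def)

lemma prod_minus_first: "a < b \<Longrightarrow> prod_minus q a b = (q ^ Suc a - 1) * prod_minus q (Suc a) b"
  using prod_minus_split[of a "Suc a" b q] prod_minus_Suc[of a a q] by (simp add: prod_minus_def)

lemma prod_plus_first: "a < b \<Longrightarrow> prod_plus q s a b = (s * q ^ a + 1) * prod_plus q s (Suc a) b"
  using prod_plus_split[of a "Suc a" b q s] by (simp add: prod_plus_def)

lemma prod_minus_same [simp]: "prod_minus q a a = 1"
  by (simp add: prod_minus_def)

lemma prod_plus_same [simp]: "prod_plus q s a a = 1"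
  by (simp add: prod_plus_def)

text \<open>
  As lists, products over short intervals can be evaluated by rewriting.
\<close>

definition prod_minus_list :: "nat \<Rightarrow> nat \<Rightarrow> nat \<Rightarrow> nat" where
  "prod_minus_list q a n = prod_list (map (\<lambda>c. q ^ (a + c) - 1) [1..<Suc n])"

definition prod_plus_list :: "nat \<Rightarrow> nat \<Rightarrow> nat \<Rightarrow> nat \<Rightarrow> nat" where
  "prod_plus_list q s a n = prod_list (map (\<lambda>c. s * q ^ (a + c) + 1) [0..<n])"

lemma prod_minus_eq_list: "prod_minus q a (a + n) = prod_minus_list q a n"
  by (induction n) (simp_all add: prod_minus_list_def prod_minus_Suc)

lemma prod_plus_eq_list: "prod_plus q s a (a + n) = prod_plus_list q s a n"
  by (induction n) (simp_all add: prod_plus_list_def prod_plus_Suc)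

text \<open>
  All values of \<open>(\<kappa>, \<mu>, a, g, k', \<epsilon>, i)\<close> for \<open>p = 2\<close> and \<open>f = 1\<close> at which no exponent exceeds 6,
  so that Zsigmondy's theorem may fail for the largest exponent, and the two sides still have the
  same power of \<open>p\<close>.
\<close>

definition exceptional_parameters :: "(nat \<times> nat \<times> nat \<times> nat \<times> nat \<times> nat \<times> nat) set" where
  "exceptional_parameters = {
    (2,1,0,0,1,1,3), (2,1,0,0,2,1,5), (2,1,0,1,1,0,1), (2,1,0,1,2,0,3), (2,1,0,1,3,0,5),
    (2,1,0,2,1,0,0), (2,1,0,2,2,0,2), (2,1,0,2,3,0,4), (2,1,1,0,1,0,0), (2,1,1,0,2,0,2),
    (2,1,1,0,3,0,4), (2,1,1,1,2,0,1), (2,1,1,1,3,0,3), (2,1,1,1,4,0,5), (2,1,2,0,2,0,0),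
    (2,1,2,0,3,0,2), (2,1,2,0,4,0,4), (3,2,0,1,3,0,0)} \<union> {
    (3,1,0,0,0,1,4), (3,1,0,1,0,0,2), (3,1,1,0,0,0,1), (3,1,1,0,1,0,5),
    (4,2,0,0,0,1,0), (4,2,0,0,1,1,2), (4,2,0,0,2,1,4)}"

text \<open>
  The last hypothesis is the equality of the exponents of \<open>p\<close>; it determines \<open>i\<close> from the other
  parameters, which are bounded.
\<close>

lemma small_parameters_exceptional:
  fixes f \<kappa> \<mu> a g k' \<epsilon> i :: nat
  assumes f: "f = 1 \<or> f = 2" and \<kappa>: "\<kappa> \<ge> 2" "1 \<le> \<mu>" "\<mu> < \<kappa>" and ag: "f * (a + \<kappa>) + g \<le> 3 + f"
    and k': "3 \<le> k' + \<kappa>" "f * (k' + \<kappa>) \<le> 6"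
    and eps: "\<epsilon> = 0 \<and> f * a + g > 0 \<or> \<epsilon> = 1 \<and> f = 1 \<and> a = 0 \<and> g = 0"
    and i: "f * (i + \<mu>) \<le> 6"
    and v: "2 * (f * \<kappa> * (2 * k' + \<kappa>)) + 2 * \<epsilon> + f * \<mu> =
      \<mu> * (4 * (f * (k' + \<kappa> + a)) + 2 * g + f * (2 * i + \<mu>))"
  shows "f = 1 \<and> (\<kappa>, \<mu>, a, g, k', \<epsilon>, i) \<in> exceptional_parameters"
proof -
  have "f \<ge> 1" using f by auto
  hence "1 * (a + \<kappa>) \<le> f * (a + \<kappa>)" "f * (a + 1) \<ge> f" by (intro mult_le_mono1, simp_all)
  have "a + \<kappa> + g \<le> 4" using f ag \<kappa> by auto
  hence K: "\<kappa> = 2 \<or> \<kappa> = 3 \<or> \<kappa> = 4" "a = 0 \<or> a = 1 \<or> a = 2" "g = 0 \<or> g = 1 \<or> g = 2" using \<kappa> by arith+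
  have M: "\<mu> = 1 \<or> \<mu> = 2 \<or> \<mu> = 3" using \<kappa> K(1) by arith
  have "k' + \<kappa> \<le> 6" using f k' by auto
  hence K': "k' = 0 \<or> k' = 1 \<or> k' = 2 \<or> k' = 3 \<or> k' = 4" using \<kappa> by arith
  show ?thesis using f
  proof
    assume f: "f = 2"
    hence "\<kappa> = 2" "a = 0" "k' = 1" "g = 1" "\<mu> = 1" "\<epsilon> = 0" using ag \<kappa> k' eps by (auto; arith)+
    hence "2 * i = 3" using v f by simp
    thus ?thesis by presburger
  next
    assume f: "f = 1"
    have ag': "a + \<kappa> + g \<le> 4" using ag unfolding f by simp
    have eps': "\<epsilon> = (if a = 0 \<and> g = 0 then 1 else 0)" using eps unfolding f by auto
    have v': "2 * (\<kappa> * (2 * k' + \<kappa>)) + 2 * \<epsilon> + \<mu> =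
        \<mu> * (4 * (k' + \<kappa> + a) + 2 * g + (2 * i + \<mu>))"
      using v unfolding f by simp
    have i6: "i + \<mu> \<le> 6" using i unfolding f by simp
    have k6: "3 \<le> k' + \<kappa>" "k' + \<kappa> \<le> 6" using k' unfolding f by simp_all
    consider "\<kappa> = 2" "\<mu> = 1" | "\<kappa> = 3" "\<mu> = 1" | "\<kappa> = 3" "\<mu> = 2"
      | "\<kappa> = 4" "\<mu> = 1" | "\<kappa> = 4" "\<mu> = 2" | "\<kappa> = 4" "\<mu> = 3"
      using K(1) M \<kappa> by linarith
    thus ?thesis
    proof cases
      case 1
      have "i + 2 * a + g = 2 * k' + \<epsilon>" using v' unfolding 1 by simp
      moreover have "a + g \<le> 2" using ag' 1 by simp
      ultimately show ?thesis using K(2,3) K' k6 i6 unfolding exceptional_parameters_def f 1 eps'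
        by (elim disjE) simp_all
    next
      case 2
      have "i + 2 * a + g = 4 * k' + 3 + \<epsilon>" using v' unfolding 2 by simp
      moreover have "a + g \<le> 1" using ag' 2 by simp
      ultimately show ?thesis using K(2,3) K' k6 i6 unfolding exceptional_parameters_def f 2 eps'
        by (elim disjE) simp_all
    next
      case 3
      have v3: "4 * i + 8 * a + 4 * g + 8 = 4 * k' + 2 * \<epsilon>" using v' unfolding 3 by simp
      have "\<not> (a = 0 \<and> g = 0)"
      proof
        assume *: "a = 0 \<and> g = 0"
        hence "4 * i + 8 = 4 * k' + 2" using v3 eps' by simp
        thus False by presburger
      qed
      hence "\<epsilon> = 0" "a + g \<ge> 1" using eps' by auto
      moreover have "k' \<le> 3" using k6 3 by simp
      ultimately have "a = 0 \<and> g = 1 \<and> i = 0 \<and> k' = 3 \<and> \<epsilon> = 0" using v3 by auto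
      thus ?thesis unfolding exceptional_parameters_def f 3 by simp
    next
      case 4
      have "2 * i + 4 * a + 2 * g = 12 * k' + 16 + 2 * \<epsilon>" using v' unfolding 4 by simp
      moreover have "a = 0" "g = 0" "i \<le> 5" using ag' i6 4 by simp_all
      ultimately have False by presburger
      thus ?thesis ..
    next
      case 5
      have ag0: "a = 0" "g = 0" using ag' 5 by simp_all
      hence e1: "\<epsilon> = 1" using eps' by simp
      have "i = 2 * k'" using v' unfolding 5 ag0 e1 by simp
      moreover have "k' = 0 \<or> k' = 1 \<or> k' = 2" using k6 5 by arith
      ultimately show ?thesis unfolding exceptional_parameters_def f 5 ag0 e1 by (elim disjE) simp_all
    next
      case 6
      have ag0: "a = 0" "g = 0" using ag' 6 by simp_all
      hence e1: "\<epsilon> = 1" using eps' by simp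
      have "6 * i + 20 = 4 * k'" using v' unfolding 6 ag0 e1 by simp
      moreover have "k' \<le> 2" using k6 6 by simp
      ultimately have False by presburger
      thus ?thesis ..
    qed
  qed
qed

text \<open>
  The left-hand side is linear in the factor that involves \<open>l\<close>, which takes at most six values;
  they are the values of \<open>B1\<close> and \<open>B2\<close> below.
\<close>

lemma exceptional_parameters_no_identity:
  assumes "(\<kappa>, \<mu>, a, g, k', \<epsilon>, i) \<in> exceptional_parameters"
    and l: "l = 0 \<or> l = 1 \<or> l = 2 \<or> l = 3 \<or> l = 4 \<or> l = (5::nat)"
  shows "prod_plus_list 2 (2^g) a \<kappa> * prod_minus_list 2 i \<mu> * prod_minus_list 2 l (\<kappa> - \<mu>) * prod_minus_list 2 a \<kappa> \<noteq>
      (1 + \<epsilon>) * (prod_minus_list 2 k' \<kappa>)^2"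
proof -
  have pm: "prod_minus_list q b 1 = q^(b+1) - 1" "prod_minus_list q b 2 = (q^(b+1) - 1) * (q^(b+2) - 1)"
    "prod_minus_list q b 3 = (q^(b+1) - 1) * (q^(b+2) - 1) * (q^(b+3) - 1)"
    "prod_minus_list q b 4 = (q^(b+1) - 1) * (q^(b+2) - 1) * (q^(b+3) - 1) * (q^(b+4) - 1)" for q b
    by (simp_all add: prod_minus_list_def numeral_eq_Suc)
  have pp: "prod_plus_list q s b 2 = (s*q^b + 1) * (s*q^(b+1) + 1)"
    "prod_plus_list q s b 3 = (s*q^b + 1) * (s*q^(b+1) + 1) * (s*q^(b+2) + 1)"
    "prod_plus_list q s b 4 = (s*q^b + 1) * (s*q^(b+1) + 1) * (s*q^(b+2) + 1) * (s*q^(b+3) + 1)" for q s b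
    by (simp_all add: prod_plus_list_def numeral_eq_Suc mult.assoc del: mult_Suc mult_Suc_right)
  define B1 B2 where "B1 = prod_minus_list 2 l 1" and "B2 = prod_minus_list 2 l 2"
  have B1: "B1 = 1 \<or> B1 = 3 \<or> B1 = 7 \<or> B1 = 15 \<or> B1 = 31 \<or> B1 = 63"
    using l unfolding B1_def pm by (elim disjE) simp_all
  have B2: "B2 = 3 \<or> B2 = 21 \<or> B2 = 105 \<or> B2 = 465 \<or> B2 = 1953 \<or> B2 = 8001"
    using l unfolding B2_def pm by (elim disjE) simp_all
  have B: "prod_minus_list 2 l (2 - 1) = B1" "prod_minus_list 2 l (3 - 2) = B1"
      "prod_minus_list 2 l (3 - 1) = B2" "prod_minus_list 2 l (4 - 2) = B2"
    unfolding B1_def B2_def by (simp_all add: numeral_eq_Suc)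
  show ?thesis
    using assms(1) unfolding exceptional_parameters_def
    apply (elim UnE)
    subgoal
      by (elim insertE emptyE Pair_inject; hypsubst; unfold B pm pp; simp?; (insert B1)?; (elim disjE)?; simp?)
    subgoal
      by (elim insertE emptyE Pair_inject; hypsubst; unfold B pm pp; simp?; (insert B2)?; (elim disjE)?; simp?)
    done
qed

section \<open>The closed form of the valency\<close>

lemma prod_lessThan_add:
  fixes f :: "nat \<Rightarrow> 'a::comm_monoid_mult"
  shows "(\<Prod>r<a + b. f r) = (\<Prod>r<a. f r) * (\<Prod>r<b. f (a + r))"
  by (induction b) (simp_all add: mult.assoc)

lemma real_prod_minus_Suc:
  assumes "q \<ge> 2"
  shows "real (prod_minus q 0 (Suc n)) = real (prod_minus q 0 n) * (real q ^ Suc n - 1)"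
  using assms by (simp add: prod_minus_Suc of_nat_diff)

lemma prod_power_minus_one_descending:
  assumes "q \<ge> 2" "n \<le> M"
  shows "(\<Prod>r<n. real q ^ (M - r) - 1) * real (prod_minus q 0 (M - n)) = real (prod_minus q 0 M)"
  using assms(2)
proof (induction n)
  case (Suc n)
  have "Suc (M - Suc n) = M - n" using Suc.prems by simp
  hence "real (prod_minus q 0 (M - n)) = real (prod_minus q 0 (M - Suc n)) * (real q ^ (M - n) - 1)"
    using real_prod_minus_Suc[OF assms(1), of "M - Suc n"] by simp
  thus ?case using Suc by (simp add: mult_ac)
qed simp

lemma prod_power_minus_power:
  assumes "q \<ge> 2"
  shows "(\<Prod>r<n. real q ^ (e + n) - real q ^ (e + r)) =
    real q ^ (e * n) * real q ^ (\<Sum>{..<n}) * real (prod_minus q 0 n)"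
proof -
  have "(\<Prod>r<n. real q ^ (e + n) - real q ^ (e + r)) =
      (\<Prod>r<n. real q ^ e * real q ^ r * (real q ^ (n - r) - 1))"
  proof (intro prod.cong refl)
    fix r assume "r \<in> {..<n}"
    hence "e + n = e + r + (n - r)" by simp
    hence "real q ^ (e + n) = real q ^ e * real q ^ r * real q ^ (n - r)" by (metis power_add)
    thus "real q ^ (e + n) - real q ^ (e + r) = real q ^ e * real q ^ r * (real q ^ (n - r) - 1)"
      by (simp add: power_add algebra_simps)
  qed
  also have "\<dots> = (real q ^ e) ^ n * (\<Prod>r<n. real q ^ r) * (\<Prod>r<n. real q ^ (n - r) - 1)"
    by (simp add: prod.distrib)
  also have "(\<Prod>r<n. real q ^ (n - r) - 1) = real (prod_minus q 0 n)"
    using prod_power_minus_one_descending[OF assms, of n n] by simp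
  finally show ?thesis by (simp add: power_sum power_mult)
qed

lemma prod_plus_descending:
  assumes "k \<le> D"
  shows "(\<Prod>b<k. 1 + real s * real q ^ (D - 1 - b)) = real (prod_plus q s (D - k) D)"
  using assms
proof (induction k)
  case (Suc k)
  have "D - 1 - k = D - Suc k" "Suc (D - Suc k) = D - k" using Suc.prems by auto
  thus ?case using Suc prod_plus_first[of "D - Suc k" D q s] by (simp add: algebra_simps)
qed simp

text \<open>
  Each of the three ranges of \<open>r\<close> is evaluated on both sides. The second range on the right
  factors because
  \<open>q^d + (t q^n/q^(m+b) - t q^n/q^d)/q - q^(m+b) = (q^(D-b) - 1) q^(m+b) (1 + s q^(D-1-b))\<close>. The
  factors \<open>T l\<close>, \<open>T k\<close> and \<open>G(k + i)\<close> then cancel, and the remaining powers of \<open>q\<close> are collected.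
\<close>

lemma card_related_closed_form:
  fixes q l k i D n t s X :: nat
  assumes q: "q \<ge> 2" and kD: "k \<le> D"
    and W: "t * q ^ n = s * q ^ (2 * (D + (l + k + i)))"
    and eq: "real X *
      (\<Prod>r<l + k + i. real q ^ (if r < l then l else if r < l + k then l + k else l + k + i) - real q ^ r) =
      (\<Prod>r<l + k + i. if r < l then real q ^ (l + k + i) - real q ^ r
        else if r < l + k
          then real q ^ (D + (l + k + i)) + (t * q ^ n / q ^ (l + k + i + r - l)
                 - t * q ^ n / q ^ (D + (l + k + i))) / q - real q ^ (l + k + i + r - l)
        else (t * q ^ n / q ^ r - t * q ^ n / q ^ (l + k + i + k)) / q)"
  shows "X * (prod_minus q 0 l * prod_minus q 0 k ^ 2 * prod_minus q 0 i * prod_minus q 0 (D - k)) =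
    prod_minus q 0 (l + k + i) * prod_minus q 0 D * prod_plus q s (D - k) D *
    (s ^ i * q ^ (k^2 + 2 * D * i + \<Sum>{..<i}))"
proof -
  define Q where "Q = real q"
  define H where "H = (\<lambda>n. real (prod_minus q 0 n))"
  define T where "T = (\<lambda>n::nat. Q ^ (\<Sum>{..<n}))"
  define P where "P = real (prod_plus q s (D - k) D)"
  define m where "m = l + k + i"
  have Q: "Q > 0" using q by (simp add: Q_def)
  have Hpos: "H n > 0" for n using prod_minus_pos[OF q] by (simp add: H_def)
  have W': "real (t * q ^ n) = real s * Q ^ (2 * (D + m))"
    unfolding W by (simp add: Q_def m_def)
  note three = prod_lessThan_add[of _ "l + k" i] prod_lessThan_add[of _ l k]

  have L1: "(\<Prod>r<l. Q ^ l - Q ^ r) = T l * H l"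
    using prod_power_minus_power[OF q, of 0 l] by (simp add: Q_def H_def T_def)
  have L2: "(\<Prod>b<k. Q ^ (l + k) - Q ^ (l + b)) = Q ^ (l * k) * T k * H k"
    using prod_power_minus_power[OF q, of l k] by (simp add: Q_def H_def T_def)
  have L3: "(\<Prod>a<i. Q ^ m - Q ^ (l + k + a)) = Q ^ ((l + k) * i) * T i * H i"
    using prod_power_minus_power[OF q, of "l + k" i] by (simp add: Q_def H_def T_def m_def)

  have R1: "(\<Prod>r<l. Q ^ m - Q ^ r) * H (k + i) = T l * H m"
  proof -
    have "(\<Prod>r<l. Q ^ m - Q ^ r) = (\<Prod>r<l. Q ^ r * (Q ^ (m - r) - 1))"
      by (intro prod.cong refl) (simp add: right_diff_distrib m_def flip: power_add)
    also have "\<dots> = T l * (\<Prod>r<l. Q ^ (m - r) - 1)" by (simp add: prod.distrib T_def power_sum)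
    finally show ?thesis
      using prod_power_minus_one_descending[OF q, of l m] by (simp add: H_def Q_def m_def mult.assoc)
  qed
  have R2: "(\<Prod>b<k. Q ^ (D + m) + (real (t * q ^ n) / Q ^ (m + b) - real (t * q ^ n) / Q ^ (D + m)) / Q
      - Q ^ (m + b)) * H (D - k) = Q ^ (m * k) * T k * H D * P"
  proof -
    have "(\<Prod>b<k. Q ^ (D + m) + (real (t * q ^ n) / Q ^ (m + b) - real (t * q ^ n) / Q ^ (D + m)) / Q
          - Q ^ (m + b)) =
        (\<Prod>b<k. Q ^ m * Q ^ b * (Q ^ (D - b) - 1) * (1 + real s * Q ^ (D - 1 - b)))"
    proof (intro prod.cong refl)
      fix b assume "b \<in> {..<k}"
      hence b: "b < k" by simp
      define c where "c = D - 1 - b"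
      have D: "D = b + c + 1" using b kD by (simp add: c_def)
      have "real (t * q ^ n) / Q ^ (m + b) = real s * Q ^ (m + b + 2 * c + 2)"
        unfolding W' D using Q by (simp add: power_add power_mult power2_eq_square field_simps)
      moreover have "real (t * q ^ n) / Q ^ (D + m) = real s * Q ^ (m + b + c + 1)"
        unfolding W' D using Q by (simp add: power_add power_mult power2_eq_square field_simps)
      moreover have "D - b = c + 1" using D by simp
      ultimately show "Q ^ (D + m) + (real (t * q ^ n) / Q ^ (m + b) - real (t * q ^ n) / Q ^ (D + m)) / Q
          - Q ^ (m + b) = Q ^ m * Q ^ b * (Q ^ (D - b) - 1) * (1 + real s * Q ^ (D - 1 - b))"
        unfolding c_def[symmetric] using Q D
        by (simp add: power_add power_mult power2_eq_square field_simps)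
    qed
    also have "\<dots> = Q ^ (m * k) * T k * (\<Prod>b<k. Q ^ (D - b) - 1) * P"
      using prod_plus_descending[OF kD, of s q]
      by (simp add: prod.distrib T_def P_def Q_def power_sum power_mult)
    finally show ?thesis
      using prod_power_minus_one_descending[OF q kD] by (simp add: H_def Q_def mult_ac)
  qed
  define E where "E = (2 * D + l + i - 1) * i"
  have R3: "(\<Prod>a<i. (real (t * q ^ n) / Q ^ (l + k + a) - real (t * q ^ n) / Q ^ (m + k)) / Q) * H k =
      real s ^ i * Q ^ E * H (k + i)"
  proof -
    have "(\<Prod>a<i. (real (t * q ^ n) / Q ^ (l + k + a) - real (t * q ^ n) / Q ^ (m + k)) / Q) =
        (\<Prod>a<i. real s * Q ^ (2 * D + l + i - 1) * (Q ^ (k + i - a) - 1))"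
    proof (intro prod.cong refl)
      fix a assume "a \<in> {..<i}"
      then obtain c where i: "i = a + c + 1" by (auto dest: less_imp_Suc_add)
      have x: "real (t * q ^ n) / Q ^ (l + k + a) = real s * (Q ^ (2 * D + l + i - 1) * Q * Q ^ (k + i - a))"
        unfolding W' m_def i using Q by (simp add: power_add power_mult power2_eq_square field_simps)
      have y: "real (t * q ^ n) / Q ^ (m + k) = real s * (Q ^ (2 * D + l + i - 1) * Q)"
        unfolding W' m_def i using Q by (simp add: power_add power_mult power2_eq_square field_simps)
      show "(real (t * q ^ n) / Q ^ (l + k + a) - real (t * q ^ n) / Q ^ (m + k)) / Q =
          real s * Q ^ (2 * D + l + i - 1) * (Q ^ (k + i - a) - 1)"
        unfolding x y using Q by (simp add: field_simps)
    qed
    also have "\<dots> = real s ^ i * Q ^ E * (\<Prod>a<i. Q ^ (k + i - a) - 1)"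
      by (simp add: prod.distrib power_mult_distrib E_def power_mult)
    finally show ?thesis
      using prod_power_minus_one_descending[OF q, of i "k + i"] by (simp add: H_def Q_def mult.assoc)
  qed

  have eq': "real X * ((T l * H l) * (Q ^ (l * k) * T k * H k) * (Q ^ ((l + k) * i) * T i * H i)) =
      (\<Prod>r<l. Q ^ m - Q ^ r) *
      (\<Prod>b<k. Q ^ (D + m) + (real (t * q ^ n) / Q ^ (m + b) - real (t * q ^ n) / Q ^ (D + m)) / Q
        - Q ^ (m + b)) *
      (\<Prod>a<i. (real (t * q ^ n) / Q ^ (l + k + a) - real (t * q ^ n) / Q ^ (m + k)) / Q)"
    unfolding L1[symmetric] L2[symmetric] L3[symmetric]
    using eq unfolding three by (simp add: Q_def m_def add_ac)
  let ?A = "T l * T k * H (k + i)"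
  have "real X * (H l * H k ^ 2 * H i * H (D - k)) * (Q ^ (l * k + (l + k) * i) * T i) * ?A =
      (real X * ((T l * H l) * (Q ^ (l * k) * T k * H k) * (Q ^ ((l + k) * i) * T i * H i))) *
      (H (k + i) * H (D - k) * H k)"
    by (simp only: power_add power2_eq_square mult_ac)
  also have "\<dots> = (T l * H m) * (Q ^ (m * k) * T k * H D * P) * (real s ^ i * Q ^ E * H (k + i))"
    unfolding eq' R1[symmetric] R2[symmetric] R3[symmetric] by (simp only: mult_ac)
  also have "\<dots> = H m * H D * P * real s ^ i * Q ^ (m * k + E) * ?A"
    by (simp only: power_add mult_ac)
  also have "m * k + E = (l * k + (l + k) * i) + (k^2 + 2 * D * i + \<Sum>{..<i}) + \<Sum>{..<i}"
  proof (cases i)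
    case (Suc j)
    have "(\<Sum>{..<Suc j}) + \<Sum>{..<Suc j} = j * Suc j" by (induction j) simp_all
    thus ?thesis unfolding E_def m_def Suc
      by (simp add: algebra_simps power2_eq_square del: sum.lessThan_Suc)
  qed (simp add: E_def m_def algebra_simps power2_eq_square)
  also have "H m * H D * P * real s ^ i *
      Q ^ ((l * k + (l + k) * i) + (k^2 + 2 * D * i + \<Sum>{..<i}) + \<Sum>{..<i}) * ?A =
      H m * H D * P * (real s ^ i * Q ^ (k^2 + 2 * D * i + \<Sum>{..<i})) *
        (Q ^ (l * k + (l + k) * i) * T i) * ?A"
    by (simp only: power_add T_def mult_ac)
  finally have "real X * (H l * H k ^ 2 * H i * H (D - k)) =
      H m * H D * P * (real s ^ i * Q ^ (k^2 + 2 * D * i + \<Sum>{..<i}))"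
    using Q Hpos[of "k + i"] by (simp add: T_def)
  hence "real (X * (prod_minus q 0 l * prod_minus q 0 k ^ 2 * prod_minus q 0 i * prod_minus q 0 (D - k))) =
    real (prod_minus q 0 (l + k + i) * prod_minus q 0 D * prod_plus q s (D - k) D *
    (s ^ i * q ^ (k^2 + 2 * D * i + \<Sum>{..<i})))"
    by (simp add: H_def P_def Q_def m_def)
  thus ?thesis by (simp only: of_nat_eq_iff)
qed

section \<open>Valuations and congruences of the products\<close>

context
  fixes p f g :: nat
  assumes p: "prime p" and f: "f \<ge> 1"
begin

lemma power_f_ge_2: "p ^ f \<ge> 2"
  using prime_ge_2_nat[OF p] self_le_power[of p f] f by linarith

lemma p_ge_2: "p \<ge> 2" using prime_ge_2_nat[OF p] .

lemma power_q: "(p ^ f) ^ c = p ^ (f * c)"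
  by (simp add: power_mult)

text \<open>
  Every factor is \<open>-1\<close> modulo the power of \<open>p\<close> in the first one.
\<close>

lemma cong_prod_minus:
  assumes "K \<le> f * Suc a" "a \<le> b"
  shows "[int (prod_minus (p ^ f) a b) = (-1) ^ (b - a)] (mod int p ^ K)"
proof -
  have "int (prod_minus (p ^ f) a b) = (\<Prod>c\<in>{a<..b}. int p ^ (f * c) - 1)"
    unfolding prod_minus_def of_nat_prod using p_ge_2
    by (intro prod.cong refl) (simp add: of_nat_diff power_mult)
  also have "[(\<Prod>c\<in>{a<..b}. int p ^ (f * c) - 1) = (\<Prod>c\<in>{a<..b}. - 1)] (mod int p ^ K)"
  proof (intro cong_prod)
    fix c assume "c \<in> {a<..b}"
    hence "f * Suc a \<le> f * c" by (intro mult_le_mono2) auto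
    hence "K \<le> f * c" using assms(1) by linarith
    hence "int p ^ K dvd int p ^ (f * c)" by (rule le_imp_power_dvd)
    hence "int p ^ K dvd (int p ^ (f * c) - 1) - (- 1)" by simp
    thus "[int p ^ (f * c) - 1 = - 1] (mod int p ^ K)" unfolding cong_iff_dvd_diff .
  qed
  finally show ?thesis by simp
qed

lemma cong_prod_plus:
  assumes "K \<le> f * a + g"
  shows "[int (prod_plus (p ^ f) (p ^ g) a b) = 1] (mod int p ^ K)"
proof -
  have "int (prod_plus (p ^ f) (p ^ g) a b) = (\<Prod>c\<in>{a..<b}. int p ^ (f * c + g) + 1)"
    unfolding prod_plus_def power_q of_nat_prod
    by (intro prod.cong refl) (simp add: power_add mult.commute)
  also have "[(\<Prod>c\<in>{a..<b}. int p ^ (f * c + g) + 1) = (\<Prod>c\<in>{a..<b}. 1)] (mod int p ^ K)"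
  proof (intro cong_prod)
    fix c assume "c \<in> {a..<b}"
    hence "f * a \<le> f * c" by (intro mult_le_mono2) auto
    hence "K \<le> f * c + g" using assms(1) by linarith
    hence "int p ^ K dvd int p ^ (f * c + g)" by (rule le_imp_power_dvd)
    hence "int p ^ K dvd (int p ^ (f * c + g) + 1) - 1" by simp
    thus "[int p ^ (f * c + g) + 1 = 1] (mod int p ^ K)" unfolding cong_iff_dvd_diff .
  qed
  finally show ?thesis by simp
qed

text \<open>
  A prime \<open>r\<close> of order \<open>N\<close> divides \<open>p^x - 1\<close> with \<open>0 < x \<le> N\<close> only if \<open>x = N\<close>, so at most the last
  factor counts.
\<close>

lemma multiplicity_prod_minus:
  assumes r: "prime r" and ord: "ord r p = N" and ab: "a < b" and N: "f * b \<le> N"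
  shows "multiplicity r (prod_minus (p ^ f) a b) = (if f * b = N then multiplicity r (p ^ N - 1) else 0)"
proof -
  have pos: "(p ^ f) ^ c - 1 \<noteq> 0" if "c \<in> {a<..b}" for c
    using one_less_power[of "p ^ f" c] power_f_ge_2 that by auto
  have "multiplicity r (prod_minus (p ^ f) a b) = (\<Sum>c\<in>{a<..b}. multiplicity r ((p ^ f) ^ c - 1))"
    unfolding prod_minus_def using pos by (intro multiplicity_prod_nonzero r) auto
  also have "\<dots> = (\<Sum>c\<in>{a<..b}. if c = b then (if f * b = N then multiplicity r (p ^ N - 1) else 0) else 0)"
  proof (intro sum.cong refl)
    fix c assume c: "c \<in> {a<..b}"
    have cb: "c = b" if "f * c = N"
    proof -
      have "f * b \<le> f * c" using that N by simp
      thus ?thesis using f c by simp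
    qed
    have nd: "\<not> r dvd p ^ (f * c) - 1" if "f * c \<noteq> N"
    proof
      assume "r dvd p ^ (f * c) - 1"
      hence "N dvd f * c" using order_divides_iff[of p r "f * c"] ord p_ge_2 by simp
      moreover have "f * c > 0" using f c by auto
      ultimately have "N \<le> f * c" by (rule dvd_imp_le)
      moreover have "f * c \<le> f * b" using c by simp
      ultimately show False using that N by linarith
    qed
    show "multiplicity r ((p ^ f) ^ c - 1) =
        (if c = b then (if f * b = N then multiplicity r (p ^ N - 1) else 0) else 0)"
    proof (cases "f * c = N")
      case True
      thus ?thesis unfolding power_q using cb[OF True] by simp
    next
      case False
      show ?thesis unfolding power_q not_dvd_imp_multiplicity_0[OF nd[OF False]] using False by auto
    qed
  qed
  also have "\<dots> = (if f * b = N then multiplicity r (p ^ N - 1) else 0)"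
    using ab by (simp add: sum.delta)
  finally show ?thesis .
qed

text \<open>
  From \<open>p^(2 y) - 1 = (p^y - 1) (p^y + 1)\<close>: the exponent that matters for \<open>p^y + 1\<close> is \<open>2 y\<close>.
\<close>

lemma multiplicity_power_plus_one:
  assumes r: "prime r" "r \<noteq> 2" and ord: "ord r p = N" and y: "2 * y \<le> N"
  shows "multiplicity r (p ^ y + 1) = (if 2 * y = N \<and> y > 0 then multiplicity r (p ^ N - 1) else 0)"
proof (cases "y = 0")
  case True
  have "\<not> r dvd 2" using r by (metis primes_dvd_imp_eq two_is_prime_nat)
  hence "multiplicity r 2 = 0" by (rule not_dvd_imp_multiplicity_0)
  thus ?thesis using True by (simp add: numeral_2_eq_2)
next
  case False
  have fact: "p ^ (2 * y) - 1 = (p ^ y - 1) * (p ^ y + 1)"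
    unfolding mult_2 power_add by (simp add: algebra_simps diff_mult_distrib)
  show ?thesis
  proof (cases "2 * y = N")
    case True
    have "\<not> r dvd p ^ y - 1"
      using order_divides_iff[of p r y] ord p_ge_2 True False dvd_imp_le[of N y] by auto
    moreover have "p ^ y - 1 \<noteq> 0" using one_less_power[of p y] p_ge_2 False by simp
    ultimately show ?thesis
      using prime_elem_multiplicity_mult_distrib[of r "p ^ y - 1" "p ^ y + 1"] True False r(1) fact
      by (simp add: not_dvd_imp_multiplicity_0)
  next
    case neq: False
    have "\<not> r dvd p ^ y + 1"
    proof
      assume "r dvd p ^ y + 1"
      hence "r dvd p ^ (2 * y) - 1" unfolding fact by (rule dvd_mult)
      hence "N dvd 2 * y" using order_divides_iff[of p r "2 * y"] ord p_ge_2 by simp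
      thus False using dvd_imp_le[of N "2 * y"] False y neq by simp
    qed
    thus ?thesis using neq by (simp add: not_dvd_imp_multiplicity_0)
  qed
qed

lemma multiplicity_prod_plus:
  assumes r: "prime r" "r \<noteq> 2" and ord: "ord r p = N" and N: "N > 0" and ab: "a \<le> x"
    and le: "2 * (f * x + g) \<le> N"
  shows "multiplicity r (prod_plus (p ^ f) (p ^ g) a (Suc x)) =
    (if 2 * (f * x + g) = N then multiplicity r (p ^ N - 1) else 0)"
proof -
  have "multiplicity r (prod_plus (p ^ f) (p ^ g) a (Suc x)) =
      (\<Sum>c\<in>{a..<Suc x}. multiplicity r (p ^ g * (p ^ f) ^ c + 1))"
    unfolding prod_plus_def by (intro multiplicity_prod_nonzero r) auto
  also have "\<dots> = (\<Sum>c\<in>{a..<Suc x}. if c = x then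
      (if 2 * (f * x + g) = N then multiplicity r (p ^ N - 1) else 0) else 0)"
  proof (intro sum.cong refl)
    fix c assume c: "c \<in> {a..<Suc x}"
    have "f * c \<le> f * x" using c by (intro mult_le_mono2) auto
    hence "2 * (f * c + g) \<le> 2 * (f * x + g)" by simp
    hence le': "2 * (f * c + g) \<le> N" using le by (rule order_trans)
    have eq: "p ^ g * (p ^ f) ^ c + 1 = p ^ (f * c + g) + 1"
      unfolding power_q by (simp add: power_add mult.commute)
    have "2 * (f * c + g) \<noteq> N" if "c \<noteq> x"
    proof -
      have "f * c < f * x" using c that f by auto
      hence "2 * (f * c + g) < 2 * (f * x + g)" by simp
      hence "2 * (f * c + g) < N" using le by (rule less_le_trans)
      thus ?thesis by simp
    qed
    thus "multiplicity r (p ^ g * (p ^ f) ^ c + 1) = (if c = x then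
      (if 2 * (f * x + g) = N then multiplicity r (p ^ N - 1) else 0) else 0)"
      unfolding eq multiplicity_power_plus_one[OF r ord le'] using N by auto
  qed
  also have "\<dots> = (if 2 * (f * x + g) = N then multiplicity r (p ^ N - 1) else 0)"
    using ab by (subst sum.delta) auto
  finally show ?thesis .
qed

text \<open>
  The analogue of \<open>multiplicity_prod_minus\<close> for a prime whose order belongs to the last factor but
  one; the proper multiples of \<open>k - 1\<close> exceed \<open>k\<close>.
\<close>

lemma multiplicity_prod_minus_below:
  assumes r: "prime r" and ord: "ord r p = f * (k - 1)" and k: "k \<ge> 3" and bk: "b \<le> k"
  shows "multiplicity r (prod_minus (p ^ f) a b) =
    (if a < k - 1 \<and> k - 1 \<le> b then multiplicity r (p ^ (f * (k - 1)) - 1) else 0)"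
proof -
  have pos: "(p ^ f) ^ c - 1 \<noteq> 0" if "c \<in> {a<..b}" for c
    using one_less_power[of "p ^ f" c] power_f_ge_2 that by auto
  have "multiplicity r (prod_minus (p ^ f) a b) = (\<Sum>c\<in>{a<..b}. multiplicity r ((p ^ f) ^ c - 1))"
    unfolding prod_minus_def using pos by (intro multiplicity_prod_nonzero r) auto
  also have "\<dots> = (\<Sum>c\<in>{a<..b}. if c = k - 1 then multiplicity r (p ^ (f * (k - 1)) - 1) else 0)"
  proof (intro sum.cong refl)
    fix c assume c: "c \<in> {a<..b}"
    have "\<not> r dvd p ^ (f * c) - 1" if "c \<noteq> k - 1"
    proof
      assume "r dvd p ^ (f * c) - 1"
      hence "f * (k - 1) dvd f * c" using order_divides_iff[of p r "f * c"] ord p_ge_2 by simp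
      hence "k - 1 dvd c" using f by simp
      then obtain e where e: "c = (k - 1) * e" by (auto elim: dvdE)
      have "e \<noteq> 0" using e c by (metis greaterThanAtMost_iff mult_0_right not_less0)
      moreover have "e \<noteq> 1" using e that by auto
      ultimately have "e \<ge> 2" by linarith
      hence "(k - 1) * 2 \<le> c" unfolding e by (intro mult_le_mono2) auto
      thus False using c bk k by auto
    qed
    thus "multiplicity r ((p ^ f) ^ c - 1) =
        (if c = k - 1 then multiplicity r (p ^ (f * (k - 1)) - 1) else 0)"
      unfolding power_q by (simp add: not_dvd_imp_multiplicity_0)
  qed
  also have "\<dots> = (if a < k - 1 \<and> k - 1 \<le> b then multiplicity r (p ^ (f * (k - 1)) - 1) else 0)"
    by (simp add: sum.delta)
  finally show ?thesis .
qed

text \<open>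
  If the exponents \<open>2 (f c + g)\<close> end at \<open>f k\<close>, they skip \<open>f (k - 1)\<close>, since they proceed in steps
  of \<open>2 f\<close>.
\<close>

lemma multiplicity_prod_plus_below:
  assumes r: "prime r" "r \<noteq> 2" and ord: "ord r p = f * (k - 1)" and k: "k \<ge> 3"
    and top: "2 * (f * x + g) = f * k"
  shows "multiplicity r (prod_plus (p ^ f) (p ^ g) a (Suc x)) = 0"
proof -
  have "multiplicity r (prod_plus (p ^ f) (p ^ g) a (Suc x)) =
      (\<Sum>c\<in>{a..<Suc x}. multiplicity r (p ^ g * (p ^ f) ^ c + 1))"
    unfolding prod_plus_def by (intro multiplicity_prod_nonzero r) auto
  also have "\<dots> = 0"
  proof (intro sum.neutral ballI)
    fix c assume c: "c \<in> {a..<Suc x}"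
    have eq: "p ^ g * (p ^ f) ^ c + 1 = p ^ (f * c + g) + 1"
      unfolding power_q by (simp add: power_add mult.commute)
    have "\<not> r dvd p ^ (f * c + g) + 1"
    proof
      assume dvd: "r dvd p ^ (f * c + g) + 1"
      have "p ^ (2 * (f * c + g)) - 1 = (p ^ (f * c + g) - 1) * (p ^ (f * c + g) + 1)"
        unfolding mult_2 power_add by (simp add: algebra_simps diff_mult_distrib)
      hence "r dvd p ^ (2 * (f * c + g)) - 1" using dvd by (metis dvd_mult)
      hence "f * (k - 1) dvd 2 * (f * c + g)"
        using order_divides_iff[of p r "2 * (f * c + g)"] ord p_ge_2 by simp
      then obtain e where e: "2 * (f * c + g) = f * (k - 1) * e" by (auto elim: dvdE)
      have "e \<noteq> 0"
      proof
        assume "e = 0"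
        hence z: "f * c + g = 0" using e by simp
        have "r dvd 2" using dvd unfolding z by (simp add: numeral_2_eq_2)
        thus False using r by (metis primes_dvd_imp_eq two_is_prime_nat)
      qed
      have cx: "f * c \<le> f * x" using c by simp
      have "e < 2"
      proof (rule ccontr)
        assume "\<not> e < 2"
        hence "f * (k - 1) * 2 \<le> f * (k - 1) * e" by (intro mult_le_mono2) auto
        also have "\<dots> = 2 * (f * c + g)" by (simp only: e)
        also have "\<dots> \<le> 2 * (f * x + g)" using cx by simp
        also have "\<dots> = f * k" by (rule top)
        finally have "f * (k - 1) * 2 \<le> f * k" .
        hence "f * ((k - 1) * 2) \<le> f * k" by (simp add: mult.assoc)
        thus False using f k by auto
      qed
      hence "2 * (f * c + g) = f * (k - 1)" using e \<open>e \<noteq> 0\<close> by (cases e) auto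
      moreover have "f * k = f * (k - 1) + f" using k by (simp add: diff_mult_distrib2)
      ultimately have "2 * (f * x) = 2 * (f * c) + f * 1" using top by simp
      hence "f * (2 * x) = f * (2 * c + 1)" by (simp add: algebra_simps)
      hence "2 * x = 2 * c + 1" using f by (metis mult_cancel1 not_one_le_zero)
      thus False by presburger
    qed
    thus "multiplicity r (p ^ g * (p ^ f) ^ c + 1) = 0"
      unfolding eq by (rule not_dvd_imp_multiplicity_0)
  qed
  finally show ?thesis .
qed

lemma dvd_times_sign: "d dvd x * (-1) ^ n \<Longrightarrow> d dvd (x :: int)"
  by (cases "even n") simp_all

text \<open>
  Modulo a power of \<open>p\<close> slightly larger than the smallest exponent, all factors reduce to signs
  except \<open>s q^a + 1\<close> and \<open>q^(a+1) - 1\<close>. For \<open>g \<noteq> f\<close> the one of them with the smaller exponent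
  leaves a term that nothing cancels. For \<open>g = f\<close> the two exponents agree, but then the factors
  combine to \<open>(q^2)^c - 1\<close> and the argument applies with \<open>q^2\<close> in place of \<open>q\<close>.
\<close>

lemma low_order_terms_differ:
  fixes a k' i l \<mu> \<nu> \<kappa> :: nat
  assumes \<kappa>: "\<kappa> = \<mu> + \<nu>" "\<mu> \<ge> 1" "\<nu> \<ge> 1"
    and i: "i \<ge> k'" and l: "l \<ge> k'"
    and top: "2 * (f * a) + 2 * g + f * \<kappa> \<le> f * k' + 2 * f"
    and pos: "f * a + g > 0"
    and ident: "prod_plus (p^f) (p^g) a (a+\<kappa>) * prod_minus (p^f) i (i+\<mu>) *
      prod_minus (p^f) l (l+\<nu>) * prod_minus (p^f) a (a+\<kappa>) = (prod_minus (p^f) k' (k'+\<kappa>))^2"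
  shows False
proof -
  have "f * 2 \<le> f * \<kappa>" using \<kappa> by (intro mult_le_mono2) simp
  hence top': "2 * (f * a) + 2 * g \<le> f * k'" using top by linarith
  have fk: "f * Suc k' = f * k' + f" "f * Suc a = f * a + f" "f * Suc (Suc a) = f * a + f + f" by simp_all
  have fi: "f * Suc k' \<le> f * Suc i" "f * Suc k' \<le> f * Suc l" using i l by simp_all
  have IL: "[int (prod_minus (p^f) i (i+\<mu>)) * int (prod_minus (p^f) l (l+\<nu>)) = (-1)^\<kappa>] (mod int p ^ K)"
    and F: "[(int (prod_minus (p^f) k' (k'+\<kappa>)))^2 = 1] (mod int p ^ K)" if K: "K \<le> f * Suc k'" for K
  proof -
    have "[int (prod_minus (p^f) i (i+\<mu>)) * int (prod_minus (p^f) l (l+\<nu>)) =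
        (-1)^(i + \<mu> - i) * (-1)^(l + \<nu> - l)] (mod int p ^ K)"
      using order_trans[OF K fi(1)] order_trans[OF K fi(2)] by (intro cong_mult cong_prod_minus) simp_all
    thus "[int (prod_minus (p^f) i (i+\<mu>)) * int (prod_minus (p^f) l (l+\<nu>)) = (-1)^\<kappa>] (mod int p ^ K)"
      by (simp add: \<kappa> power_add)
    have "[(int (prod_minus (p^f) k' (k'+\<kappa>)))^2 = ((-1)^(k'+\<kappa>-k'))^2] (mod int p ^ K)"
      using K by (intro cong_pow cong_prod_minus) auto
    thus "[(int (prod_minus (p^f) k' (k'+\<kappa>)))^2 = 1] (mod int p ^ K)"
      by (simp flip: power_mult)
  qed
  let ?C = "int (prod_minus (p^f) a (a+\<kappa>))" and ?E = "int (prod_plus (p^f) (p^g) a (a+\<kappa>))"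
  have ident': "?E * ?C * (int (prod_minus (p^f) i (i+\<mu>)) * int (prod_minus (p^f) l (l+\<nu>))) =
      (int (prod_minus (p^f) k' (k'+\<kappa>)))^2"
    using arg_cong[OF ident, of int] by (simp add: mult_ac)
  have CE: "[?E * ?C = (-1)^\<kappa>] (mod int p ^ K)" if "K \<le> f * Suc k'" for K
  proof -
    have "[?E * ?C * (-1)^\<kappa> = 1] (mod int p ^ K)"
      using cong_trans[OF cong_scalar_left[OF IL[OF that], of "?E * ?C", THEN cong_sym]] F[OF that]
      unfolding ident' by blast
    hence "[?E * ?C * (-1)^\<kappa> * (-1)^\<kappa> = 1 * (-1)^\<kappa>] (mod int p ^ K)"
      by (rule cong_scalar_right)
    thus ?thesis by (simp add: mult.assoc flip: power_add)
  qed
  have not_dvd: "\<not> int p ^ Suc M dvd int p ^ M" for M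
  proof
    assume "int p ^ Suc M dvd int p ^ M"
    hence "int p ^ Suc M \<le> int p ^ M" using p_ge_2 by (intro zdvd_imp_le) auto
    thus False using p_ge_2 by simp
  qed
  have "\<kappa> \<ge> 2" using \<kappa> by simp
  then obtain \<kappa>' where \<kappa>': "\<kappa> = Suc \<kappa>'" by (cases \<kappa>) auto
  have Cfirst: "?C = (int p ^ (f * Suc a) - 1) * int (prod_minus (p^f) (Suc a) (a+\<kappa>))"
    using prod_minus_first[of a "a+\<kappa>" "p^f"] \<kappa>' p_ge_2
    by (simp add: of_nat_diff power_q del: mult_Suc_right power_Suc)
  have lt: "a < a + \<kappa>" using \<kappa>' by simp
  have Efirst: "?E = (int p ^ (f * a + g) + 1) * int (prod_plus (p^f) (p^g) (Suc a) (a+\<kappa>))"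
    unfolding prod_plus_first[OF lt] power_q by (simp add: power_add algebra_simps)
  have sgn: "(-1::int) ^ \<kappa> = - ((-1) ^ \<kappa>')" by (simp add: \<kappa>')
  consider "g < f" | "g > f" | "g = f" by linarith
  thus False
  proof cases
    case 1
    let ?K = "Suc (f * a + g)"
    have s1: "[?E * ?C = (int p ^ (f * a + g) + 1) * 1 * (-1)^(a + \<kappa> - a)] (mod int p ^ ?K)"
      unfolding Efirst using 1 fk
      by (intro cong_mult cong_refl cong_prod_plus cong_prod_minus) auto
    have s2: "[?E * ?C = (-1)^\<kappa>] (mod int p ^ ?K)"
    proof (rule CE)
      have "Suc (u + g) \<le> f + w" if "2 * u + 2 * g \<le> w" "u + g > 0" for u w using that by linarith
      from this[OF top' pos] show "?K \<le> f * Suc k'" by (simp only: mult_Suc_right)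
    qed
    have "[(int p ^ (f * a + g) + 1) * (-1)^\<kappa> = (-1)^\<kappa>] (mod int p ^ ?K)"
      using cong_trans[OF cong_sym[OF s1] s2] by (simp del: power_Suc)
    hence "int p ^ ?K dvd (int p ^ (f * a + g) + 1) * (-1)^\<kappa> - (-1)^\<kappa>"
      unfolding cong_iff_dvd_diff .
    hence "int p ^ ?K dvd int p ^ (f * a + g) * (-1)^\<kappa>" by (simp add: algebra_simps)
    hence "int p ^ ?K dvd int p ^ (f * a + g)"
      by (rule dvd_times_sign)
    thus False using not_dvd by blast
  next
    case 2
    let ?K = "Suc (f * Suc a)"
    have s1: "[?E * ?C = 1 * ((int p ^ (f * Suc a) - 1) * (-1)^(a + \<kappa> - Suc a))] (mod int p ^ ?K)"
      unfolding Cfirst using 2 fk f \<kappa>'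
      by (intro cong_mult cong_refl cong_prod_plus cong_prod_minus) auto
    have s2: "[?E * ?C = (-1)^\<kappa>] (mod int p ^ ?K)"
    proof (rule CE)
      have "Suc (f + u) \<le> f + w" if "2 * u + 2 * g \<le> w" for u w using that 2 by linarith
      from this[OF top'] show "?K \<le> f * Suc k'" by (simp only: mult_Suc_right)
    qed
    have "a + \<kappa> - Suc a = \<kappa>'" using \<kappa>' by simp
    hence "[(int p ^ (f * Suc a) - 1) * (-1)^\<kappa>' = (-1)^\<kappa>] (mod int p ^ ?K)"
      using cong_trans[OF cong_sym[OF s1] s2] by (simp only: mult_1)
    hence "int p ^ ?K dvd (int p ^ (f * Suc a) - 1) * (-1)^\<kappa>' - (-1)^\<kappa>"
      unfolding cong_iff_dvd_diff .
    hence "int p ^ ?K dvd int p ^ (f * Suc a) * (-1)^\<kappa>'" unfolding sgn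
      by (simp add: algebra_simps del: power_Suc mult_Suc_right)
    hence "int p ^ ?K dvd int p ^ (f * Suc a)"
      by (rule dvd_times_sign)
    thus False using not_dvd by blast
  next
    case 3
    let ?M = "2 * (f * Suc a)" and ?K = "Suc (2 * (f * Suc a))"
    have CE_eq: "int (prod_minus (p^f) u v) * int (prod_plus (p^f) (p^g) u v) =
        int (prod_minus (p^(2 * f)) u v)" for u v
    proof -
      have "prod_plus (p^f) (p^g) u v = (\<Prod>c\<in>{u<..v}. (p^f)^c + 1)"
        unfolding prod_plus_def 3
        by (rule prod.reindex_bij_witness[where i = "\<lambda>c. c - 1" and j = Suc]) auto
      hence "prod_minus (p^f) u v * prod_plus (p^f) (p^g) u v =
          (\<Prod>c\<in>{u<..v}. ((p^f)^c - 1) * ((p^f)^c + 1))"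
        by (simp only: prod_minus_def prod.distrib)
      also have "\<dots> = prod_minus (p^(2 * f)) u v"
        unfolding prod_minus_def
      proof (intro prod.cong refl)
        fix c
        have "(p ^ (2 * f)) ^ c = (p ^ f) ^ c * (p ^ f) ^ c"
          by (simp add: mult_2 power_add power_mult_distrib)
        thus "((p ^ f) ^ c - 1) * ((p ^ f) ^ c + 1) = (p ^ (2 * f)) ^ c - 1"
          by (simp add: algebra_simps diff_mult_distrib)
      qed
      finally show ?thesis by (simp flip: of_nat_mult)
    qed
    have E1: "?E * ?C = (int p ^ ?M - 1) * int (prod_minus (p^(2 * f)) (Suc a) (a+\<kappa>))"
    proof -
      have "?E * ?C = int (prod_minus (p^(2 * f)) a (a+\<kappa>))" using CE_eq by (simp add: mult.commute)
      also have "\<dots> = int ((p^(2 * f)) ^ Suc a - 1) * int (prod_minus (p^(2 * f)) (Suc a) (a+\<kappa>))"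
        using prod_minus_first[of a "a+\<kappa>" "p^(2 * f)"] \<kappa>' by simp
      also have "int ((p^(2 * f)) ^ Suc a - 1) = int p ^ ?M - 1"
      proof -
        have "(p^(2 * f)) ^ Suc a = p ^ ?M" by (simp only: power_mult[symmetric] mult.assoc)
        moreover have "p ^ ?M \<ge> 1" using p_ge_2 by simp
        ultimately show ?thesis by (simp add: of_nat_diff)
      qed
      finally show ?thesis .
    qed
    have "[int (prod_minus (p^(2 * f)) (Suc a) (a+\<kappa>)) = (-1)^\<kappa>'] (mod int p ^ ?K)"
    proof -
      have "int (prod_minus (p^(2 * f)) (Suc a) (a+\<kappa>)) = (\<Prod>c\<in>{Suc a<..a+\<kappa>}. int p ^ (2 * f * c) - 1)"
        unfolding prod_minus_def of_nat_prod using p_ge_2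
        by (intro prod.cong refl) (simp add: of_nat_diff power_mult)
      also have "[(\<Prod>c\<in>{Suc a<..a+\<kappa>}. int p ^ (2 * f * c) - 1) = (\<Prod>c\<in>{Suc a<..a+\<kappa>}. - 1)] (mod int p ^ ?K)"
      proof (intro cong_prod)
        fix c assume "c \<in> {Suc a<..a+\<kappa>}"
        hence "f * Suc (Suc a) \<le> f * c" by (intro mult_le_mono2) auto
        hence "?K \<le> 2 * f * c" using f fk by simp
        hence "int p ^ ?K dvd int p ^ (2 * f * c)" by (rule le_imp_power_dvd)
        hence "int p ^ ?K dvd (int p ^ (2 * f * c) - 1) - (- 1)" by simp
        thus "[int p ^ (2 * f * c) - 1 = - 1] (mod int p ^ ?K)" unfolding cong_iff_dvd_diff .
      qed
      finally show ?thesis by (simp add: \<kappa>')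
    qed
    hence s1: "[?E * ?C = (int p ^ ?M - 1) * (-1)^\<kappa>'] (mod int p ^ ?K)"
      unfolding E1 by (rule cong_scalar_left)
    have s2: "[?E * ?C = (-1)^\<kappa>] (mod int p ^ ?K)"
    proof (rule CE)
      have "Suc (2 * (f + u)) \<le> f + w" if "2 * u + 2 * g \<le> w" for u w
        using that f unfolding 3 by simp
      from this[OF top'] show "?K \<le> f * Suc k'" by (simp only: mult_Suc_right)
    qed
    have "[(int p ^ ?M - 1) * (-1)^\<kappa>' = (-1)^\<kappa>] (mod int p ^ ?K)"
      by (rule cong_trans[OF cong_sym[OF s1] s2])
    hence "int p ^ ?K dvd (int p ^ ?M - 1) * (-1)^\<kappa>' - (-1)^\<kappa>"
      unfolding cong_iff_dvd_diff .
    hence "int p ^ ?K dvd int p ^ ?M * (-1)^\<kappa>'" unfolding sgn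
      by (simp add: algebra_simps del: power_Suc mult_Suc_right)
    hence "int p ^ ?K dvd int p ^ ?M"
      by (rule dvd_times_sign)
    thus False using not_dvd by blast
  qed
qed

section \<open>Identities between products of consecutive terms\<close>

text \<open>
  The multiplicity of a primitive prime for the largest exponent that occurs, on both sides. The
  right-hand side is a square up to the factor \<open>1 + \<epsilon> \<le> 2\<close>, so its interval must reach this
  exponent, and exactly two of the four products on the left do. The hypothesis \<open>generic\<close> excludes
  Zsigmondy's exception.
\<close>

lemma top_order_balance:
  fixes a k' i l \<mu> \<nu> \<kappa> x \<epsilon> :: nat
  assumes \<kappa>: "\<kappa> \<ge> 1" "\<mu> \<ge> 1" "\<nu> \<ge> 1" and x: "Suc x = a + \<kappa>"
    and k3: "k' + \<kappa> \<ge> 3" and eps: "\<epsilon> \<le> 1"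
    and ident: "prod_plus (p^f) (p^g) a (a+\<kappa>) * prod_minus (p^f) i (i+\<mu>) *
      prod_minus (p^f) l (l+\<nu>) * prod_minus (p^f) a (a+\<kappa>) =
      (1 + \<epsilon>) * (prod_minus (p^f) k' (k'+\<kappa>))^2"
    and generic: "\<not> (p = 2 \<and> f * (i+\<mu>) \<le> 6 \<and> f * (l+\<nu>) \<le> 6 \<and> f * (a+\<kappa>) \<le> 6 \<and>
      2 * (f * x + g) \<le> 6 \<and> f * (k'+\<kappa>) \<le> 6)"
  shows "i + \<mu> \<le> k' + \<kappa> \<and> l + \<nu> \<le> k' + \<kappa> \<and> a + \<kappa> \<le> k' + \<kappa> \<and> 2 * (f * x + g) \<le> f * (k' + \<kappa>) \<and>
    of_bool (i + \<mu> = k' + \<kappa>) + of_bool (l + \<nu> = k' + \<kappa>) + of_bool (a + \<kappa> = k' + \<kappa>) +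
    of_bool (2 * (f * x + g) = f * (k' + \<kappa>)) = (2 :: nat)"
proof -
  define M where "M = Max {f * (i+\<mu>), f * (l+\<nu>), f * (a+\<kappa>), 2 * (f * x + g), f * (k'+\<kappa>)}"
  have le: "f * (i+\<mu>) \<le> M" "f * (l+\<nu>) \<le> M" "f * (a+\<kappa>) \<le> M" "2 * (f * x + g) \<le> M" "f * (k'+\<kappa>) \<le> M"
    unfolding M_def by (intro Max_ge; simp)+
  have "M \<in> {f * (i+\<mu>), f * (l+\<nu>), f * (a+\<kappa>), 2 * (f * x + g), f * (k'+\<kappa>)}"
    unfolding M_def by (intro Max_in) auto
  hence attained: "M = f * (i+\<mu>) \<or> M = f * (l+\<nu>) \<or> M = f * (a+\<kappa>) \<or> M = 2 * (f * x + g) \<or> M = f * (k'+\<kappa>)"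
    by simp
  have "1 * 3 \<le> f * (k' + \<kappa>)" using f k3 by (intro mult_le_mono) auto
  hence M3: "M \<ge> 3" using le by simp
  have exc: "\<not> (p = 2 \<and> M = 6)" using generic le by blast
  obtain r where r: "prime r" "ord r p = M"
    using primitive_prime_exists[OF p_ge_2 M3 exc] by blast
  have r2: "r \<noteq> 2"
  proof
    assume "r = 2"
    have "coprime r p" using r(2) M3 by (metis ord_eq_0 not_numeral_le_zero)
    hence "M dvd totient r" using order_divides_totient r(2) by metis
    thus False using \<open>r = 2\<close> M3 by simp
  qed
  define c where "c = multiplicity r (p ^ M - 1)"
  have "r dvd p ^ M - 1" using order_divides_iff[of p r M] r p_ge_2 by simp
  moreover have "p ^ M - 1 \<noteq> 0" using one_less_power[of p M] p_ge_2 M3 by simp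
  ultimately have c0: "c > 0" unfolding c_def using r(1) by (simp add: prime_multiplicity_gt_zero_iff)
  have nz: "prod_minus (p^f) u v \<noteq> 0" "prod_plus (p^f) (p^g) u v \<noteq> 0" for u v
    using prod_minus_pos[OF power_f_ge_2, of u v] prod_plus_pos[of "p^f" "p^g" u v] by auto
  note pm = multiplicity_prod_minus[OF r, folded c_def]
  have mI: "multiplicity r (prod_minus (p^f) i (i+\<mu>)) = (if f * (i+\<mu>) = M then c else 0)"
    using \<kappa> le by (intro pm) auto
  have mL: "multiplicity r (prod_minus (p^f) l (l+\<nu>)) = (if f * (l+\<nu>) = M then c else 0)"
    using \<kappa> le by (intro pm) auto
  have mC: "multiplicity r (prod_minus (p^f) a (a+\<kappa>)) = (if f * (a+\<kappa>) = M then c else 0)"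
    using \<kappa> le by (intro pm) auto
  have mF: "multiplicity r (prod_minus (p^f) k' (k'+\<kappa>)) = (if f * (k'+\<kappa>) = M then c else 0)"
    using \<kappa> le by (intro pm) auto
  have mE: "multiplicity r (prod_plus (p^f) (p^g) a (a+\<kappa>)) = (if 2 * (f * x + g) = M then c else 0)"
    unfolding x[symmetric] c_def
    using \<kappa> le x M3 by (intro multiplicity_prod_plus[OF r(1) r2 r(2)]) auto
  have "\<not> r dvd 1 + \<epsilon>"
  proof
    assume "r dvd 1 + \<epsilon>"
    hence "r \<le> 1 + \<epsilon>" by (rule dvd_imp_le) simp
    thus False using eps r2 prime_ge_2_nat[OF r(1)] by simp
  qed
  hence mW: "multiplicity r (1 + \<epsilon>) = 0" by (rule not_dvd_imp_multiplicity_0)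
  note md = prime_elem_multiplicity_mult_distrib[OF prime_imp_prime_elem[OF r(1)]]
  have "multiplicity r (prod_plus (p^f) (p^g) a (a+\<kappa>) * prod_minus (p^f) i (i+\<mu>) *
      prod_minus (p^f) l (l+\<nu>) * prod_minus (p^f) a (a+\<kappa>)) =
      (if 2 * (f * x + g) = M then c else 0) + (if f * (i+\<mu>) = M then c else 0) +
      (if f * (l+\<nu>) = M then c else 0) + (if f * (a+\<kappa>) = M then c else 0)"
    by (simp only: md nz mult_eq_0_iff mI mL mC mE simp_thms)
  moreover have "multiplicity r ((1 + \<epsilon>) * (prod_minus (p^f) k' (k'+\<kappa>))^2) =
      2 * (if f * (k'+\<kappa>) = M then c else 0)"
    using nz by (simp only: md mW prime_elem_multiplicity_power_distrib[OF prime_imp_prime_elem[OF r(1)]]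
        mF power_eq_0_iff simp_thms)
  ultimately have "(if 2 * (f * x + g) = M then c else 0) + (if f * (i+\<mu>) = M then c else 0) +
      (if f * (l+\<nu>) = M then c else 0) + (if f * (a+\<kappa>) = M then c else 0) =
      2 * (if f * (k'+\<kappa>) = M then c else 0)"
    using ident by simp
  hence "c * (of_bool (i + \<mu> = k' + \<kappa>) + of_bool (l + \<nu> = k' + \<kappa>) + of_bool (a + \<kappa> = k' + \<kappa>) +
    of_bool (2 * (f * x + g) = f * (k' + \<kappa>))) = c * 2 \<and> f * (k' + \<kappa>) = M"
  proof (cases "f * (k' + \<kappa>) = M")
    case True
    have eq: "f * y = M \<longleftrightarrow> y = k' + \<kappa>" for y unfolding True[symmetric] using f by simp
    have "(if P then c else 0) = c * of_bool P" for P by simp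
    moreover assume "(if 2 * (f * x + g) = M then c else 0) + (if f * (i+\<mu>) = M then c else 0) +
      (if f * (l+\<nu>) = M then c else 0) + (if f * (a+\<kappa>) = M then c else 0) =
      2 * (if f * (k'+\<kappa>) = M then c else 0)"
    ultimately have "c * of_bool (2 * (f * x + g) = M) + c * of_bool (i+\<mu> = k' + \<kappa>) +
      c * of_bool (l+\<nu> = k' + \<kappa>) + c * of_bool (a+\<kappa> = k' + \<kappa>) = 2 * c"
      unfolding eq by simp
    thus ?thesis unfolding True[symmetric] by (simp only: distrib_left simp_thms ac_simps)
  next
    case False
    assume "(if 2 * (f * x + g) = M then c else 0) + (if f * (i+\<mu>) = M then c else 0) +
      (if f * (l+\<nu>) = M then c else 0) + (if f * (a+\<kappa>) = M then c else 0) =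
      2 * (if f * (k'+\<kappa>) = M then c else 0)"
    thus ?thesis using False attained c0 by (auto split: if_splits)
  qed
  hence "of_bool (i + \<mu> = k' + \<kappa>) + of_bool (l + \<nu> = k' + \<kappa>) + of_bool (a + \<kappa> = k' + \<kappa>) +
    of_bool (2 * (f * x + g) = f * (k' + \<kappa>)) = (2 :: nat)" and M: "f * (k' + \<kappa>) = M"
    using c0 by (metis mult_cancel1 less_irrefl, blast)
  moreover have "y \<le> k' + \<kappa>" if "f * y \<le> M" for y using that f unfolding M[symmetric] by simp
  ultimately show ?thesis using le M by blast
qed

text \<open>
  If the product of the \<open>s q^c + 1\<close> is among the two that reach the top, it contributes nothing to
  the next smaller exponent, and the balance there involves only the other three.
\<close>

lemma second_order_balance:
  fixes a k' i l \<mu> \<nu> \<kappa> x \<epsilon> :: nat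
  assumes \<kappa>: "\<kappa> \<ge> 2" and x: "Suc x = a + \<kappa>"
    and k3: "k' + \<kappa> \<ge> 3" and eps: "\<epsilon> \<le> 1"
    and ident: "prod_plus (p^f) (p^g) a (a+\<kappa>) * prod_minus (p^f) i (i+\<mu>) *
      prod_minus (p^f) l (l+\<nu>) * prod_minus (p^f) a (a+\<kappa>) =
      (1 + \<epsilon>) * (prod_minus (p^f) k' (k'+\<kappa>))^2"
    and generic: "\<not> (p = 2 \<and> f * (k' + \<kappa> - 1) = 6)" "f * (k' + \<kappa> - 1) \<ge> 3"
    and le: "i + \<mu> \<le> k' + \<kappa>" "l + \<nu> \<le> k' + \<kappa>" "a + \<kappa> \<le> k' + \<kappa>"
    and top: "2 * (f * x + g) = f * (k' + \<kappa>)"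
  shows "of_bool (i < k' + \<kappa> - 1 \<and> k' + \<kappa> - 1 \<le> i + \<mu>) + of_bool (l < k' + \<kappa> - 1 \<and> k' + \<kappa> - 1 \<le> l + \<nu>) +
    of_bool (a < k' + \<kappa> - 1 \<and> k' + \<kappa> - 1 \<le> a + \<kappa>) = (2 :: nat)"
proof -
  define M where "M = f * (k' + \<kappa> - 1)"
  obtain r where r: "prime r" "ord r p = M"
    using primitive_prime_exists[OF p_ge_2 generic(2,1)] unfolding M_def by blast
  have r2: "r \<noteq> 2"
  proof
    assume "r = 2"
    have "coprime r p" using r(2) generic M_def by (metis ord_eq_0 not_numeral_le_zero)
    hence "M dvd totient r" using order_divides_totient r(2) by metis
    thus False using \<open>r = 2\<close> generic(2) unfolding M_def by simp
  qed
  define c where "c = multiplicity r (p ^ M - 1)"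
  have "r dvd p ^ M - 1" using order_divides_iff[of p r M] r p_ge_2 by simp
  moreover have "p ^ M - 1 \<noteq> 0"
  proof -
    have "M > 0" using generic(2) unfolding M_def by linarith
    thus ?thesis using one_less_power[of p M] p_ge_2 by simp
  qed
  ultimately have c0: "c > 0" unfolding c_def using r(1) by (simp add: prime_multiplicity_gt_zero_iff)
  have nz: "prod_minus (p^f) u v \<noteq> 0" "prod_plus (p^f) (p^g) u v \<noteq> 0" for u v
    using prod_minus_pos[OF power_f_ge_2, of u v] prod_plus_pos[of "p^f" "p^g" u v] by auto
  have pm: "multiplicity r (prod_minus (p^f) u v) =
      (if u < k' + \<kappa> - 1 \<and> k' + \<kappa> - 1 \<le> v then c else 0)" if "v \<le> k' + \<kappa>" for u v
    unfolding c_def M_def using r M_def k3 that by (intro multiplicity_prod_minus_below) auto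
  have mE: "multiplicity r (prod_plus (p^f) (p^g) a (a+\<kappa>)) = 0"
    unfolding x[symmetric] using r M_def
    by (intro multiplicity_prod_plus_below[OF r(1) r2 _ k3 top]) auto
  have "\<not> r dvd 1 + \<epsilon>"
  proof
    assume "r dvd 1 + \<epsilon>"
    hence "r \<le> 1 + \<epsilon>" by (rule dvd_imp_le) simp
    thus False using eps r2 prime_ge_2_nat[OF r(1)] by simp
  qed
  hence mW: "multiplicity r (1 + \<epsilon>) = 0" by (rule not_dvd_imp_multiplicity_0)
  note md = prime_elem_multiplicity_mult_distrib[OF prime_imp_prime_elem[OF r(1)]]
  have "multiplicity r (prod_plus (p^f) (p^g) a (a+\<kappa>) * prod_minus (p^f) i (i+\<mu>) *
      prod_minus (p^f) l (l+\<nu>) * prod_minus (p^f) a (a+\<kappa>)) =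
      0 + (if i < k' + \<kappa> - 1 \<and> k' + \<kappa> - 1 \<le> i + \<mu> then c else 0) +
      (if l < k' + \<kappa> - 1 \<and> k' + \<kappa> - 1 \<le> l + \<nu> then c else 0) +
      (if a < k' + \<kappa> - 1 \<and> k' + \<kappa> - 1 \<le> a + \<kappa> then c else 0)"
    by (simp only: md nz mult_eq_0_iff pm[OF le(1)] pm[OF le(2)] pm[OF le(3)] mE simp_thms)
  moreover have "multiplicity r ((1 + \<epsilon>) * (prod_minus (p^f) k' (k'+\<kappa>))^2) = 2 * c"
    using nz \<kappa> by (simp only: md mW prime_elem_multiplicity_power_distrib[OF prime_imp_prime_elem[OF r(1)]]
        pm[OF order_refl] power_eq_0_iff simp_thms) simp
  ultimately have "(if i < k' + \<kappa> - 1 \<and> k' + \<kappa> - 1 \<le> i + \<mu> then c else 0) +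
      (if l < k' + \<kappa> - 1 \<and> k' + \<kappa> - 1 \<le> l + \<nu> then c else 0) +
      (if a < k' + \<kappa> - 1 \<and> k' + \<kappa> - 1 \<le> a + \<kappa> then c else 0) = 2 * c"
    using ident by simp
  thus ?thesis using c0 by (simp add: of_bool_def split: if_splits)
qed

lemma two_of_three: "of_bool P + of_bool Q + of_bool R = (2::nat) \<Longrightarrow> \<not> R \<Longrightarrow> P \<and> Q"
  by (cases P; cases Q) simp_all

text \<open>
  By \<open>top_order_balance\<close> either both products starting beyond \<open>i\<close> and \<open>l\<close> reach the largest
  exponent, or one of them and the product of the \<open>s q^c + 1\<close> do. In the first case \<open>\<kappa> = \<mu> + \<nu>\<close>
  gives \<open>k' \<le> i\<close> and \<open>k' \<le> l\<close>. In the second case \<open>second_order_balance\<close> and the equality \<open>v\<close> of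
  the exponents of \<open>p\<close> give the same bounds or a contradiction. Then \<open>low_order_terms_differ\<close>
  applies if \<open>\<epsilon> = 0\<close>; if \<open>\<epsilon> = 1\<close>, the same argument is carried out modulo 16.
\<close>

lemma no_balanced_identity:
  fixes a k' i l \<mu> \<nu> \<kappa> \<epsilon> :: nat
  assumes \<kappa>: "\<kappa> = \<mu> + \<nu>" "\<mu> \<ge> 1" "\<nu> \<ge> 1"
    and shift: "\<epsilon> = 0 \<and> f * a + g > 0 \<or> \<epsilon> = 1 \<and> p = 2 \<and> f = 1 \<and> g = 0 \<and> a = 0"
    and v: "2 * (f * \<kappa> * (2 * k' + \<kappa>)) + 2 * \<epsilon> + f * \<mu> =
      \<mu> * (4 * (f * (k' + \<kappa> + a)) + 2 * g + f * (2 * i + \<mu>))"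
    and ident: "prod_plus (p^f) (p^g) a (a+\<kappa>) * prod_minus (p^f) i (i+\<mu>) *
      prod_minus (p^f) l (l+\<nu>) * prod_minus (p^f) a (a+\<kappa>) =
      (1 + \<epsilon>) * (prod_minus (p^f) k' (k'+\<kappa>))^2"
  shows False
proof -
  have \<kappa>2: "\<kappa> \<ge> 2" using \<kappa> by simp
  then obtain x where x: "Suc x = a + \<kappa>" by (metis Suc_pred add_gr_0 not_numeral_le_zero zero_less_iff_neq_zero)
  have eps: "\<epsilon> \<le> 1" using shift by auto
  have k3: "k' + \<kappa> \<ge> 3"
  proof (rule ccontr)
    assume "\<not> ?thesis"
    hence k': "k' = 0" "\<kappa> = 2" "\<mu> = 1" "\<nu> = 1" using \<kappa> by linarith+
    have "2 * \<epsilon> = 4 * (f * a) + 2 * g + 2 * (f * i)" using v unfolding k' by (simp add: algebra_simps)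
    hence e1: "\<epsilon> = 1" and *: "p = 2" "f = 1" "g = 0" "a = 0" using shift by auto
    hence "i = 1" using \<open>2 * \<epsilon> = _\<close> by simp
    \<comment> \<open>What is left is 6 * 3 * (2^(l+1) - 1) * 3 = 18, but 54 does not divide 18.\<close>
    have ev: "prod_plus (2^1) (2^0) 0 (0+2) = 6" "prod_minus (2^1) 1 (1+1) = 3" "prod_minus (2^1) 0 (0+2) = 3"
      unfolding prod_minus_eq_list prod_plus_eq_list
      by (simp_all add: prod_minus_list_def prod_plus_list_def numeral_eq_Suc)
    have "6 * 3 * prod_minus (2^1) l (l + 1) * 3 = 2 * 3^2"
      using ident unfolding k' * e1 \<open>i = 1\<close> ev by simp
    thus False by simp
  qed
  have generic: "\<not> (p = 2 \<and> f * (i+\<mu>) \<le> 6 \<and> f * (l+\<nu>) \<le> 6 \<and> f * (a+\<kappa>) \<le> 6 \<and>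
      2 * (f * x + g) \<le> 6 \<and> f * (k'+\<kappa>) \<le> 6)"
  proof
    assume *: "p = 2 \<and> f * (i+\<mu>) \<le> 6 \<and> f * (l+\<nu>) \<le> 6 \<and> f * (a+\<kappa>) \<le> 6 \<and>
      2 * (f * x + g) \<le> 6 \<and> f * (k'+\<kappa>) \<le> 6"
    have "f * 3 \<le> f * (k' + \<kappa>)" using k3 by (intro mult_le_mono2)
    hence "f * 3 \<le> 6" using * by (meson order_trans)
    hence f12: "f = 1 \<or> f = 2" using f by linarith
    have ag: "f * (a + \<kappa>) + g \<le> 3 + f" using * unfolding x[symmetric] by simp
    have t: "f = 1 \<and> (\<kappa>, \<mu>, a, g, k', \<epsilon>, i) \<in> exceptional_parameters"
    proof (rule small_parameters_exceptional)
      show "f * (k' + \<kappa>) \<le> 6" "f * (i + \<mu>) \<le> 6" using * by blast+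
      show "\<epsilon> = 0 \<and> 0 < f * a + g \<or> \<epsilon> = 1 \<and> f = 1 \<and> a = 0 \<and> g = 0" using shift by blast
      show "\<mu> < \<kappa>" using \<kappa> by simp
    qed (use f12 \<kappa>2 \<kappa>(2) ag k3 v in blast)+
    have "l + \<nu> \<le> 6" using * t by simp
    hence l: "l = 0 \<or> l = 1 \<or> l = 2 \<or> l = 3 \<or> l = 4 \<or> l = 5" using \<kappa> by arith
    have "\<nu> = \<kappa> - \<mu>" using \<kappa> by simp
    have f1: "f = 1" and p2: "p = 2" using t * by auto
    show False
      using exceptional_parameters_no_identity[OF conjunct2[OF t] l] ident
      unfolding prod_minus_eq_list prod_plus_eq_list f1 p2 \<open>\<nu> = \<kappa> - \<mu>\<close> by simp
  qed
  note top = top_order_balance[OF _ \<kappa>(2,3) x k3 eps ident generic]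
  have le: "i + \<mu> \<le> k' + \<kappa>" "l + \<nu> \<le> k' + \<kappa>" "a + \<kappa> \<le> k' + \<kappa>" "2 * (f * x + g) \<le> f * (k' + \<kappa>)"
    and two: "of_bool (i + \<mu> = k' + \<kappa>) + of_bool (l + \<nu> = k' + \<kappa>) + of_bool (a + \<kappa> = k' + \<kappa>) +
    of_bool (2 * (f * x + g) = f * (k' + \<kappa>)) = (2 :: nat)"
    using top \<kappa>2 by auto
  have fx: "f * Suc x = f * x + f" by simp
  have fdist: "f * (k' + \<kappa>) = f * k' + f * \<kappa>" "f * (a + \<kappa>) = f * a + f * \<kappa>"
    by (simp_all add: distrib_left)
  have a_ne: "a + \<kappa> \<noteq> k' + \<kappa>"
  proof
    assume eq: "a + \<kappa> = k' + \<kappa>"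
    have "f * 3 \<le> f * (k' + \<kappa>)" using k3 by (intro mult_le_mono2)
    moreover have "f * (k' + \<kappa>) = f * x + f" using eq x fx by simp
    moreover have "2 * (f * x) + 2 * g \<le> f * (k' + \<kappa>)" using le(4) by simp
    ultimately show False using f by linarith
  qed
  have bounds: "i \<ge> k' \<and> l \<ge> k'"
  proof (cases "2 * (f * x + g) = f * (k' + \<kappa>)")
    case False
    hence "i + \<mu> = k' + \<kappa>" "l + \<nu> = k' + \<kappa>" using two a_ne by (auto simp: of_bool_def split: if_splits)
    thus ?thesis using \<kappa> by simp
  next
    case True
    hence one: "i + \<mu> = k' + \<kappa> \<and> l + \<nu> \<noteq> k' + \<kappa> \<or> i + \<mu> \<noteq> k' + \<kappa> \<and> l + \<nu> = k' + \<kappa>"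
      using two a_ne by (auto simp: of_bool_def split: if_splits)
    have True': "2 * (f * x) + 2 * g = f * (k' + \<kappa>)" using True by simp
    have fax: "f * a + f * \<kappa> = f * x + f" using fx x fdist by simp
    have evenk: "even (k' + \<kappa>)" if "f = 1"
      using True that by (metis dvd_triv_left mult_1)
    \<comment> \<open>The next smaller exponent is large enough for a primitive prime.\<close>
    have f_ge: "f * (k' + \<kappa> - 1) \<ge> 3"
    proof (cases "f = 1")
      case f1: True
      thus ?thesis using evenk k3 by (cases "k' + \<kappa> = 3") auto
    next
      case False
      hence "2 * 2 \<le> f * (k' + \<kappa> - 1)" using f k3 by (intro mult_le_mono) auto
      thus ?thesis by simp
    qed
    show ?thesis
    proof (cases "p = 2 \<and> f * (k' + \<kappa> - 1) = 6")
      case exc: True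
      \<comment> \<open>Zsigmondy's exception for the second exponent: only q = 4 with k' + \<kappa> = 4 is possible.\<close>
      have "f dvd 6" using exc by (metis dvd_triv_left)
      hence "f \<in> {1, 2, 3, 6}"
        using dvd_imp_le[of f 6] by (auto simp: le_Suc_eq numeral_eq_Suc elim!: dvdE) presburger+
      moreover have "f \<noteq> 1"
      proof
        assume "f = 1"
        hence "k' + \<kappa> - 1 = 6" "even (k' + \<kappa>)" using exc evenk by auto
        thus False by presburger
      qed
      moreover have "f \<noteq> 3"
      proof
        assume "f = 3"
        hence "k' + \<kappa> = 3" using exc k3 by auto
        thus False using True \<open>f = 3\<close> by presburger
      qed
      moreover have "f \<noteq> 6" using exc k3 by auto
      ultimately have f2: "f = 2" by blast
      hence k4: "k' + \<kappa> = 4" using exc k3 by auto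
      have xg: "2 * x + g = 4" using True f2 k4 by simp
      have e0: "\<epsilon> = 0" "2 * a + g > 0" using shift f2 by auto
      have v2: "4 * (\<kappa> * (2 * k' + \<kappa>)) + 2 * \<mu> = \<mu> * (8 * (4 + a) + 2 * g + 2 * (2 * i + \<mu>))"
        using v unfolding f2 k4 e0 by (simp add: mult.assoc)
      have "x = 1 \<and> \<kappa> = 2 \<and> a = 0 \<and> k' = 2 \<and> g = 2 \<or> x = 2 \<and> \<kappa> = 2 \<and> a = 1 \<and> k' = 2 \<and> g = 0"
        using xg x \<kappa>2 k4 e0 by presburger
      thus ?thesis
      proof (elim disjE conjE)
        assume *: "x = 1" "\<kappa> = 2" "a = 0" "k' = 2" "g = 2"
        have \<mu>\<nu>: "\<mu> = 1" "\<nu> = 1" using \<kappa> * by auto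
        have "i = 3" using v2 unfolding * \<mu>\<nu> by simp
        have "l + 1 < 4" using one \<open>i = 3\<close> unfolding \<mu>\<nu> using k4 le(2) \<mu>\<nu> by auto
        hence l: "l = 0 \<or> l = 1 \<or> l = 2" by arith
        have ev: "prod_plus 4 4 0 (0 + 2) = 85" "prod_minus 4 3 (3 + 1) = 255" "prod_minus 4 0 (0 + 2) = 45"
          "prod_minus 4 2 (2 + 2) = 16065" "prod_minus 4 0 (0 + 1) = 3" "prod_minus 4 1 (1 + 1) = 15"
          "prod_minus 4 2 (2 + 1) = 63"
          unfolding prod_minus_eq_list prod_plus_eq_list
          by (simp_all add: prod_minus_list_def prod_plus_list_def upt_rec)
        have "85 * 255 * prod_minus 4 l (l + 1) * 45 = 16065 ^ 2"
          using ident exc ev unfolding f2 * \<mu>\<nu> \<open>i = 3\<close> e0 by simp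
        thus ?thesis using l ev by auto
      next
        assume *: "x = 2" "\<kappa> = 2" "a = 1" "k' = 2" "g = 0"
        have \<mu>\<nu>: "\<mu> = 1" "\<nu> = 1" using \<kappa> * by auto
        have "i = 2" using v2 unfolding * \<mu>\<nu> by simp
        moreover have "l = 3" using one k4 \<open>i = 2\<close> unfolding \<mu>\<nu> by auto
        ultimately show ?thesis using * by simp
      qed
    next
      case False
      have two': "of_bool (i < k' + \<kappa> - 1 \<and> k' + \<kappa> - 1 \<le> i + \<mu>) +
          of_bool (l < k' + \<kappa> - 1 \<and> k' + \<kappa> - 1 \<le> l + \<nu>) +
          of_bool (a < k' + \<kappa> - 1 \<and> k' + \<kappa> - 1 \<le> a + \<kappa>) = (2 :: nat)"
        by (rule second_order_balance[OF \<kappa>2 x k3 eps ident False f_ge le(1-3) True])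
      show ?thesis
      proof (cases "k' + \<kappa> - 1 \<le> a + \<kappa>")
        case False
        hence "(i < k' + \<kappa> - 1 \<and> k' + \<kappa> - 1 \<le> i + \<mu>) \<and> (l < k' + \<kappa> - 1 \<and> k' + \<kappa> - 1 \<le> l + \<nu>)"
          using two_of_three[OF two'] by blast
        hence "Suc i < k' + \<kappa>" "k' + \<kappa> \<le> Suc (i + \<mu>)" "Suc l < k' + \<kappa>" "k' + \<kappa> \<le> Suc (l + \<nu>)"
          by linarith+
        thus ?thesis using one \<kappa>(1) le(1,2) by (elim disjE conjE) linarith+
      next
        case True
        hence ak: "k' = a + 1" using le(3) a_ne by simp
        have "f * k' = f * a + f" unfolding ak by simp
        have X: "f * k' + f * \<kappa> + 2 * g = 4 * f"
          using True' fax fdist \<open>f * k' = f * a + f\<close> by linarith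
        have "f * (k' + \<kappa>) \<le> f * 4" using X fdist by simp
        hence "k' + \<kappa> \<le> 4" using f by simp
        hence k34: "k' + \<kappa> = 3 \<or> k' + \<kappa> = 4" using k3 by arith
        show ?thesis
        proof (cases "k' + \<kappa> = 4")
          case k4: True
          have "f * 4 + 2 * g = 4 * f" using X fdist k4 by simp
          hence g0: "g = 0" by simp
          have "k' = 1 \<and> \<kappa> = 3 \<and> a = 0 \<or> k' = 2 \<and> \<kappa> = 2 \<and> a = 1" using k4 ak \<kappa>2 by arith
          thus ?thesis
          proof (elim disjE conjE)
            assume *: "k' = 1" "\<kappa> = 3" "a = 0"
            hence e: "\<epsilon> = 1" "f = 1" using shift g0 by auto
            have \<mu>: "\<mu> = 1 \<or> \<mu> = 2" using \<kappa> * by arith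
            have "32 + \<mu> = \<mu> * (16 + (2 * i + \<mu>))" using v unfolding * e g0 by simp
            hence "\<mu> = 1 \<and> i = 8" using \<mu> by (elim disjE) (simp_all, presburger?)
            thus ?thesis using le(1) * by simp
          next
            assume *: "k' = 2" "\<kappa> = 2" "a = 1"
            hence e0: "\<epsilon> = 0" using shift by auto
            have \<mu>\<nu>: "\<mu> = 1" "\<nu> = 1" using \<kappa> * by auto
            have "f * (2 * i) = f * 4" using v unfolding * e0 g0 \<mu>\<nu> by (simp add: algebra_simps)
            hence "i = 2" using f by simp
            moreover have "l = 3" using one k4 \<open>i = 2\<close> unfolding \<mu>\<nu> by auto
            ultimately show ?thesis using * by simp
          qed
        next
          case False
          hence k': "k' + \<kappa> = 3" using k34 by simp
          hence *: "k' = 1" "\<kappa> = 2" "a = 0" using ak \<kappa>2 by arith+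
          have "f * 3 + 2 * g = 4 * f" using X fdist k' by simp
          hence g: "2 * g = f" by simp
          have \<mu>\<nu>: "\<mu> = 1" "\<nu> = 1" using \<kappa> * by auto
          have e0: "\<epsilon> = 0" using shift g by auto
          have "f * (2 * i) = f * 3" using v g unfolding * e0 \<mu>\<nu> by (simp add: algebra_simps)
          hence "2 * i = 3" using f by simp
          thus ?thesis by presburger
        qed
      qed
    qed
  qed
  have top': "2 * (f * a) + 2 * g + f * \<kappa> \<le> f * k' + 2 * f"
    using le(4) fx fdist x by (simp add: algebra_simps)
  show False
  proof (cases "\<epsilon> = 0")
    case True
    hence pos: "f * a + g > 0" using shift by simp
    have "prod_plus (p^f) (p^g) a (a+\<kappa>) * prod_minus (p^f) i (i+\<mu>) *
      prod_minus (p^f) l (l+\<nu>) * prod_minus (p^f) a (a+\<kappa>) = (prod_minus (p^f) k' (k'+\<kappa>))^2"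
      using ident True by simp
    from low_order_terms_differ[OF \<kappa> conjunct1[OF bounds] conjunct2[OF bounds] top' pos this]
    show False .
  next
    case False
    hence sh: "\<epsilon> = 1" "p = 2" "f = 1" "g = 0" "a = 0" using shift by auto
    have v1: "2 * (\<kappa> * (2 * k' + \<kappa>)) + 2 + \<mu> = \<mu> * (4 * (k' + \<kappa>) + (2 * i + \<mu>))"
      using v unfolding sh by simp
    \<comment> \<open>Here q = 2 and s = 1, so the products over c start with (1+1)(2+1)(4+1) = 30 and (2-1)(4-1) = 3.\<close>
    have kk: "\<kappa> \<le> k' + 2" using top' unfolding sh by simp
    have "\<kappa> \<noteq> 2"
    proof
      assume "\<kappa> = 2"
      hence "\<mu> = 1" using \<kappa> by simp
      have "i = 2 * k' + 1" using v1 unfolding \<open>\<mu> = 1\<close> \<open>\<kappa> = 2\<close> by simp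
      thus False using le(1) \<open>\<kappa> = 2\<close> \<open>\<mu> = 1\<close> k3 by simp
    qed
    hence \<kappa>3: "\<kappa> \<ge> 3" using \<kappa>2 by simp
    have "k' \<noteq> 1"
    proof
      assume "k' = 1"
      hence "\<kappa> = 3" using \<kappa>3 kk by simp
      have \<mu>: "\<mu> = 1 \<or> \<mu> = 2" using \<kappa> \<open>\<kappa> = 3\<close> by arith
      have "32 + \<mu> = \<mu> * (16 + (2 * i + \<mu>))" using v1 unfolding \<open>\<kappa> = 3\<close> \<open>k' = 1\<close> by simp
      hence "\<mu> = 1 \<and> i = 8" using \<mu> by (elim disjE) (simp_all, presburger?)
      thus False using le(1) \<open>\<kappa> = 3\<close> \<open>k' = 1\<close> by simp
    qed
    hence k'2: "k' \<ge> 2" using \<kappa>3 kk by simp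
    obtain m where m: "\<kappa> = m + 3" using \<kappa>3 by (metis add.commute le_Suc_ex)
    have C: "[int (prod_minus 2 0 \<kappa>) = 3 * (-1)^(Suc m)] (mod 8)"
    proof -
      have "prod_minus 2 0 \<kappa> = 3 * prod_minus 2 2 \<kappa>"
        using prod_minus_first[of 0 \<kappa> 2] prod_minus_first[of 1 \<kappa> 2] m by (simp add: numeral_2_eq_2)
      moreover have "[int (prod_minus (2^1) 2 \<kappa>) = (-1)^(\<kappa> - 2)] (mod int 2 ^ 3)"
        using cong_prod_minus[of 3 2 \<kappa>] m sh by simp
      ultimately show ?thesis using cong_scalar_left[of "int (prod_minus 2 2 \<kappa>)" "(-1)^(\<kappa> - 2)" 8 3] m by simp
    qed
    have E: "[int (prod_plus 2 1 0 \<kappa>) = 30] (mod 16)"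
    proof -
      have e1: "prod_plus 2 1 0 \<kappa> = 30 * prod_plus 2 1 3 \<kappa>"
        using prod_plus_first[of 0 \<kappa> 2 1] prod_plus_first[of 1 \<kappa> 2 1] prod_plus_first[of 2 \<kappa> 2 1] m
        by (simp add: numeral_3_eq_3 numeral_2_eq_2)
      have "[int (prod_plus (2^1) (2^0) 3 \<kappa>) = 1] (mod int 2 ^ 3)"
        using cong_prod_plus[of 3 3 \<kappa>] sh by simp
      hence "8 dvd int (prod_plus 2 1 3 \<kappa>) - 1" by (simp add: cong_iff_dvd_diff)
      then obtain z where "int (prod_plus 2 1 3 \<kappa>) = 1 + 8 * z" by (auto elim!: dvdE simp: algebra_simps)
      hence "int (prod_plus 2 1 0 \<kappa>) - 30 = 16 * (15 * z)" unfolding e1 by simp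
      thus ?thesis unfolding cong_iff_dvd_diff by simp
    qed
    have "[int (prod_minus (2^1) i (i+\<mu>)) * int (prod_minus (2^1) l (l+\<nu>)) =
        (-1)^(i+\<mu>-i) * (-1)^(l+\<nu>-l)] (mod int 2 ^ 3)"
      using cong_mult[OF cong_prod_minus[of 3 i "i+\<mu>"] cong_prod_minus[of 3 l "l+\<nu>"]] bounds k'2
      unfolding sh by simp
    hence AB: "[int (prod_minus 2 i (i+\<mu>)) * int (prod_minus 2 l (l+\<nu>)) = (-1)^\<kappa>] (mod 8)"
      by (simp add: \<kappa>(1) power_add)
    have sg: "(-1::int)^n * (3 * (-1)^n) = 3" for n by (cases "even n") simp_all
    have "[int (prod_minus 2 i (i+\<mu>)) * int (prod_minus 2 l (l+\<nu>)) * int (prod_minus 2 0 \<kappa>) = 3] (mod 8)"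
      using cong_mult[OF AB C] unfolding m by (simp add: power_add) (simp only: sg)
    then obtain w where w: "int (prod_minus 2 i (i+\<mu>)) * int (prod_minus 2 l (l+\<nu>)) * int (prod_minus 2 0 \<kappa>) = 3 + 8 * w"
      unfolding cong_iff_dvd_diff by (auto elim!: dvdE simp: algebra_simps)
    have "[(int (prod_minus (2^1) k' (k'+\<kappa>)))^2 = ((-1)^(k'+\<kappa>-k'))^2] (mod int 2 ^ 3)"
      using cong_pow[OF cong_prod_minus[of 3 k' "k'+\<kappa>"], of 2] k'2 unfolding sh by simp
    hence "[(int (prod_minus 2 k' (k'+\<kappa>)))^2 = 1] (mod 8)" by (simp flip: power_mult)
    then obtain y where y: "(int (prod_minus 2 k' (k'+\<kappa>)))^2 = 1 + 8 * y"
      unfolding cong_iff_dvd_diff by (auto elim!: dvdE simp: algebra_simps)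
    obtain z where z: "int (prod_plus 2 1 0 \<kappa>) = 30 + 16 * z"
      using E unfolding cong_iff_dvd_diff by (auto elim!: dvdE simp: algebra_simps)
    have "int (prod_plus 2 1 0 \<kappa>) *
       (int (prod_minus 2 i (i+\<mu>)) * int (prod_minus 2 l (l+\<nu>)) * int (prod_minus 2 0 \<kappa>)) =
        2 * (int (prod_minus 2 k' (k'+\<kappa>)))^2"
      using arg_cong[OF ident, of int] unfolding sh by (simp add: mult_ac)
    hence "(30 + 16 * z) * (3 + 8 * w) = 2 * (1 + 8 * y)" unfolding w y z .
    hence "88 = 16 * (y - 15 * w - 3 * z - 8 * (z * w))" by (simp add: algebra_simps)
    hence "(16::int) dvd 88" by (rule dvdI)
    thus False by simp
  qed
qed

section \<open>Distinctness of the closed forms\<close>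

lemma two_sum_lessThan: "2 * \<Sum>{..<n::nat} + n = n ^ 2"
  by (induction n) (simp_all add: power2_eq_square lessThan_Suc)

lemma not_dvd_prod_minus: "\<not> p dvd prod_minus (p^f) a b"
proof (cases "a \<le> b")
  case True
  show ?thesis
  proof
    assume "p dvd prod_minus (p^f) a b"
    hence "int p dvd int (prod_minus (p^f) a b)" by (simp only: of_nat_dvd_iff)
    moreover have "[int (prod_minus (p^f) a b) = (-1) ^ (b - a)] (mod int p)"
      using cong_prod_minus[of 1 a b] f True by simp
    ultimately have "int p dvd (-1) ^ (b - a)" using cong_dvd_iff by blast
    hence "int p dvd 1" by (cases "even (b - a)") auto
    thus False using p_ge_2 by simp
  qed
qed (use p_ge_2 in \<open>auto simp: prod_minus_def\<close>)

text \<open>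
  A factor \<open>s q^c + 1\<close> is prime to \<open>p\<close> unless \<open>s q^c = 1\<close>.
\<close>

lemma multiplicity_prod_plus_self:
  "multiplicity p (prod_plus (p^f) (p^g) a b) = (if p = 2 \<and> f * a + g = 0 \<and> a < b then 1 else 0)"
proof -
  have nd: "\<not> p dvd prod_plus (p^f) (p^g) a b" if "f * a + g > 0" for a
  proof
    assume "p dvd prod_plus (p^f) (p^g) a b"
    hence "int p dvd int (prod_plus (p^f) (p^g) a b)" by (simp only: of_nat_dvd_iff)
    moreover have "[int (prod_plus (p^f) (p^g) a b) = 1] (mod int p)"
      using cong_prod_plus[of 1 a b] Suc_leI[OF that] by simp
    ultimately have "int p dvd 1" using cong_dvd_iff by blast
    thus False using p_ge_2 by simp
  qed
  show ?thesis
  proof (cases "f * a + g = 0 \<and> a < b")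
    case False
    hence "\<not> p dvd prod_plus (p^f) (p^g) a b"
      using nd[of a] p_ge_2 by (cases "a < b") (auto simp: prod_plus_def)
    thus ?thesis using False by (auto simp: not_dvd_imp_multiplicity_0)
  next
    case True
    hence a0: "a = 0" "g = 0" using f by auto
    have "prod_plus (p^f) (p^g) a b = 2 * prod_plus (p^f) (p^g) 1 b"
      using prod_plus_first[of a b "p^f" "p^g"] True a0 by simp
    moreover have "multiplicity p (prod_plus (p^f) (p^g) 1 b) = 0"
      using nd[of 1] f by (intro not_dvd_imp_multiplicity_0) auto
    moreover have "multiplicity p (2 * prod_plus (p^f) (p^g) 1 b) =
        multiplicity p 2 + multiplicity p (prod_plus (p^f) (p^g) 1 b)"
      using prod_plus_pos[of "p^f" "p^g" 1 b] p
      by (intro prime_elem_multiplicity_mult_distrib) auto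
    moreover have "multiplicity p 2 = (if p = 2 then 1 else 0)"
    proof (cases "p = 2")
      case False
      hence "\<not> p dvd 2" using p by (metis primes_dvd_imp_eq two_is_prime_nat)
      thus ?thesis using False by (simp add: not_dvd_imp_multiplicity_0)
    qed (use p in simp)
    ultimately show ?thesis using True by auto
  qed
qed

text \<open>
  The exponent of \<open>p\<close> in \<open>s^i q^(k^2 + 2 D i + i(i-1)/2)\<close> for \<open>q = p^f\<close> and \<open>s = p^g\<close>.
\<close>

definition p_exponent :: "nat \<Rightarrow> nat \<Rightarrow> nat \<Rightarrow> nat" where
  "p_exponent D i k = f * (k^2 + 2 * D * i + \<Sum>{..<i}) + g * i"

text \<open>
  Dividing the two closed forms and comparing exponents of \<open>p\<close>, where \<open>\<epsilon>\<close> records the extra factor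
  2. If \<open>k < k'\<close> the exponents differ. If \<open>k = k'\<close> they agree only for \<open>D = 0\<close> and
  \<open>{i, i'} = {0, 1}\<close>, where the numbers differ as \<open>m \<ge> 2\<close>. If \<open>k' < k\<close>, put \<open>\<kappa> = k - k'\<close> and
  \<open>\<mu> = i' - i\<close>; for \<open>\<mu> < \<kappa>\<close> the quotient is an identity refuted by \<open>no_balanced_identity\<close>, and for
  \<open>\<mu> \<ge> \<kappa>\<close> the exponents force \<open>p^f = 2\<close>, \<open>s = 1\<close> and \<open>k = k' + 1 = D\<close>, whereupon the quotient
  itself gives \<open>D = 1\<close>.
\<close>

lemma closed_form_inj_ordered:
  fixes D m l k i l' k' i' N :: nat
  assumes m: "l + k + i = m" "l' + k' + i' = m" and kD: "k \<le> D" "k' \<le> D" and N: "N > 0"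
    and eq1: "N * (prod_minus (p^f) 0 l * prod_minus (p^f) 0 k ^ 2 * prod_minus (p^f) 0 i *
        prod_minus (p^f) 0 (D - k)) = prod_minus (p^f) 0 m * prod_minus (p^f) 0 D *
        prod_plus (p^f) (p^g) (D - k) D * p ^ p_exponent D i k"
    and eq2: "N * (prod_minus (p^f) 0 l' * prod_minus (p^f) 0 k' ^ 2 * prod_minus (p^f) 0 i' *
        prod_minus (p^f) 0 (D - k')) = prod_minus (p^f) 0 m * prod_minus (p^f) 0 D *
        prod_plus (p^f) (p^g) (D - k') D * p ^ p_exponent D i' k'"
    and exc: "\<not> (p = 2 \<and> f = 1 \<and> g = 0 \<and> D = 1)" and m2: "D = 0 \<Longrightarrow> m \<ge> 2"
    and ii: "i \<le> i'"
  shows "i = i' \<and> k = k'"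
proof -
  let ?G = "prod_minus (p^f) 0" and ?P = "\<lambda>k. prod_plus (p^f) (p^g) (D - k) D"
  define V V' where "V = p_exponent D i k" and "V' = p_exponent D i' k'"
  note Vdef = V_def[unfolded p_exponent_def] and V'def = V'_def[unfolded p_exponent_def]
  have Gpos: "?G n > 0" for n using prod_minus_pos[OF power_f_ge_2] .
  have Ppos: "?P n > 0" for n by (rule prod_plus_pos)
  \<comment> \<open>Both closed forms share N, G(m) and G(D); this is their quotient without denominators.\<close>
  have cross: "p ^ V * ?P k * (?G l' * ?G k' ^ 2 * ?G i' * ?G (D - k')) =
      p ^ V' * ?P k' * (?G l * ?G k ^ 2 * ?G i * ?G (D - k))"
  proof -
    let ?C = "N * (?G m * ?G D)"
    have "?C * (p ^ V * ?P k * (?G l' * ?G k' ^ 2 * ?G i' * ?G (D - k'))) =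
       (?G m * ?G D * ?P k * p ^ V) * (N * (?G l' * ?G k' ^ 2 * ?G i' * ?G (D - k')))"
      by (simp only: mult_ac)
    also have "\<dots> = (N * (?G l * ?G k ^ 2 * ?G i * ?G (D - k))) * (?G m * ?G D * ?P k' * p ^ V')"
      unfolding eq1[folded V_def] eq2[folded V'_def] ..
    also have "\<dots> = ?C * (p ^ V' * ?P k' * (?G l * ?G k ^ 2 * ?G i * ?G (D - k)))"
      by (simp only: mult_ac)
    finally have eq: "?C * (p ^ V * ?P k * (?G l' * ?G k' ^ 2 * ?G i' * ?G (D - k'))) =
      ?C * (p ^ V' * ?P k' * (?G l * ?G k ^ 2 * ?G i * ?G (D - k)))" .
    have "?C \<noteq> 0" using N Gpos[of m] Gpos[of D] by simp
    from mult_left_cancel[THEN iffD1, OF this eq] show ?thesis .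
  qed
  define \<epsilon> \<epsilon>' :: nat where "\<epsilon> = (if p = 2 \<and> g = 0 \<and> k = D \<and> D > 0 then 1 else 0)"
    and "\<epsilon>' = (if p = 2 \<and> g = 0 \<and> k' = D \<and> D > 0 then 1 else 0)"
  have V: "V + \<epsilon> = V' + \<epsilon>'"
  proof -
    have mP: "multiplicity p (?P k) = \<epsilon>" "multiplicity p (?P k') = \<epsilon>'"
      unfolding multiplicity_prod_plus_self \<epsilon>_def \<epsilon>'_def using kD f by auto
    have mG: "multiplicity p (?G n) = 0" for n
      using not_dvd_prod_minus by (rule not_dvd_imp_multiplicity_0)
    have nz: "?G n \<noteq> 0" "?P n \<noteq> 0" for n using Gpos[of n] Ppos[of n] by auto
    have p0: "p \<noteq> 0" using p_ge_2 by simp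
    note md = prime_elem_multiplicity_mult_distrib[OF prime_imp_prime_elem[OF p]]
      prime_elem_multiplicity_power_distrib[OF prime_imp_prime_elem[OF p]]
    have pp: "multiplicity p (p ^ n) = n" for n using p by (simp add: multiplicity_same_power)
    have "multiplicity p (p ^ V * ?P k * (?G l' * ?G k' ^ 2 * ?G i' * ?G (D - k'))) = V + \<epsilon>"
      by (simp only: md nz p0 mult_eq_0_iff power_eq_0_iff pp mP mG simp_thms add_0_right mult_0_right)
    moreover have "multiplicity p (p ^ V' * ?P k' * (?G l * ?G k ^ 2 * ?G i * ?G (D - k))) = V' + \<epsilon>'"
      by (simp only: md nz p0 mult_eq_0_iff power_eq_0_iff pp mP mG simp_thms add_0_right mult_0_right)
    ultimately show ?thesis using cross by simp
  qed
  have tri_mono: "\<Sum>{..<i} \<le> \<Sum>{..<i'}" using ii by (intro sum_mono2) auto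
  have V_mono_i: "f * (2 * D * i + \<Sum>{..<i}) + g * i \<le> f * (2 * D * i' + \<Sum>{..<i'}) + g * i'"
    using ii tri_mono by (intro add_mono mult_le_mono) auto
  have Vsum: "V = f * k^2 + (f * (2 * D * i + \<Sum>{..<i}) + g * i)"
      "V' = f * k'^2 + (f * (2 * D * i' + \<Sum>{..<i'}) + g * i')"
    unfolding Vdef V'def by (simp_all add: distrib_left)
  have sq: "f * x^2 < f * y^2" if "x < y" for x y :: nat
    using that f power_strict_mono[of x y 2] by simp
  consider "k < k'" | "k = k'" | "k' < k" by linarith
  thus ?thesis
  proof cases
    case 1
    hence "\<epsilon> = 0" using kD by (simp add: \<epsilon>_def)
    thus ?thesis using V Vsum V_mono_i sq[OF 1] by linarith
  next
    case 2
    hence "V = V'" using V by (simp add: \<epsilon>_def \<epsilon>'_def)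
    show ?thesis
    proof (rule ccontr)
      assume "\<not> ?thesis"
      hence lt: "i < i'" using 2 ii by simp
      have e: "f * (2 * D * i + \<Sum>{..<i}) + g * i = f * (2 * D * i' + \<Sum>{..<i'}) + g * i'"
        using \<open>V = V'\<close> Vsum 2 by simp
      have D0: "D = 0"
      proof (rule ccontr)
        assume "D \<noteq> 0"
        hence "2 * D * i < 2 * D * i'" using lt by simp
        hence "2 * D * i + \<Sum>{..<i} < 2 * D * i' + \<Sum>{..<i'}" using tri_mono by (rule add_less_le_mono)
        hence "f * (2 * D * i + \<Sum>{..<i}) < f * (2 * D * i' + \<Sum>{..<i'})" using f by simp
        moreover have "g * i \<le> g * i'" using lt by simp
        ultimately show False using e by linarith
      qed
      have "f * \<Sum>{..<i} \<le> f * \<Sum>{..<i'}" using tri_mono by simp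
      moreover have "g * i \<le> g * i'" using lt by simp
      moreover have "f * \<Sum>{..<i} + g * i = f * \<Sum>{..<i'} + g * i'" using e D0 by simp
      ultimately have "f * \<Sum>{..<i} = f * \<Sum>{..<i'}" by linarith
      hence tri: "\<Sum>{..<i} = \<Sum>{..<i'}" using f by simp
      have "{..<i'} = {..<i} \<union> {i..<i'}" using lt by auto
      hence "\<Sum>{..<i'} = \<Sum>{..<i} + \<Sum>{i..<i'}" by (metis sum.union_disjoint finite_lessThan
          finite_atLeastLessThan ivl_disj_int_one(2))
      hence z: "\<Sum>{i..<i'} = 0" using tri by simp
      hence "\<forall>x\<in>{i..<i'}. x = 0" by (simp add: sum_eq_0_iff)
      hence z': "x = 0" if "i \<le> x" "x < i'" for x using that by simp
      have "i = 0" by (rule z') (use lt in auto)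
      have "i' = 1"
      proof (rule ccontr)
        assume "i' \<noteq> 1"
        hence "1 < i'" using lt by linarith
        hence "(1::nat) = 0" using \<open>i = 0\<close> by (intro z') simp_all
        thus False by simp
      qed
      have k0: "k = 0" "k' = 0" using kD D0 by auto
      have "l = m" "m = Suc l'" using m \<open>i = 0\<close> \<open>i' = 1\<close> k0 by auto
      have "V = 0" using Vdef \<open>i = 0\<close> k0 by simp
      hence "?G l' * ?G 1 = ?G m"
        using cross \<open>V = V'\<close> \<open>i = 0\<close> \<open>i' = 1\<close> k0 D0 \<open>l = m\<close> by simp
      moreover have "?G m = ?G l' * ((p^f) ^ m - 1)"
        unfolding \<open>m = Suc l'\<close> by (rule prod_minus_Suc) simp
      moreover have "?G 1 = p^f - 1" using prod_minus_Suc[of 0 0 "p^f"] by simp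
      ultimately have "p^f - 1 = (p^f) ^ m - 1" using Gpos[of l'] by simp
      moreover have "(p^f) ^ 1 < (p^f) ^ m" using m2[OF D0] power_f_ge_2 by (intro power_strict_increasing) auto
      ultimately show False using power_f_ge_2 by simp
    qed
  next
    case 3
    hence e'0: "\<epsilon>' = 0" using kD by (simp add: \<epsilon>'_def)
    have lt: "i < i'"
    proof (rule ccontr)
      assume "\<not> i < i'"
      hence "i' = i" using ii by simp
      thus False using V Vsum sq[OF 3] e'0 by simp
    qed
    obtain \<kappa> where \<kappa>: "k = k' + \<kappa>" "\<kappa> \<ge> 1" using 3 by (metis add.commute add_le_cancel_left le_add_diff_inverse less_imp_le_nat less_iff_Suc_add add_Suc_right le_add1 plus_1_eq_Suc)
    obtain \<mu> where \<mu>: "i' = i + \<mu>" "\<mu> \<ge> 1" using lt by (metis less_iff_Suc_add add_Suc_right le_add1 plus_1_eq_Suc)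
    obtain a where a: "D = k' + \<kappa> + a" using kD \<kappa> by (metis le_iff_add)
    have f1: "f = 1" if "\<epsilon> = 1"
    proof -
      have "g = 0" using that by (simp add: \<epsilon>_def split: if_splits)
      hence "f * (k^2 + 2 * D * i + \<Sum>{..<i}) + 1 = f * (k'^2 + 2 * D * i' + \<Sum>{..<i'})"
        using V e'0 that unfolding Vdef V'def by simp
      hence "f dvd f * (k^2 + 2 * D * i + \<Sum>{..<i}) + 1" by simp
      hence "f dvd 1" by (metis dvd_add_right_iff dvd_triv_left)
      thus ?thesis by simp
    qed
    \<comment> \<open>Twice the equality of the exponents of p, which avoids the halves in i(i-1)/2.\<close>
    have v: "2 * (f * \<kappa> * (2 * k' + \<kappa>)) + 2 * \<epsilon> + f * \<mu> =
      \<mu> * (4 * (f * (k' + \<kappa> + a)) + 2 * g + f * (2 * i + \<mu>))"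
    proof -
      have t: "2 * int (\<Sum>{..<n}) = int n ^ 2 - int n" for n
        using arg_cong[OF two_sum_lessThan[of n], of int] by simp
      have "2 * int (V + \<epsilon>) = 2 * int V'" using V e'0 by simp
      hence "int f * (2 * int k ^ 2 + 4 * int D * int i + (int i ^ 2 - int i)) + 2 * int g * int i + 2 * int \<epsilon> =
          int f * (2 * int k' ^ 2 + 4 * int D * int i' + (int i' ^ 2 - int i')) + 2 * int g * int i'"
        unfolding Vdef V'def by (simp add: algebra_simps flip: t)
      hence "int (2 * (f * \<kappa> * (2 * k' + \<kappa>)) + 2 * \<epsilon> + f * \<mu>) =
         int (\<mu> * (4 * (f * (k' + \<kappa> + a)) + 2 * g + f * (2 * i + \<mu>)))"
        unfolding \<kappa>(1) \<mu>(1) a by (simp add: power2_eq_square algebra_simps)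
      thus ?thesis by (simp only: of_nat_eq_iff)
    qed
    have Dk: "D - k = a" "D - k' = a + \<kappa>" using a \<kappa> by auto
    have PD: "?P k = prod_plus (p^f) (p^g) a (a + \<kappa>) * ?P k'"
      unfolding Dk using a by (intro prod_plus_split) auto
    have splits: "?G i' = ?G i * prod_minus (p^f) i (i + \<mu>)" "?G k = ?G k' * prod_minus (p^f) k' (k' + \<kappa>)"
       "?G (D - k') = ?G (D - k) * prod_minus (p^f) a (a + \<kappa>)"
      unfolding \<mu> \<kappa>(1) Dk[unfolded \<kappa>(1)] by (intro prod_minus_split; simp)+
    show ?thesis
    proof (cases "\<mu> < \<kappa>")
      case False
      have "\<epsilon> \<le> 1" by (simp add: \<epsilon>_def)
      obtain w where w: "\<mu> = \<kappa> + w" using False by (metis le_iff_add not_less)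
      obtain \<kappa>1 where \<kappa>1: "\<kappa> = Suc \<kappa>1" using \<kappa>(2) by (cases \<kappa>) auto
      \<comment> \<open>For \<mu> = \<kappa> + w the equality is a sum of nonnegative terms equal to 2 \<epsilon> \<le> 2.\<close>
      have "2 * \<epsilon> = f * (2 * \<kappa> ^ 2 + 4 * k' * w + 4 * \<kappa> * w + 4 * \<mu> * a + 2 * i * \<mu> + \<mu> * (\<mu> - 1)) + 2 * g * \<mu>"
      proof -
        have "\<mu> * (\<mu> - 1) + \<mu> = \<mu> * \<mu>" using \<mu>(2) by (cases \<mu>) auto
        hence "int (\<mu> * (\<mu> - 1)) = int \<mu> * int \<mu> - int \<mu>" by (metis add_diff_cancel_right' of_nat_add of_nat_mult)
        hence "int (f * (2 * \<kappa> ^ 2 + 4 * k' * w + 4 * \<kappa> * w + 4 * \<mu> * a + 2 * i * \<mu> + \<mu> * (\<mu> - 1)) + 2 * g * \<mu>) =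
          int f * (2 * int \<kappa> ^ 2 + 4 * int k' * int w + 4 * int \<kappa> * int w + 4 * int \<mu> * int a + 2 * int i * int \<mu> + (int \<mu> * int \<mu> - int \<mu>)) + 2 * int g * int \<mu>"
          by simp
        also have "\<dots> = 2 * int \<epsilon>"
          using arg_cong[OF v, of int] unfolding w by (simp add: power2_eq_square algebra_simps)
        finally show ?thesis by linarith
      qed
      hence "f * (2 * \<kappa> ^ 2 + 4 * k' * w + 4 * \<kappa> * w + 4 * \<mu> * a + 2 * i * \<mu> + \<mu> * (\<mu> - 1)) \<le> 2 * \<epsilon>" by simp
      moreover have "1 * (2 * \<kappa> ^ 2 + 4 * k' * w + 4 * \<kappa> * w + 4 * \<mu> * a + 2 * i * \<mu> + \<mu> * (\<mu> - 1)) \<le> f * (2 * \<kappa> ^ 2 + 4 * k' * w + 4 * \<kappa> * w + 4 * \<mu> * a + 2 * i * \<mu> + \<mu> * (\<mu> - 1))"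
        using f by (intro mult_le_mono1)
      ultimately have "1 * (2 * \<kappa> ^ 2 + 4 * k' * w + 4 * \<kappa> * w + 4 * \<mu> * a + 2 * i * \<mu> + \<mu> * (\<mu> - 1)) \<le> 2 * \<epsilon>" by - (rule order_trans)
      hence ge1: "2 * \<kappa> ^ 2 + 4 * k' * w + 4 * \<kappa> * w + 4 * \<mu> * a + 2 * i * \<mu> + \<mu> * (\<mu> - 1) \<le> 2 * \<epsilon>" by (simp only: mult_1)
      hence "2 * \<kappa>^2 \<le> 2" using \<open>\<epsilon> \<le> 1\<close> by linarith
      hence "\<kappa>^2 \<le> 1^2" by simp
      hence k1: "\<kappa> = 1" using \<kappa>(2) power2_le_imp_le[of \<kappa> 1] by simp
      have "\<epsilon> = 1" using ge1 k1 \<open>\<epsilon> \<le> 1\<close> by simp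
      hence z: "4 * w = 0" "4 * \<mu> * a = 0" "2 * i * \<mu> = 0" using ge1 k1 by simp_all
      hence w0: "w = 0" and \<mu>1: "\<mu> = 1" using w k1 by auto
      have "a = 0" "i = 0" using z \<mu>1 by auto
      have sp: "p = 2" "g = 0" using \<open>\<epsilon> = 1\<close> by (simp_all add: \<epsilon>_def split: if_splits)
      have "f = 1" using f1 \<open>\<epsilon> = 1\<close> by simp
      have "l' = l" using m \<kappa>(1) \<mu>(1) k1 \<mu>1 by simp
      have V1: "V' = V + 1" using V e'0 \<open>\<epsilon> = 1\<close> by simp
      have G1: "?G 1 = 1" "?G 0 = 1" using prod_minus_Suc[of 0 0 "p^f"] sp \<open>f = 1\<close> by simp_all
      have E: "?P k = 2 * ?P k'"
        unfolding PD \<open>a = 0\<close> k1 using prod_plus_Suc[of 0 0 "p^f" "p^g"] sp by simp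
      have "p ^ V * (2 * ?P k') * (?G l * ?G k' ^ 2 * 1 * 1) = p ^ (V + 1) * ?P k' * (?G l * ?G k ^ 2 * 1 * 1)"
      proof -
        have "?G i' = 1" "?G i = 1" "?G (D - k) = 1" "?G (D - k') = 1"
          unfolding \<mu>(1) \<mu>1 Dk \<open>a = 0\<close> k1 \<open>i = 0\<close> add_0 using G1 by simp_all
        thus ?thesis using cross unfolding E V1 \<open>l' = l\<close> by (simp only: mult_1_right)
      qed
      hence "(2 * p ^ V * ?P k' * ?G l) * ?G k' ^ 2 = (2 * p ^ V * ?P k' * ?G l) * ?G k ^ 2"
        using sp by (simp add: mult_ac)
      moreover have "2 * p ^ V * ?P k' * ?G l > 0" using Ppos[of k'] Gpos[of l] p_ge_2 by simp
      ultimately have "?G k' ^ 2 = ?G k ^ 2" by (metis mult_cancel1 less_irrefl)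
      hence "?G k' = ?G k" using power2_eq_imp_eq by blast
      hence "prod_minus (p^f) k' (k' + \<kappa>) = 1" using splits(2) Gpos[of k'] by simp
      hence "(2::nat) ^ Suc k' - 1 = 1"
        using prod_minus_Suc[of k' k' "p^f"] k1 sp \<open>f = 1\<close> by simp
      hence "(2::nat) ^ Suc k' = 2" by linarith
      hence "k' = 0" by simp
      hence "D = 1" using a k1 \<open>a = 0\<close> by simp
      thus ?thesis using exc sp \<open>f = 1\<close> by simp
    next
      case True
      obtain \<nu> where \<nu>: "\<kappa> = \<mu> + \<nu>" "\<nu> \<ge> 1" using True by (metis less_iff_Suc_add add_Suc_right le_add1 plus_1_eq_Suc)
      have l': "l' = l + \<nu>" using m \<kappa>(1) \<mu>(1) \<nu>(1) by simp
      have splitl: "?G l' = ?G l * prod_minus (p^f) l (l + \<nu>)"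
        unfolding l' by (intro prod_minus_split) auto
      let ?A = "prod_minus (p^f) i (i + \<mu>)" and ?B = "prod_minus (p^f) l (l + \<nu>)"
        and ?C = "prod_minus (p^f) a (a + \<kappa>)" and ?F = "prod_minus (p^f) k' (k' + \<kappa>)"
        and ?E = "prod_plus (p^f) (p^g) a (a + \<kappa>)"
      have "p ^ \<epsilon> = 1 + \<epsilon>" by (simp add: \<epsilon>_def)
      have ident: "?E * ?A * ?B * ?C = (1 + \<epsilon>) * ?F ^ 2"
      proof -
        let ?K = "p ^ V * ?P k' * ?G l * ?G k' ^ 2 * ?G i * ?G (D - k)"
        have "?K * (?E * ?A * ?B * ?C) = p ^ V * ?P k * (?G l' * ?G k' ^ 2 * ?G i' * ?G (D - k'))"
          unfolding PD splits splitl by (simp only: mult_ac)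
        also have "\<dots> = p ^ (V + \<epsilon>) * ?P k' * (?G l * ?G k ^ 2 * ?G i * ?G (D - k))"
          using cross V e'0 by simp
        also have "\<dots> = ?K * (p ^ \<epsilon> * ?F ^ 2)"
          unfolding splits(2) power_add power_mult_distrib by (simp only: mult_ac)
        finally have "?K * (?E * ?A * ?B * ?C) = ?K * ((1 + \<epsilon>) * ?F ^ 2)"
          unfolding \<open>p ^ \<epsilon> = 1 + \<epsilon>\<close> .
        moreover have "?K > 0" using Ppos[of k'] Gpos p_ge_2 by simp
        ultimately show ?thesis by (metis mult_cancel1 less_irrefl)
      qed
      have shift: "\<epsilon> = 0 \<and> f * a + g > 0 \<or> \<epsilon> = 1 \<and> p = 2 \<and> f = 1 \<and> g = 0 \<and> a = 0"
      proof (cases "f * a + g = 0")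
        case False
        hence "\<epsilon> = 0" using Dk f by (auto simp: \<epsilon>_def)
        thus ?thesis using False by simp
      next
        case z: True
        hence a0: "a = 0" "g = 0" using f by auto
        have "D > 0" "k = D" using a \<kappa> a0 by auto
        show ?thesis
        proof (cases "p = 2")
          case True
          hence "\<epsilon> = 1" using a0 \<open>D > 0\<close> \<open>k = D\<close> by (simp add: \<epsilon>_def)
          thus ?thesis using f1 True a0 by simp
        next
          case False
          hence e0: "\<epsilon> = 0" by (simp add: \<epsilon>_def)
          have "?E = 2 * prod_plus (p^f) (p^g) 1 (a + \<kappa>)"
            using prod_plus_first[of 0 "a + \<kappa>" "p^f" "p^g"] a0 \<kappa>(2) by simp
          moreover have "[int (prod_plus (p^f) (p^g) 1 (a + \<kappa>)) = 1] (mod int p ^ 1)"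
            using f by (intro cong_prod_plus) auto
          ultimately have E: "[int ?E = 2] (mod int p ^ 1)"
            using cong_scalar_left[of "int (prod_plus (p^f) (p^g) 1 (a + \<kappa>))" 1 "int p ^ 1" 2] by simp
          have "[int ?E * int ?A * int ?B * int ?C =
              2 * (-1)^(i + \<mu> - i) * (-1)^(l + \<nu> - l) * (-1)^(a + \<kappa> - a)] (mod int p ^ 1)"
            using f by (intro cong_mult E cong_prod_minus) auto
          hence L: "[int ?E * int ?A * int ?B * int ?C = 2] (mod int p ^ 1)"
            by (simp add: \<nu>(1) power_add mult_ac)
          have "[(int ?F)^2 = ((-1)^(k' + \<kappa> - k'))^2] (mod int p ^ 1)"
            using f by (intro cong_pow cong_prod_minus) auto
          hence F: "[(int ?F)^2 = 1] (mod int p ^ 1)" by (simp flip: power_mult)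
          have "int ?E * int ?A * int ?B * int ?C = (int ?F)^2"
            using arg_cong[OF ident, of int] e0 by simp
          hence "[2 = 1] (mod int p ^ 1)" using L F by (metis cong_sym cong_trans)
          hence "int p dvd 1" by (simp add: cong_iff_dvd_diff)
          thus ?thesis using p_ge_2 by simp
        qed
      qed
      from no_balanced_identity[OF \<nu>(1) \<mu>(2) \<nu>(2) shift v ident] show ?thesis ..
    qed
  qed
qed

end

lemma closed_form_inj:
  fixes p f g D m l k i l' k' i' N :: nat
  assumes p: "prime p" and f: "f \<ge> 1"
    and m: "l + k + i = m" "l' + k' + i' = m" and kD: "k \<le> D" "k' \<le> D" and N: "N > 0"
    and eq1: "N * (prod_minus (p^f) 0 l * prod_minus (p^f) 0 k ^ 2 * prod_minus (p^f) 0 i *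
        prod_minus (p^f) 0 (D - k)) = prod_minus (p^f) 0 m * prod_minus (p^f) 0 D *
        prod_plus (p^f) (p^g) (D - k) D * ((p^g) ^ i * (p^f) ^ (k^2 + 2 * D * i + \<Sum>{..<i}))"
    and eq2: "N * (prod_minus (p^f) 0 l' * prod_minus (p^f) 0 k' ^ 2 * prod_minus (p^f) 0 i' *
        prod_minus (p^f) 0 (D - k')) = prod_minus (p^f) 0 m * prod_minus (p^f) 0 D *
        prod_plus (p^f) (p^g) (D - k') D * ((p^g) ^ i' * (p^f) ^ (k'^2 + 2 * D * i' + \<Sum>{..<i'}))"
    and exc: "\<not> (p = 2 \<and> f = 1 \<and> g = 0 \<and> D = 1)" and m2: "D = 0 \<Longrightarrow> m \<ge> 2"
  shows "i = i' \<and> k = k'"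
proof -
  have e: "(p^g) ^ i * (p^f) ^ (k^2 + 2 * D * i + \<Sum>{..<i}) = p ^ p_exponent f g D i k" for i k
    by (simp add: p_exponent_def[OF p f] mult.commute add.commute flip: power_mult power_add)
  note eqs = eq1[unfolded e] eq2[unfolded e]
  show ?thesis
  proof (cases "i \<le> i'")
    case True
    show ?thesis by (rule closed_form_inj_ordered[OF p f m kD N eqs exc m2 True])
  next
    case False
    hence "i' \<le> i" by simp
    from closed_form_inj_ordered[OF p f m(2,1) kD(2,1) N eqs(2,1) exc m2 this] show ?thesis by simp
  qed
qed

section \<open>The valencies of the relations\<close>

context polar_geometry
begin

lemma card_related_pos:
  assumes "U \<in> related S l k m" shows "card (related S l k m) > 0"
proof -
  have "finite (related S l k m)"
    by (rule finite_subset[of _ "Pow UNIV"]) (blast, simp only: finite_Pow_iff finite_vectors)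
  thus ?thesis using assms by (auto simp: card_gt_0_iff)
qed

lemma card_related_cong:
  assumes "ti S" "ti S'" "dim S = m" "dim S' = m" "l + k \<le> m"
    and "\<And>A. ti A \<Longrightarrow> dim A \<le> d" "\<exists>A. ti A \<and> dim A = d"
  shows "card (related S l k m) = card (related S' l k m)"
proof -
  let ?w = "\<Prod>r<m. real q ^ (if r < l then l else if r < l + k then l + k else m) - real q ^ r"
  have "?w > 0"
    using q_ge_2 by (intro prod_pos) (auto simp del: of_nat_power)
  hence w: "?w \<noteq> 0" by (rule less_imp_neq[symmetric])
  have "real (card (related S l k m)) * ?w = real (card (related S' l k m)) * ?w"
    by (rule trans[OF card_related[OF assms(1,3,5,6,7)] card_related[OF assms(2,4,5,6,7), symmetric]])
  from mult_right_cancel[OF w, THEN iffD1, OF this] show ?thesis by (simp only: of_nat_eq_iff)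
qed

text \<open>
  The sum of \<open>S\<close> and \<open>U \<inter> S\<^sup>\<bottom>\<close> is totally isotropic of dimension \<open>m + k\<close>.
\<close>

lemma related_imp_dim_le:
  assumes "ti S" "dim S = m" "U \<in> related S l k m" and max: "\<And>A. ti A \<Longrightarrow> dim A \<le> d"
  shows "m + k \<le> d"
proof -
  have U: "ti U" "dim (U \<inter> S) = l" "dim (U \<inter> orthc S) = l + k"
    using assms(3) by (auto simp: related_def)
  let ?P = "U \<inter> orthc S"
  have subS: "subspace S" and subP: "subspace ?P"
    using assms(1) U(1) tiD(1) subspace_orthc by (auto intro: subspace_inter)
  have "ti ?P" by (rule ti_subset[OF U(1) subP]) simp
  hence "ti (span (S \<union> ?P))" by (intro ti_sum assms(1)) auto
  hence "dim (span (S \<union> ?P)) \<le> d" by (rule max)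
  moreover have "span (S \<union> ?P) = {x + y |x y. x \<in> S \<and> y \<in> ?P}"
    unfolding span_Un using subS subP by (simp only: span_eq_iff[THEN iffD2])
  moreover have "S \<inter> ?P = U \<inter> S" using tiD(3)[OF assms(1)] by blast
  ultimately show ?thesis using dim_sums_Int[OF subS subP] U assms(2) by simp
qed

text \<open>
  A totally isotropic subspace is contained in its orthogonal complement.
\<close>

lemma two_dim_ti_le: "2 * dim A \<le> dim UNIV" if "ti A"
proof -
  have "card A \<le> card (orthc A)" using tiD(3)[OF that] by (intro card_mono finite_vectors)
  hence "card A * card A \<le> q ^ dim UNIV" unfolding card_orthc_ti[OF that, symmetric] by simp
  hence "q ^ (2 * dim A) \<le> q ^ dim UNIV"
    unfolding card_subspace[OF tiD(1)[OF that]] by (simp add: mult_2 power_add)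
  thus ?thesis using q_ge_2 by simp
qed

lemma ex_ti_dim:
  assumes "ti A" "m \<le> dim A" shows "\<exists>S. ti S \<and> dim S = m"
proof -
  obtain B where B: "B \<subseteq> A" "independent B" "card B = dim A"
    using basis_exists[of A] by metis
  then obtain C where C: "C \<subseteq> B" "card C = m"
    using assms(2) by (metis obtain_subset_with_card_n)
  have "independent C" using B(2) C(1) by (rule independent_mono)
  hence "dim (span C) = m" using C(2) by (simp add: dim_eq_card_independent)
  moreover have "span C \<subseteq> A" using B C tiD(1)[OF assms(1)] by (intro span_minimal) auto
  hence "ti (span C)" by (intro ti_subset[OF assms(1)]) auto
  ultimately show ?thesis by blast
qed

end

text \<open>
  A quadratic form that vanishes on a subspace has a polarization that vanishes there as well.
\<close>

lemma vanishes_on_subspace_iff: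
  fixes scale :: "'f::{field,finite} \<Rightarrow> 'v::ab_group_add \<Rightarrow> 'v" and F :: "('f, 'v) form"
  assumes "polar_geometry scale Basis (\<lambda>x y. pairing F x y = 0) (\<lambda>x. vanishes_on F {x}) t q"
    and "module.subspace scale S"
  shows "vanishes_on F S \<longleftrightarrow>
    polar_geometry.ti scale (\<lambda>x y. pairing F x y = 0) (\<lambda>x. vanishes_on F {x}) S"
proof -
  interpret polar_geometry scale Basis "\<lambda>x y. pairing F x y = 0" "\<lambda>x. vanishes_on F {x}" t q
    by (rule assms(1))
  have "ti S \<longleftrightarrow> (\<forall>x\<in>S. vanishes_on F {x}) \<and> (\<forall>x\<in>S. \<forall>y\<in>S. pairing F x y = 0)"
    using assms(2) by (auto simp only: ti_def orthc_def)
  moreover have "pairing F x y = 0" if "vanishes_on F S" "x \<in> S" "y \<in> S" for x y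
    using that subspace_add[OF assms(2)] by (cases F) (simp_all add: polarization_def)
  ultimately show ?thesis by (cases F) auto
qed

lemma valency_eqI:
  assumes "N \<noteq> {}" "\<And>S. S \<in> N \<Longrightarrow> card (R `` {S}) = c"
  shows "valency N R = c"
  unfolding valency_def
proof (rule the_equality)
  fix c' assume "\<forall>S\<in>N. card (R `` {S}) = c'"
  thus "c' = c" using assms by auto
qed (use assms in auto)

theorem proposition3:
  fixes scale :: "'f::{field,finite} \<Rightarrow> 'v::ab_group_add \<Rightarrow> 'v"
    and Basis :: "'v set"
    and F :: "('f, 'v) form"
    and n d m i j i' j' :: nat
  assumes "finite_dimensional_vector_space scale Basis"
    and "vector_space.dim scale (UNIV :: 'v set) = n"
    and "nondegenerate_form scale F"
    and "witt_index scale F = d"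
    and "2 \<le> d" and "1 \<le> m" and "m \<le> d"
    and "\<not> (is_quad F \<and> CARD('f) = 2 \<and> n = 2 * d \<and> m + 1 = d)"
    and "i \<le> j" and "j \<le> m" and "i' \<le> j'" and "j' \<le> m"
    and "(i, j) \<noteq> (i', j')"
    and "isotropic_relation scale F m i j \<noteq> {} \<or>
         isotropic_relation scale F m i' j' \<noteq> {}"
  shows "valency (isotropic_subspaces scale F m)
           (isotropic_relation scale F m i j) \<noteq>
         valency (isotropic_subspaces scale F m)
           (isotropic_relation scale F m i' j')"
proof
  let ?N = "isotropic_subspaces scale F m" and ?R = "isotropic_relation scale F m"
  assume valency_eq: "valency ?N (?R i j) = valency ?N (?R i' j')"
  obtain e where pg: "polar_geometry scale Basis (\<lambda>x y. pairing F x y = 0) (\<lambda>x. vanishes_on F {x})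
      (CHAR('f) ^ e) CARD('f)" and e: "is_sesqui F \<longrightarrow> CARD('f) = 2 \<longrightarrow> e \<noteq> 0"
    using nondegenerate_form_polar_geometry[OF assms(1,3)] by blast
  interpret polar_geometry scale Basis "\<lambda>x y. pairing F x y = 0" "\<lambda>x. vanishes_on F {x}"
      "CHAR('f) ^ e" "CARD('f)"
    by (rule pg)
  let ?q = "CARD('f)" and ?p = "CHAR('f)"
  have p: "prime ?p"
    by (rule prime_CHAR_semidom) (rule finite_imp_CHAR_pos, simp)
  obtain f where q: "?q = ?p ^ f"
    using card_additive_subgroup[of "UNIV :: 'f set"] by auto
  have f: "f \<ge> 1"
  proof (rule ccontr)
    assume "\<not> f \<ge> 1"
    hence "?q = 1" unfolding q by simp
    thus False using q_ge_2 by simp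
  qed

  have ti_iff: "subspace S \<and> vanishes_on F S \<longleftrightarrow> ti S" for S
    using vanishes_on_subspace_iff[OF pg, of S] tiD(1)[of S] by blast
  have N: "?N = {S. ti S \<and> dim S = m}"
    unfolding isotropic_subspaces_def using ti_iff by blast
  let ?D = "{dim S |S. subspace S \<and> vanishes_on F S}"
  have "dim T \<le> n" for T using dim_subset[OF subset_UNIV, of T] by (simp only: assms(2))
  hence "?D \<subseteq> {..n}" by blast
  hence fin: "finite ?D" by (rule finite_subset) simp
  have d: "Max ?D = d" using assms(4) by (simp add: witt_index_def)
  have max: "dim A \<le> d" if "ti A" for A
    unfolding d[symmetric] using that fin ti_iff by (intro Max_ge) auto
  have ex: "\<exists>A. ti A \<and> dim A = d"
  proof -
    have "?D \<noteq> {}" using ti_iff ti_zero by blast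
    with fin have "Max ?D \<in> ?D" by (rule Max_in)
    thus ?thesis unfolding d using ti_iff by auto
  qed
  then obtain A where A: "ti A" "dim A = d" by blast
  obtain S where S: "ti S" "dim S = m" using ex_ti_dim[OF A(1), of m] A(2) assms(7) by auto

  have image: "?R i j `` {T} = related T (m - j) (j - i) m"
    if "ti T" "dim T = m" "i \<le> j" "j \<le> m" for T i j
  proof -
    have "orth F T = orthc T" by (simp add: orth_def orthc_def)
    moreover have "m - j + (j - i) = m - i" using that by simp
    ultimately show ?thesis
      using that unfolding isotropic_relation_def N related_def by (auto simp: Int_commute)
  qed
  have val: "valency ?N (?R i j) = card (related S (m - j) (j - i) m)" if "i \<le> j" "j \<le> m" for i j
  proof (rule valency_eqI)
    show "?N \<noteq> {}" unfolding N using S by blast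
    show "card (?R i j `` {T}) = card (related S (m - j) (j - i) m)" if "T \<in> ?N" for T
    proof -
      have T: "ti T" "dim T = m" using that by (auto simp: N)
      show ?thesis
        unfolding image[OF T \<open>i \<le> j\<close> \<open>j \<le> m\<close>]
        using \<open>i \<le> j\<close> \<open>j \<le> m\<close> by (intro card_related_cong[OF T(1) S(1) T(2) S(2) _ max ex]) simp_all
    qed
  qed
  have pos: "card (related S (m - j) (j - i) m) > 0" if "?R i j \<noteq> {}" "i \<le> j" "j \<le> m" for i j
  proof -
    obtain T U where "(T, U) \<in> ?R i j" using \<open>?R i j \<noteq> {}\<close> by auto
    hence T: "ti T" "dim T = m" and "U \<in> ?R i j `` {T}"
      by (auto simp: isotropic_relation_def N)
    hence "U \<in> related T (m - j) (j - i) m" using image that by blast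
    hence "card (related T (m - j) (j - i) m) > 0" by (rule card_related_pos)
    moreover have "card (related T (m - j) (j - i) m) = card (related S (m - j) (j - i) m)"
      using that by (intro card_related_cong[OF T(1) S(1) T(2) S(2) _ max ex]) simp_all
    ultimately show ?thesis by simp
  qed
  define X where "X = card (related S (m - j) (j - i) m)"
  have X: "X = card (related S (m - j) (j - i) m)" "X = card (related S (m - j') (j' - i') m)"
    using valency_eq assms(9-12) by (simp_all add: val X_def)
  have "X > 0" using assms(9-12,14) pos X by metis

  define D where "D = d - m"
  have D: "d = D + m" using assms(7) by (simp add: D_def)
  have n: "2 * d \<le> n" using two_dim_ti_le[OF A(1)] A(2) assms(2) by simp
  \<comment> \<open>The number s = t q^(n - 2 d) of the closed form equals p^g.\<close>
  define g where "g = e + f * (n - 2 * d)"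
  have closed: "j - i \<le> D \<and> X * (prod_minus ?q 0 (m - j) * prod_minus ?q 0 (j - i) ^ 2 * prod_minus ?q 0 i *
        prod_minus ?q 0 (D - (j - i))) = prod_minus ?q 0 m * prod_minus ?q 0 D *
        prod_plus ?q (?p^g) (D - (j - i)) D *
        ((?p^g) ^ i * ?q ^ ((j - i)^2 + 2 * D * i + \<Sum>{..<i}))"
    if ij: "i \<le> j" "j \<le> m" and Xij: "X = card (related S (m - j) (j - i) m)" for i j
  proof -
    have m: "m - j + (j - i) + i = m" and le: "m - j + (j - i) \<le> m" using ij by auto
    obtain U where "U \<in> related S (m - j) (j - i) m"
      using \<open>X > 0\<close> Xij by (metis card.empty equals0I less_irrefl)
    hence "m + (j - i) \<le> d" by (rule related_imp_dim_le[OF S _ max])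
    hence kD: "j - i \<le> D" using D by simp
    have W: "?p ^ e * ?q ^ n = ?p ^ g * ?q ^ (2 * (D + (m - j + (j - i) + i)))"
    proof -
      have "?q ^ n = ?q ^ (n - 2 * d) * ?q ^ (2 * d)" using n by (simp flip: power_add)
      moreover have "?p ^ g = ?p ^ e * ?q ^ (n - 2 * d)" by (simp add: g_def q power_add power_mult)
      ultimately show ?thesis unfolding m D by (simp only: mult.assoc)
    qed
    note card_related_closed_form[OF q_ge_2 kD W, unfolded m,
        OF card_related[OF S le max ex, folded Xij, unfolded assms(2) D]]
    with kD show ?thesis by (rule conjI)
  qed
  have c: "j - i \<le> D" "j' - i' \<le> D" and
      eqs: "X * (prod_minus (?p^f) 0 (m - j) * prod_minus (?p^f) 0 (j - i) ^ 2 * prod_minus (?p^f) 0 i *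
        prod_minus (?p^f) 0 (D - (j - i))) = prod_minus (?p^f) 0 m * prod_minus (?p^f) 0 D *
        prod_plus (?p^f) (?p^g) (D - (j - i)) D *
        ((?p^g) ^ i * (?p^f) ^ ((j - i)^2 + 2 * D * i + \<Sum>{..<i}))"
      "X * (prod_minus (?p^f) 0 (m - j') * prod_minus (?p^f) 0 (j' - i') ^ 2 * prod_minus (?p^f) 0 i' *
        prod_minus (?p^f) 0 (D - (j' - i'))) = prod_minus (?p^f) 0 m * prod_minus (?p^f) 0 D *
        prod_plus (?p^f) (?p^g) (D - (j' - i')) D *
        ((?p^g) ^ i' * (?p^f) ^ ((j' - i')^2 + 2 * D * i' + \<Sum>{..<i'}))"
    using closed[OF assms(9,10) X(1)] closed[OF assms(11,12) X(2)] unfolding q by blast+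
  \<comment> \<open>Over two scalars, s = 1 means t = 1 and n = 2 d: a quadratic form of maximal Witt index.\<close>
  have exc: "\<not> (?p = 2 \<and> f = 1 \<and> g = 0 \<and> D = 1)"
  proof
    assume *: "?p = 2 \<and> f = 1 \<and> g = 0 \<and> D = 1"
    hence "?q = 2" "e = 0" "n = 2 * d" "m + 1 = d" using q n D by (auto simp: g_def)
    moreover have "is_quad F" using e \<open>?q = 2\<close> \<open>e = 0\<close> by (cases F) auto
    ultimately show False using assms(8) by blast
  qed
  have "i = i' \<and> j - i = j' - i'"
  proof (rule closed_form_inj[OF p f _ _ c \<open>X > 0\<close> eqs exc])
    show "m - j + (j - i) + i = m" "m - j' + (j' - i') + i' = m" using assms(9-12) by auto
    show "2 \<le> m" if "D = 0" using that D assms(5) by simp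
  qed
  thus False using assms(9,11,13) by auto
qed

end
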